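(* Let $m,n\ge 1$ and $m+n>k\ge 2$. The representation of $\mathfrak{S}_m\times \mathfrak{S}_n$ on the unique nonvanishing (top-dimensional, dimension $m+n-k-1$) reduced rational homology of the shellable cut complex $\Delta_k(K_m+K_n)$ is \[ V_{(k,1^{m+n-k})} \big\downarrow_{\mathfrak{S}_m\times \mathfrak{S}_n}^{\mathfrak{S}_{m+n}} -V_{(k,1^{m-k})}\otimes V_{(1^n)} - V_{(1^m)}\otimes V_{(k,1^{n-k})}, \] where if $m<k$ the module $V_{(k,1^{m-k})}$ (and hence $V_{(k,1^{m-k})}\otimes V_{(1^n)}$) is interpreted as zero, and similarly if $n<k$. In particular, the unique nonzero Betti number of the cut complex is \[ \binom{m+n-1}{k-1}-\binom{m-1}{k-1}-\binom{n-1}{k-1}. \]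
   Context: $K_r$ is the complete graph on $r$ vertices and $K_m+K_n$ is the disjoint union of $K_m$ (on vertex set $[m]$) and $K_n$ (on a disjoint copy of $[n]$); $\mathfrak{S}_m\times\mathfrak{S}_n$ acts by permuting the vertices of each component. For a graph $G=(V,E)$ with $|V|=N$ and $k\ge 2$, the $k$-cut complex $\Delta_k(G)$ is the simplicial complex on $V$ whose facets are the subsets $F\subseteq V$ with $|F|=N-k$ such that the induced subgraph $G[V\setminus F]$ is disconnected. $V_\lambda$ denotes the irreducible rational $\mathfrak{S}_r$-module indexed by the partition $\lambda$ of $r$; $(k,1^{r-k})$ is the hook partition and $V_{(1^r)}$ is the sign representation. The down arrow denotes restriction, and the formula is an equality of (virtual) $\mathfrak{S}_m\times\mathfrak{S}_n$-modules; binomial coefficients $\binom{a}{b}$ with $a<b$ are $0$. *)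

theory Defs
  imports
    Complex_Main
    "HOL-Algebra.Sym_Groups"
    "HOL-Algebra.Module"
    "HOL-Algebra.AbelCoset"
    "HOL-Library.Function_Algebras"
begin

section \<open>Graphs, cut complexes and shellability\<close>

text \<open>A simple graph is a pair of a vertex set and a set of two-element edges.\<close>

type_synonym 'a graph = "'a set \<times> 'a set set"

definition complete_graph :: "'a set \<Rightarrow> 'a graph" where
  "complete_graph A = (A, {e. e \<subseteq> A \<and> card e = 2})"

definition graph_sum :: "'a graph \<Rightarrow> 'b graph \<Rightarrow> ('a + 'b) graph" where
  "graph_sum G H =
     (Inl ` fst G \<union> Inr ` fst H, image Inl ` snd G \<union> image Inr ` snd H)"

definition induced_graph :: "'a graph \<Rightarrow> 'a set \<Rightarrow> 'a graph" where
  "induced_graph G S = (fst G \<inter> S, {e \<in> snd G. e \<subseteq> S})"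

definition connected_graph :: "'a graph \<Rightarrow> bool" where
  "connected_graph G \<longleftrightarrow> fst G \<noteq> {} \<and>
     (\<forall>u\<in>fst G. \<forall>v\<in>fst G. (u, v) \<in> {(x, y). {x, y} \<in> snd G}\<^sup>*)"

text \<open>Simplicial complexes are given by their sets of faces, the empty face included.\<close>

definition cut_complex :: "nat \<Rightarrow> 'a graph \<Rightarrow> 'a set set" where
  "cut_complex k G =
     {\<sigma>. \<exists>F. \<sigma> \<subseteq> F \<and> F \<subseteq> fst G \<and> card F + k = card (fst G)
          \<and> \<not> connected_graph (induced_graph G (fst G - F))}"

definition facets :: "'a set set \<Rightarrow> 'a set set" where
  "facets \<Delta> = {F \<in> \<Delta>. \<forall>\<sigma>\<in>\<Delta>. F \<subseteq> \<sigma> \<longrightarrow> \<sigma> = F}"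

definition complex_dim :: "'a set set \<Rightarrow> int" where
  "complex_dim \<Delta> = int (Max (card ` \<Delta>)) - 1"

text \<open>A shelling is an ordering of the facets such that each facet after the first
  meets the complex generated by its predecessors in a pure complex of codimension one.\<close>

definition shellable :: "'a set set \<Rightarrow> bool" where
  "shellable \<Delta> \<longleftrightarrow> (\<exists>Fs. distinct Fs \<and> set Fs = facets \<Delta> \<and>
     (\<forall>j. 0 < j \<and> j < length Fs \<longrightarrow>
        (\<forall>\<sigma> \<in> facets {\<sigma>. \<sigma> \<subseteq> Fs ! j \<and> (\<exists>i<j. \<sigma> \<subseteq> Fs ! i)}. card \<sigma> + 1 = card (Fs ! j))))"


section \<open>Rational representations\<close>

text \<open>A representation over the rationals: a module record together with an action.
  As usual for modules in HOL-Algebra, the ring fields \<^const>\<open>mult\<close> and \<^const>\<open>one\<close>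
  of the record carry no information.\<close>

record ('g, 'v) rep = "(rat, 'v) module" +
  action :: "'g \<Rightarrow> 'v \<Rightarrow> 'v"

definition lin_iso ::
    "('v \<Rightarrow> 'w) \<Rightarrow> (rat, 'v, 'x) module_scheme \<Rightarrow> (rat, 'w, 'y) module_scheme \<Rightarrow> bool" where
  "lin_iso f M N \<longleftrightarrow>
     bij_betw f (carrier M) (carrier N) \<and>
     (\<forall>u\<in>carrier M. \<forall>v\<in>carrier M. f (u \<oplus>\<^bsub>M\<^esub> v) = f u \<oplus>\<^bsub>N\<^esub> f v) \<and>
     (\<forall>c. \<forall>v\<in>carrier M. f (c \<odot>\<^bsub>M\<^esub> v) = c \<odot>\<^bsub>N\<^esub> f v)"

definition rep_iso :: "('g, 'z) monoid_scheme \<Rightarrow> ('g, 'v) rep \<Rightarrow> ('g, 'w) rep \<Rightarrow> bool" where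
  "rep_iso G M N \<longleftrightarrow> (\<exists>f. lin_iso f M N \<and>
     (\<forall>g\<in>carrier G. \<forall>v\<in>carrier M. f (action M g v) = action N g (f v)))"

definition fun_module :: "('x \<Rightarrow> rat) set \<Rightarrow> (rat, 'x \<Rightarrow> rat) module" where
  "fun_module V =
     \<lparr>carrier = V, mult = undefined, one = undefined,
      zero = (\<lambda>x. 0), add = (\<lambda>f h x. f x + h x), smult = (\<lambda>c f x. c * f x)\<rparr>"

definition has_dim :: "(rat, 'v, 'x) module_scheme \<Rightarrow> nat \<Rightarrow> bool" where
  "has_dim M d \<longleftrightarrow> (\<exists>f. lin_iso f (fun_module {a :: nat \<Rightarrow> rat. \<forall>i\<ge>d. a i = 0}) M)"

definition fun_rep :: "('x \<Rightarrow> rat) set \<Rightarrow> ('g \<Rightarrow> ('x \<Rightarrow> rat) \<Rightarrow> ('x \<Rightarrow> rat)) \<Rightarrow> ('g, 'x \<Rightarrow> rat) rep" where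
  "fun_rep V \<rho> = module.extend (fun_module V) \<lparr>action = \<rho>\<rparr>"

definition restrict_rep :: "('h \<Rightarrow> 'g) \<Rightarrow> ('g, 'v) rep \<Rightarrow> ('h, 'v) rep" where
  "restrict_rep \<iota> M = module.extend (module.truncate M) \<lparr>action = (\<lambda>h. action M (\<iota> h))\<rparr>"

text \<open>Rational representations of a finite group are cancellable under direct sums, so an identity
  \<open>[A] = [B] - [C]\<close> between classes of representations says that \<open>A \<oplus> C\<close> and \<open>B\<close> are
  isomorphic.\<close>

definition dsum_rep :: "('g, 'v) rep \<Rightarrow> ('g, 'w) rep \<Rightarrow> ('g, 'v \<times> 'w) rep" where
  "dsum_rep M N =
     \<lparr>carrier = carrier M \<times> carrier N, mult = undefined, one = undefined,
      zero = (\<zero>\<^bsub>M\<^esub>, \<zero>\<^bsub>N\<^esub>),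
      add = (\<lambda>(u, v) (u', v'). (u \<oplus>\<^bsub>M\<^esub> u', v \<oplus>\<^bsub>N\<^esub> v')),
      smult = (\<lambda>c (u, v). (c \<odot>\<^bsub>M\<^esub> u, c \<odot>\<^bsub>N\<^esub> v)),
      action = (\<lambda>g (u, v). (action M g u, action N g v))\<rparr>"

text \<open>The quotient by an invariant submodule \<^term>\<open>U\<close>, carried by the cosets of \<^term>\<open>U\<close>.\<close>

definition quotient_rep :: "('g, 'v) rep \<Rightarrow> 'v set \<Rightarrow> ('g, 'v set) rep" where
  "quotient_rep M U =
     \<lparr>carrier = a_rcosets\<^bsub>M\<^esub> U, mult = undefined, one = undefined,
      zero = U,
      add = set_add M,
      smult = (\<lambda>c X. \<Union>v\<in>X. U +>\<^bsub>M\<^esub> (c \<odot>\<^bsub>M\<^esub> v)),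
      action = (\<lambda>g X. action M g ` X)\<rparr>"

interpretation rat_fun: vector_space "(\<lambda>c f x. c * f x) :: rat \<Rightarrow> ('x \<Rightarrow> rat) \<Rightarrow> ('x \<Rightarrow> rat)"
  by unfold_locales (auto simp: fun_eq_iff algebra_simps)

text \<open>The outer tensor product of two representations carried by spaces of functions (with
  pointwise operations): the span of the functions \<open>u \<otimes> v = (\<lambda>(x, y). u x * v y)\<close>.
  If \<open>F\<close> lies in this span, then all its slices \<open>F (x, -)\<close> lie in \<open>N\<close> and all its slices
  \<open>F (-, y)\<close> lie in \<open>M\<close>; letting \<open>h\<close> act on the former and then \<open>g\<close> on the latter is the linear
  map that takes \<open>u \<otimes> v\<close> to \<open>(g u) \<otimes> (h v)\<close>.\<close>

definition tensor_rep ::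
    "('g, 'x \<Rightarrow> rat) rep \<Rightarrow> ('h, 'y \<Rightarrow> rat) rep \<Rightarrow> ('g \<times> 'h, 'x \<times> 'y \<Rightarrow> rat) rep" where
  "tensor_rep M N = fun_rep
     (rat_fun.span {(\<lambda>(x, y). u x * v y) | u v. u \<in> carrier M \<and> v \<in> carrier N})
     (\<lambda>(g, h) F (x, y). action M g (\<lambda>x'. action N h (\<lambda>y'. F (x', y')) y) x)"


section \<open>Specht modules\<close>

text \<open>The irreducible rational representation of the symmetric group indexed by a partition
  \<open>\<mu>\<close> (a weakly decreasing list of positive parts) is the Specht module: the span of the
  polytabloids in the permutation module on tabloids. A tableau is a bijective filling of the
  cells (row, column), both counted from 0, and its tabloid is the list of the sets of entries of
  its rows.\<close>

definition cells :: "nat list \<Rightarrow> (nat \<times> nat) set" where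
  "cells \<mu> = {(i, j). i < length \<mu> \<and> j < \<mu> ! i}"

definition tableaux :: "nat list \<Rightarrow> (nat \<times> nat \<Rightarrow> nat) set" where
  "tableaux \<mu> = {t. bij_betw t (cells \<mu>) {1..sum_list \<mu>}}"

definition tabloid :: "nat list \<Rightarrow> (nat \<times> nat \<Rightarrow> nat) \<Rightarrow> nat set list" where
  "tabloid \<mu> t = map (\<lambda>i. {t (i, j) | j. (i, j) \<in> cells \<mu>}) [0..<length \<mu>]"

definition column_stabilizer :: "nat list \<Rightarrow> (nat \<times> nat \<Rightarrow> nat) \<Rightarrow> (nat \<Rightarrow> nat) set" where
  "column_stabilizer \<mu> t = {\<pi>. \<pi> permutes {1..sum_list \<mu>} \<and>
     (\<forall>j. \<pi> ` {t (i, j) | i. (i, j) \<in> cells \<mu>} = {t (i, j) | i. (i, j) \<in> cells \<mu>})}"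

text \<open>The polytabloid of \<open>t\<close>, the signed sum of the tabloids of \<open>\<pi> \<circ> t\<close> over the column
  stabilizer, as its function of coefficients.\<close>

definition polytabloid :: "nat list \<Rightarrow> (nat \<times> nat \<Rightarrow> nat) \<Rightarrow> nat set list \<Rightarrow> rat" where
  "polytabloid \<mu> t X =
     (\<Sum>\<pi> \<in> column_stabilizer \<mu> t. if tabloid \<mu> (\<pi> \<circ> t) = X then of_int (sign \<pi>) else 0)"

definition specht :: "nat list \<Rightarrow> (nat \<Rightarrow> nat, nat set list \<Rightarrow> rat) rep" where
  "specht \<mu> = fun_rep (rat_fun.span (polytabloid \<mu> ` tableaux \<mu>))
     (\<lambda>\<pi> f X. f (map (image (inv_into UNIV \<pi>)) X))"

text \<open>The hook \<open>(k, 1, ..., 1)\<close>, with the zero module for \<open>r < k\<close>.\<close>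

definition hook_rep :: "nat \<Rightarrow> nat \<Rightarrow> (nat \<Rightarrow> nat, nat set list \<Rightarrow> rat) rep" where
  "hook_rep k r =
     (if k \<le> r then specht (k # replicate (r - k) 1) else fun_rep {\<lambda>X. 0} (\<lambda>\<pi> f. f))"

definition sign_rep :: "nat \<Rightarrow> (nat \<Rightarrow> nat, nat set list \<Rightarrow> rat) rep" where
  "sign_rep r = specht (replicate r 1)"

text \<open>The embedding of the product of the symmetric groups on \<open>{1..m}\<close> and \<open>{1..n}\<close> into the
  symmetric group on \<open>{1..m + n}\<close>.\<close>

definition young_embedding :: "nat \<Rightarrow> (nat \<Rightarrow> nat) \<times> (nat \<Rightarrow> nat) \<Rightarrow> nat \<Rightarrow> nat" where
  "young_embedding m = (\<lambda>(\<sigma>, \<tau>) i. if i \<le> m then \<sigma> i else m + \<tau> (i - m))"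


section \<open>Reduced simplicial homology\<close>

text \<open>Oriented \<open>p\<close>-chains of a finite complex, as functions of coefficients: \<open>c [v\<^sub>0, \<dots>, v\<^sub>p]\<close>
  is the coefficient in \<open>c\<close> of the oriented simplex \<open>[v\<^sub>0, \<dots>, v\<^sub>p]\<close>, so it changes sign
  when two vertices are exchanged. The empty face spans the chains in degree \<open>-1\<close>.\<close>

definition chains :: "'a set set \<Rightarrow> int \<Rightarrow> ('a list \<Rightarrow> rat) set" where
  "chains \<Delta> p = {c.
     (\<forall>xs. c xs \<noteq> 0 \<longrightarrow> distinct xs \<and> set xs \<in> \<Delta> \<and> int (length xs) = p + 1) \<and>
     (\<forall>xs i j. i < j \<and> j < length xs \<longrightarrow> c (xs[i := xs ! j, j := xs ! i]) = - c xs)}"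

text \<open>Since the boundary of \<open>[v\<^sub>0, \<dots>, v\<^sub>p]\<close> is the alternating sum of its faces, the coefficient
  of \<open>[v\<^sub>1, \<dots>, v\<^sub>p]\<close> in the boundary of \<open>c\<close> is the sum over all vertices \<open>v\<^sub>0\<close> of the
  coefficients \<open>c [v\<^sub>0, v\<^sub>1, \<dots>, v\<^sub>p]\<close>.\<close>

definition boundary :: "'a set set \<Rightarrow> ('a list \<Rightarrow> rat) \<Rightarrow> 'a list \<Rightarrow> rat" where
  "boundary \<Delta> c xs = (\<Sum>v \<in> \<Union>\<Delta>. c (v # xs))"

definition cycles :: "'a set set \<Rightarrow> int \<Rightarrow> ('a list \<Rightarrow> rat) set" where
  "cycles \<Delta> p = {c \<in> chains \<Delta> p. boundary \<Delta> c = (\<lambda>xs. 0)}"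

definition boundaries :: "'a set set \<Rightarrow> int \<Rightarrow> ('a list \<Rightarrow> rat) set" where
  "boundaries \<Delta> p = boundary \<Delta> ` chains \<Delta> (p + 1)"

text \<open>Here \<open>\<phi> g\<close> is the permutation of the vertices by which \<open>g\<close> acts; the induced action
  takes \<open>[v\<^sub>0, \<dots>, v\<^sub>p]\<close> to \<open>[\<phi> g v\<^sub>0, \<dots>, \<phi> g v\<^sub>p]\<close>.\<close>

definition homology_rep ::
    "('g \<Rightarrow> 'a \<Rightarrow> 'a) \<Rightarrow> 'a set set \<Rightarrow> int \<Rightarrow> ('g, ('a list \<Rightarrow> rat) set) rep" where
  "homology_rep \<phi> \<Delta> p = quotient_rep
     (fun_rep (cycles \<Delta> p) (\<lambda>g c xs. c (map (inv_into UNIV (\<phi> g)) xs)))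
     (boundaries \<Delta> p)"

end

theory Submission
  imports Defs "HOL-Library.Nat_Bijection"
begin

text \<open>Write \<open>N = m + n\<close>. A set of vertices is a face of the cut complex iff it has at most \<open>N - k\<close>
  elements and contains neither of the two cliques, so the complex is the \<open>(N - k - 1)\<close>-skeleton
  of a join of two simplex boundaries. The complements of its facets are the bases of a matroid.
  Ordering the facets by the binary weight of their complements gives a shelling: exchange the
  largest element by which a complement differs from an earlier one.

  For a set \<open>A\<close> let \<open>Z\<^sub>p(A)\<close> be the cycles of the full simplex on \<open>A\<close> that are supported on
  \<open>p\<close>-element sets. The Specht module of \<open>(k, 1, \<dots>, 1)\<close> is \<open>Z\<^sub>r\<^sub>-\<^sub>k([r])\<close>, since polytabloids are
  boundaries of simplices, and the sign representation is the case \<open>k = 1\<close>. For cycles \<open>u\<close> on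
  \<open>[m]\<close> and \<open>v\<close> on \<open>[n]\<close> and barycentres \<open>a\<close>, \<open>b\<close> of these two sets, the boundary of
  \<open>a \<and> u \<and> b \<and> v\<close> is up to signs \<open>u \<and> b \<and> v\<close> plus \<open>a \<and> u \<and> v\<close>, a cycle on the disjoint
  union \<open>V\<close> that depends equivariantly on \<open>u\<close> and \<open>v\<close>. If \<open>v\<close> is the cycle of dimension
  \<open>n - 2\<close>, then its part on the sets containing \<open>[n]\<close> determines \<open>u\<close> and equals
  the corresponding part of any prescribed chain on \<open>V\<close> whose boundary has no such part. As
  \<open>k \<ge> 2\<close>, it has no part on the sets containing \<open>[m]\<close>. Subtracting these products moves a chain
  into the cut complex without changing its boundary. For chains whose boundary is a given cycle
  this shows that the homology below the top degree vanishes. For cycles it splits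
  \<open>Z\<^sub>N\<^sub>-\<^sub>k(V)\<close> into the top homology of the cut complex and the two tensor products.\<close>


section \<open>Alternating functions of lists\<close>

text \<open>The decomposition is a split exact sequence. With \<open>L = N - k\<close>, restricting
  a cycle on \<open>V\<close> with \<open>L\<close> vertices to the simplices that contain
  \<open>[n]\<close> gives a cycle on \<open>[m]\<close> tensored with the sign of
  \<open>[n]\<close>, and likewise with the cliques exchanged. Cycles with both restrictions zero
  are the cycles of the cut complex, and these are its top homology because no face has more than
  \<open>L\<close> vertices. Products with top cycles split the two restrictions. Coning over a
  vertex would give a splitting equivariant only under the stabiliser of that vertex; the barycentre
  averages over all vertices, which uses rational coefficients and takes the place of Maschke's
  theorem. The correction by products asks only that the boundary of a chain have no part on
  simplices containing a clique, so that one lemma serves both the vanishing below the top and the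
  representation at the top. Chains are graded by the number of vertices instead of the dimension:
  the empty face sits in degree 0, and truncated subtraction has to be watched only where a hook
  degenerates to the zero module.\<close>

definition alternating :: "('a list \<Rightarrow> rat) \<Rightarrow> bool" where
  "alternating c \<longleftrightarrow> (\<forall>xs a b ys. c (xs @ a # b # ys) = - c (xs @ b # a # ys))"

lemma alternatingD:
  assumes "alternating c"
  shows "c (xs @ a # b # ys) = - c (xs @ b # a # ys)"
  by (rule assms[unfolded alternating_def, rule_format])

lemma alternatingI:
  assumes "\<And>xs a b ys. c (xs @ a # b # ys) = - c (xs @ b # a # ys)"
  shows "alternating c"
  unfolding alternating_def by (intro allI assms)

lemma alternating_append:
  assumes "alternating c"
  shows "alternating (\<lambda>xs. c (us @ xs))"
proof (rule alternatingI)
  fix xs a b ys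
  show "c (us @ xs @ a # b # ys) = - c (us @ xs @ b # a # ys)"
    using alternatingD[OF assms, of "us @ xs" a b ys] by simp
qed

lemma alternating_Cons: "alternating c \<Longrightarrow> alternating (\<lambda>xs. c (u # xs))"
  using alternating_append[of c "[u]"] by simp

lemma alternating_shift:
  assumes "alternating c"
  shows "c (x # us @ vs) = (-1) ^ length us * c (us @ x # vs)"
  using assms
proof (induction us arbitrary: c)
  case (Cons u us)
  have "c (x # (u # us) @ vs) = - c (u # x # us @ vs)"
    using alternatingD[OF Cons.prems, of "[]" x u "us @ vs"] by simp
  also have "c (u # x # us @ vs) = (-1) ^ length us * c (u # us @ x # vs)"
    using Cons.IH[OF alternating_Cons[OF Cons.prems]] .
  finally show ?case by simp
qed simp

lemma alternating_swap:
  assumes "alternating c"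
  shows "c (as @ x # bs @ y # cs) = - c (as @ y # bs @ x # cs)"
proof -
  have "c (as @ x # bs @ y # cs) = (-1) ^ length bs * c (as @ bs @ x # y # cs)" for x y
    using alternating_shift[OF alternating_append[OF assms, of as], of x bs "y # cs"]
    by simp
  moreover have "c (as @ bs @ x # y # cs) = - c (as @ bs @ y # x # cs)"
    using alternatingD[OF assms, of "as @ bs" x y cs] by simp
  ultimately show ?thesis by (simp only: mult_minus_right)
qed

text \<open>Swapping a repeated entry with itself shows that the value is its own negative.\<close>

lemma alternating_distinct:
  assumes "alternating c" "c xs \<noteq> 0"
  shows "distinct xs"
proof (rule ccontr)
  assume "\<not> distinct xs"
  then obtain as y bs cs where "xs = as @ [y] @ bs @ [y] @ cs"
    using not_distinct_decomp by blast
  then show False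
    using alternating_swap[OF assms(1), of as y bs y cs] assms(2) by simp
qed

lemma list_update_swap_decomp:
  assumes "i < j" "j < length xs"
  obtains as x bs y cs where "xs = as @ x # bs @ y # cs"
    "xs[i := xs ! j, j := xs ! i] = as @ y # bs @ x # cs"
proof -
  define as where "as = take i xs"
  define bs where "bs = take (j - Suc i) (drop (Suc i) xs)"
  define cs where "cs = drop (Suc j) xs"
  have xs: "xs = as @ xs ! i # drop (Suc i) xs"
    unfolding as_def using assms by (simp add: id_take_nth_drop)
  have "drop (Suc i) xs = bs @ drop (Suc i) xs ! (j - Suc i) # drop (Suc (j - Suc i)) (drop (Suc i) xs)"
    unfolding bs_def using assms by (intro id_take_nth_drop) auto
  then have "drop (Suc i) xs = bs @ xs ! j # cs"
    using assms by (simp add: cs_def)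
  with xs have decomp: "xs = as @ xs ! i # bs @ xs ! j # cs" by simp
  obtain d where d: "j = Suc (i + d)"
    using less_imp_Suc_add[OF assms(1)] by blast
  have len: "length as = i" "length bs = d"
    using assms d by (auto simp: as_def bs_def)
  have *: "(as @ x # bs @ y # cs)[i := y, j := x] = as @ y # bs @ x # cs" for x y
    using len by (simp add: list_update_append d)
  have "xs[i := xs ! j, j := xs ! i] = (as @ xs ! i # bs @ xs ! j # cs)[i := xs ! j, j := xs ! i]"
    using arg_cong[OF decomp, of "\<lambda>ys. ys[i := xs ! j, j := xs ! i]"] .
  then have "xs[i := xs ! j, j := xs ! i] = as @ xs ! j # bs @ xs ! i # cs"
    by (simp only: *)
  from that[OF decomp this] show ?thesis .
qed

text \<open>Bridges two forms of the sign rule: adjacent entries suit induction along a list,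
  arbitrary positions are what \<open>chains\<close> prescribes.\<close>

lemma alternating_iff_swap:
  "alternating c \<longleftrightarrow>
     (\<forall>xs i j. i < j \<and> j < length xs \<longrightarrow> c (xs[i := xs ! j, j := xs ! i]) = - c xs)"
  (is "_ \<longleftrightarrow> ?swap")
proof
  assume c: "alternating c"
  show ?swap
  proof (intro allI impI, elim conjE)
    fix xs :: "'a list" and i j
    assume "i < j" "j < length xs"
    then obtain as x bs y cs where *: "xs = as @ x # bs @ y # cs"
      "xs[i := xs ! j, j := xs ! i] = as @ y # bs @ x # cs"
      by (rule list_update_swap_decomp)
    show "c (xs[i := xs ! j, j := xs ! i]) = - c xs"
      unfolding *(2) by (subst *(1)) (rule alternating_swap[OF c])
  qed
next
  assume R: ?swap
  show "alternating c"
    unfolding alternating_def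
  proof (intro allI)
    fix xs ys :: "'a list" and a b
    define zs where "zs = xs @ b # a # ys"
    have "zs ! length xs = b" "zs ! Suc (length xs) = a"
      by (simp_all add: zs_def nth_append)
    moreover have "zs[length xs := a, Suc (length xs) := b] = xs @ a # b # ys"
      by (simp add: zs_def list_update_append)
    moreover have "c (zs[length xs := zs ! Suc (length xs), Suc (length xs) := zs ! length xs]) = - c zs"
      by (rule R[rule_format]) (simp add: zs_def)
    ultimately show "c (xs @ a # b # ys) = - c (xs @ b # a # ys)"
      by (simp only: zs_def[symmetric])
  qed
qed

text \<open>The sign of the rearrangement is the same for both functions and never has to be named.
  Comparison with zero shows that vanishing depends only on the entries.\<close>

lemma alternating_eqI:
  assumes "alternating c" "alternating c'" "mset ys = mset xs" "c xs = c' xs"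
  shows "c ys = c' ys"
  using assms
proof (induction xs arbitrary: c c' ys)
  case (Cons x xs)
  then have "x \<in> set ys" by (metis list.set_intros(1) mset_eq_setD)
  then obtain us vs where ys: "ys = us @ x # vs" by (meson split_list)
  with Cons.prems have "mset (us @ vs) = mset xs" by simp
  then have "c (x # us @ vs) = c' (x # us @ vs)"
    by (rule Cons.IH[OF alternating_Cons[OF Cons.prems(1)] alternating_Cons[OF Cons.prems(2)]])
      (rule Cons.prems(4))
  then show ?case
    unfolding ys
    using alternating_shift[OF Cons.prems(1), of x us vs] alternating_shift[OF Cons.prems(2), of x us vs]
    by simp
qed simp

lemma alternating_zero: "alternating (\<lambda>_. 0)"
  by (simp add: alternating_def)

lemma alternating_add:
  assumes "alternating c" "alternating c'"
  shows "alternating (\<lambda>xs. c xs + c' xs)"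
  by (rule alternatingI, subst (1) alternatingD[OF assms(1)], subst (1) alternatingD[OF assms(2)]) simp

lemma alternating_scale:
  assumes "alternating c"
  shows "alternating (\<lambda>xs. r * c xs)"
  by (rule alternatingI, subst alternatingD[OF assms]) simp

lemma alternating_sum:
  assumes "\<And>i. i \<in> I \<Longrightarrow> alternating (c i)"
  shows "alternating (\<lambda>xs. \<Sum>i\<in>I. c i xs)"
  unfolding alternating_def sum_negf[symmetric]
  by (intro allI sum.cong refl alternatingD assms)

lemma alternating_vanish:
  assumes "alternating c" "mset ys = mset xs" "c xs = 0"
  shows "c ys = 0"
  using alternating_eqI[OF assms(1) alternating_zero assms(2)] assms(3) by simp

lemma alternating_relabel:
  assumes "alternating c"
  shows "alternating (\<lambda>xs. c (map h xs))"
proof (rule alternatingI)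
  fix xs a b ys
  show "c (map h (xs @ a # b # ys)) = - c (map h (xs @ b # a # ys))"
    using alternatingD[OF assms, of "map h xs" "h a" "h b" "map h ys"] by simp
qed

section \<open>Chains of the full simplex on a vertex set\<close>

definition alt_chains :: "'a set \<Rightarrow> nat \<Rightarrow> ('a list \<Rightarrow> rat) set" where
  "alt_chains A L = {c. alternating c \<and> (\<forall>xs. c xs \<noteq> 0 \<longrightarrow> set xs \<subseteq> A \<and> length xs = L)}"

lemma alt_chainsD:
  assumes "c \<in> alt_chains A L"
  shows "alternating c" "c xs \<noteq> 0 \<Longrightarrow> set xs \<subseteq> A" "c xs \<noteq> 0 \<Longrightarrow> length xs = L"
    "c xs \<noteq> 0 \<Longrightarrow> distinct xs"
  using assms alternating_distinct by (auto simp: alt_chains_def)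

lemma alt_chainsI:
  assumes "alternating c" "\<And>xs. c xs \<noteq> 0 \<Longrightarrow> set xs \<subseteq> A \<and> length xs = L"
  shows "c \<in> alt_chains A L"
  using assms by (auto simp: alt_chains_def)

lemma subspace_alt_chains: "rat_fun.subspace (alt_chains A L)"
proof (rule rat_fun.subspaceI)
  show "0 \<in> alt_chains A L"
    by (auto simp: alt_chains_def alternating_def)
  show "x + y \<in> alt_chains A L" if "x \<in> alt_chains A L" "y \<in> alt_chains A L" for x y
  proof (rule alt_chainsI)
    show "alternating (x + y)"
      using that alternating_add by (auto simp: alt_chains_def plus_fun_def)
    show "set xs \<subseteq> A \<and> length xs = L" if "(x + y) xs \<noteq> 0" for xs
    proof -
      have "x xs \<noteq> 0 \<or> y xs \<noteq> 0" using that by auto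
      then show ?thesis
        using \<open>x \<in> _\<close> \<open>y \<in> _\<close> by (auto simp: alt_chains_def)
    qed
  qed
  show "(\<lambda>xs. c * x xs) \<in> alt_chains A L" if "x \<in> alt_chains A L" for c x
    using that by (auto simp: alt_chains_def alternating_scale)
qed

lemma alt_chains_eq_0:
  assumes "c \<in> alt_chains A L" "finite A" "card A < L"
  shows "c = 0"
proof
  fix xs
  show "c xs = 0 xs"
  proof (rule ccontr)
    assume "c xs \<noteq> 0 xs"
    then have "c xs \<noteq> 0" by simp
    note * = alt_chainsD[OF assms(1)] this
    have "L = card (set xs)" using *(3-5) by (metis distinct_card)
    also have "\<dots> \<le> card A" using * assms(2) by (simp add: card_mono)
    finally show False using assms(3) by simp
  qed
qed

text \<open>In the top degree all lists in the support are rearrangements of one another, so the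
  chains form a line.\<close>

lemma alt_chains_top_eqI:
  assumes c: "c \<in> alt_chains A (card A)" and c': "c' \<in> alt_chains A (card A)"
    and xs: "set xs = A" "distinct xs" and eq: "c xs = c' xs"
  shows "c = c'"
proof
  fix ys
  show "c ys = c' ys"
  proof (cases "set ys \<subseteq> A \<and> length ys = card A \<and> distinct ys")
    case True
    then have "card (set ys) = card A" by (simp add: distinct_card)
    then have "set ys = A" using True xs(1) by (metis List.finite_set card_subset_eq)
    then have "mset ys = mset xs"
      using True xs set_eq_iff_mset_eq_distinct by metis
    then show ?thesis
      using alternating_eqI alt_chainsD(1)[OF c] alt_chainsD(1)[OF c'] eq by blast
  next
    case False
    then show ?thesis using alt_chainsD(2-4)[OF c] alt_chainsD(2-4)[OF c'] by metis
  qed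
qed


section \<open>Boundary and cone\<close>

definition bdry :: "'a set \<Rightarrow> ('a list \<Rightarrow> rat) \<Rightarrow> 'a list \<Rightarrow> rat" where
  "bdry A c xs = (\<Sum>v\<in>A. c (v # xs))"

definition alt_cycles :: "'a set \<Rightarrow> nat \<Rightarrow> ('a list \<Rightarrow> rat) set" where
  "alt_cycles A L = {c \<in> alt_chains A L. bdry A c = 0}"

lemma bdry_add: "bdry A (c + c') = bdry A c + bdry A c'"
  by (auto simp: bdry_def fun_eq_iff sum.distrib)

lemma bdry_scale: "bdry A (\<lambda>xs. r * c xs) = (\<lambda>xs. r * bdry A c xs)"
  by (auto simp: bdry_def fun_eq_iff sum_distrib_left)

lemma bdry_zero: "bdry A 0 = 0"
  by (auto simp: bdry_def fun_eq_iff)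

lemma subspace_alt_cycles: "rat_fun.subspace (alt_cycles A L)"
proof (rule rat_fun.subspaceI)
  show "0 \<in> alt_cycles A L"
    using rat_fun.subspace_0[OF subspace_alt_chains] by (simp add: alt_cycles_def bdry_zero)
  show "c + c' \<in> alt_cycles A L" if "c \<in> alt_cycles A L" "c' \<in> alt_cycles A L" for c c'
    using that by (auto simp: alt_cycles_def bdry_add intro: rat_fun.subspace_add[OF subspace_alt_chains])
  show "(\<lambda>xs. r * c xs) \<in> alt_cycles A L" if "c \<in> alt_cycles A L" for r c
    using that
    by (auto simp: alt_cycles_def bdry_scale fun_eq_iff intro: rat_fun.subspace_scale[OF subspace_alt_chains])
qed

lemma bdry_alt_chains:
  assumes "c \<in> alt_chains A (Suc L)"
  shows "bdry A c \<in> alt_chains A L"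
proof (rule alt_chainsI)
  show "alternating (bdry A c)"
    unfolding bdry_def[abs_def] by (rule alternating_sum) (rule alternating_Cons[OF alt_chainsD(1)[OF assms]])
  show "set xs \<subseteq> A \<and> length xs = L" if "bdry A c xs \<noteq> 0" for xs
  proof -
    from that[unfolded bdry_def] obtain v where "c (v # xs) \<noteq> 0"
      by (rule sum.not_neutral_contains_not_neutral)
    then show ?thesis using alt_chainsD(2,3)[OF assms, of "v # xs"] by auto
  qed
qed

text \<open>Exchanging the two new vertices flips every summand but permutes the double sum, which
  is therefore its own negative.\<close>

lemma bdry_bdry:
  assumes "alternating c"
  shows "bdry A (bdry A c) = 0"
proof
  fix xs
  have "bdry A (bdry A c) xs = (\<Sum>v\<in>A. \<Sum>w\<in>A. c (w # v # xs))"
    by (simp add: bdry_def)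
  also have "\<dots> = (\<Sum>v\<in>A. \<Sum>w\<in>A. - c (v # w # xs))"
    by (intro sum.cong refl alternatingD[OF assms, of "[]", simplified])
  also have "\<dots> = (\<Sum>w\<in>A. \<Sum>v\<in>A. - c (v # w # xs))"
    by (rule sum.swap)
  also have "\<dots> = - bdry A (bdry A c) xs"
    by (simp add: bdry_def sum_negf)
  finally show "bdry A (bdry A c) xs = 0 xs" by simp
qed

lemma bdry_in_alt_cycles: "c \<in> alt_chains A (Suc L) \<Longrightarrow> bdry A c \<in> alt_cycles A L"
  by (simp add: alt_cycles_def bdry_alt_chains bdry_bdry alt_chainsD(1))

lemma bdry_relabel:
  assumes "bij_betw h A B"
  shows "bdry A (\<lambda>xs. c (map h xs)) xs = bdry B c (map h xs)"
  unfolding bdry_def using sum.reindex_bij_betw[OF assms, of "\<lambda>v. c (v # map h xs)"] by simp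

text \<open>The exterior product \<open>w \<and> c\<close> with the vector of coefficients \<open>w\<close>, expanded along
  the first vertex.\<close>

primrec wedge :: "('a \<Rightarrow> rat) \<Rightarrow> ('a list \<Rightarrow> rat) \<Rightarrow> 'a list \<Rightarrow> rat" where
  "wedge w c [] = 0"
| "wedge w c (x # xs) = w x * c xs - wedge w (\<lambda>ys. c (x # ys)) xs"

lemma wedge_zero [simp]: "wedge w (\<lambda>_. 0) xs = 0"
  by (induction xs) auto

lemma wedge_add: "wedge w (\<lambda>xs. c xs + c' xs) xs = wedge w c xs + wedge w c' xs"
  by (induction xs arbitrary: c c') (auto simp: algebra_simps)

lemma wedge_scale: "wedge w (\<lambda>xs. r * c xs) xs = r * wedge w c xs"
  by (induction xs arbitrary: c) (auto simp: algebra_simps)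

lemma wedge_sum: "wedge w (\<lambda>xs. \<Sum>i\<in>I. c i xs) xs = (\<Sum>i\<in>I. wedge w (c i) xs)"
  by (induction I rule: infinite_finite_induct) (auto simp: wedge_add)

lemma wedge_relabel:
  assumes "\<And>x. w' (h x) = w x"
  shows "wedge w (\<lambda>xs. c (map h xs)) xs = wedge w' c (map h xs)"
  by (induction xs arbitrary: c) (auto simp: assms)

lemma wedge_support:
  assumes "wedge w c xs \<noteq> 0" and "\<And>ys. c ys \<noteq> 0 \<Longrightarrow> set ys \<subseteq> A \<and> length ys = L"
    and "\<And>x. w x \<noteq> 0 \<Longrightarrow> x \<in> A"
  shows "set xs \<subseteq> A \<and> length xs = Suc L"
  using assms(1,2)
proof (induction xs arbitrary: c L)
  case (Cons x xs)
  show ?case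
  proof (cases "w x * c xs = 0")
    case True
    then have w: "wedge w (\<lambda>ys. c (x # ys)) xs \<noteq> 0" using Cons.prems(1) by auto
    then have "(\<lambda>ys. c (x # ys)) \<noteq> (\<lambda>_. 0)" by (metis wedge_zero)
    \<comment> \<open>A nonzero value on a list starting with \<open>x\<close> shows that
      \<open>L\<close> is positive; the induction hypothesis is then used one degree lower, for the
      slice of \<open>c\<close> at \<open>x\<close>.\<close>
    then obtain ys where "c (x # ys) \<noteq> 0" by auto
    from Cons.prems(2)[OF this] obtain L' where L: "L = Suc L'" and "x \<in> A" by auto
    have "set xs \<subseteq> A \<and> length xs = Suc L'"
      by (rule Cons.IH[OF w]) (use Cons.prems(2) L in fastforce)
    then show ?thesis using L \<open>x \<in> A\<close> by auto
  next
    case False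
    then show ?thesis using Cons.prems(2)[of xs] assms(3)[of x] by auto
  qed
qed simp

lemma alternating_wedge:
  assumes "alternating c"
  shows "alternating (wedge w c)"
  unfolding alternating_def
proof (intro allI)
  fix xs ys a b
  show "wedge w c (xs @ a # b # ys) = - wedge w c (xs @ b # a # ys)"
    using assms
  proof (induction xs arbitrary: c)
    \<comment> \<open>Expanding twice, the terms with \<open>w a\<close> and \<open>w b\<close>
      trade places with opposite signs; only the remaining term depends on \<open>c\<close> being
      alternating.\<close>
    case Nil
    have "(\<lambda>zs. c (b # a # zs)) = (\<lambda>zs. (-1) * c (a # b # zs))"
      using alternatingD[OF Nil.prems, of "[]" b a] by (intro ext) simp
    then have "wedge w (\<lambda>zs. c (b # a # zs)) ys = - wedge w (\<lambda>zs. c (a # b # zs)) ys"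
      by (simp only: wedge_scale)
    then show ?case by simp
  next
    case (Cons x xs)
    show ?case
      using Cons.IH[OF alternating_Cons[OF Cons.prems], of x] alternatingD[OF Cons.prems, of xs a b ys]
      by (simp del: wedge.simps add: wedge.simps(2))
  qed
qed

lemma wedge_alt_chains:
  assumes "c \<in> alt_chains A L" "\<And>x. w x \<noteq> 0 \<Longrightarrow> x \<in> A"
  shows "wedge w c \<in> alt_chains A (Suc L)"
proof (rule alt_chainsI)
  show "alternating (wedge w c)"
    by (rule alternating_wedge[OF alt_chainsD(1)[OF assms(1)]])
  show "set xs \<subseteq> A \<and> length xs = Suc L" if "wedge w c xs \<noteq> 0" for xs
    by (rule wedge_support[OF that]) (use assms in \<open>auto simp: alt_chains_def\<close>)
qed

text \<open>The contracting homotopy of the simplex. The wedge is expanded along the first vertex,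
  which is the one the boundary sums over, so the recursion gives the formula directly.\<close>

lemma bdry_wedge:
  assumes "sum w A = 1"
  shows "bdry A (wedge w c) xs = c xs - wedge w (bdry A c) xs"
proof -
  have "bdry A (wedge w c) xs = (\<Sum>v\<in>A. w v * c xs - wedge w (\<lambda>ys. c (v # ys)) xs)"
    by (simp add: bdry_def)
  also have "\<dots> = sum w A * c xs - wedge w (\<lambda>ys. \<Sum>v\<in>A. c (v # ys)) xs"
    by (simp add: sum_subtractf sum_distrib_right wedge_sum)
  finally show ?thesis using assms by (simp add: bdry_def[abs_def])
qed

lemma bdry_wedge_cycle:
  assumes "sum w A = 1" "bdry A c = 0"
  shows "bdry A (wedge w c) = c"
  using bdry_wedge[OF assms(1), of c] assms(2) by (auto simp: fun_eq_iff zero_fun_def)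

definition barycentre :: "'a set \<Rightarrow> 'a \<Rightarrow> rat" where
  "barycentre A x = (if x \<in> A then 1 / of_nat (card A) else 0)"

lemma sum_barycentre: "finite A \<Longrightarrow> A \<noteq> {} \<Longrightarrow> sum (barycentre A) A = 1"
  by (simp add: barycentre_def)

lemma barycentre_support: "barycentre A x \<noteq> 0 \<Longrightarrow> x \<in> A"
  by (simp add: barycentre_def split: if_splits)

lemma barycentre_permutes: "\<sigma> permutes A \<Longrightarrow> barycentre A (\<sigma> x) = barycentre A x"
  by (simp add: barycentre_def permutes_in_image)


section \<open>Dimensions of spaces of functions\<close>

abbreviation scale_fun :: "rat \<Rightarrow> ('x \<Rightarrow> rat) \<Rightarrow> 'x \<Rightarrow> rat" where
  "scale_fun \<equiv> \<lambda>c f x. c * f x"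

interpretation rat_fun_pair: vector_space_pair
  "scale_fun :: rat \<Rightarrow> ('x \<Rightarrow> rat) \<Rightarrow> _" "scale_fun :: rat \<Rightarrow> ('y \<Rightarrow> rat) \<Rightarrow> _"
  by unfold_locales

lemma linear_funI:
  assumes "\<And>f g. T (f + g) = T f + T g" "\<And>c f. T (\<lambda>x. c * f x) = (\<lambda>x. c * T f x)"
  shows "Vector_Spaces.linear scale_fun scale_fun T"
  by (intro Vector_Spaces.linear.intro module_hom.intro module_hom_axioms.intro
      rat_fun.vector_space_axioms rat_fun.module_axioms assms)

lemma sum_fun_apply: "(\<Sum>i\<in>I. f i) x = (\<Sum>i\<in>I. f i x)" for f :: "'i \<Rightarrow> 'x \<Rightarrow> rat"
  by (induction I rule: infinite_finite_induct) auto

text \<open>The ambient spaces of functions on lists are infinite-dimensional, so finiteness is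
  carried along as a property of each subspace.\<close>

definition fin_dim :: "('x \<Rightarrow> rat) set \<Rightarrow> bool" where
  "fin_dim V \<longleftrightarrow> rat_fun.subspace V \<and> (\<exists>W. finite W \<and> V \<subseteq> rat_fun.span W)"

lemma fin_dim_subset: "fin_dim V \<Longrightarrow> rat_fun.subspace U \<Longrightarrow> U \<subseteq> V \<Longrightarrow> fin_dim U"
  unfolding fin_dim_def by (meson order_trans)

lemma fin_dim_basis:
  assumes "fin_dim V"
  obtains B where "finite B" "rat_fun.independent B" "rat_fun.span B = V" "card B = rat_fun.dim V"
proof -
  obtain W where W: "rat_fun.subspace V" "finite W" "V \<subseteq> rat_fun.span W"
    using assms by (auto simp: fin_dim_def)
  obtain B where B: "B \<subseteq> V" "rat_fun.independent B" "V \<subseteq> rat_fun.span B" "card B = rat_fun.dim V"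
    using rat_fun.basis_exists by blast
  have "finite B"
    using rat_fun.independent_span_bound[OF W(2) B(2)] B(1) W(3) by blast
  moreover have "rat_fun.span B = V"
    using B W(1) by (simp add: rat_fun.span_subspace)
  ultimately show ?thesis using B that by blast
qed

lemma dim_inj_image:
  assumes T: "Vector_Spaces.linear scale_fun scale_fun T" and V: "fin_dim V" and inj: "inj_on T V"
  shows "rat_fun.dim (T ` V) = rat_fun.dim V"
proof -
  obtain B where B: "finite B" "rat_fun.independent B" "rat_fun.span B = V" "card B = rat_fun.dim V"
    using fin_dim_basis[OF V] .
  have "rat_fun.independent (T ` B)"
    by (rule rat_fun_pair.linear_independent_injective_image[OF T B(2)]) (simp add: B(3) inj)
  moreover have "rat_fun.span (T ` B) = T ` V"
    using rat_fun_pair.linear_span_image[OF T] B(3) by auto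
  moreover have "B \<subseteq> V" using B(3) rat_fun.span_superset by blast
  then have "card (T ` B) = card B"
    using inj card_image inj_on_subset by blast
  ultimately show ?thesis using B(4) rat_fun.dim_span_eq_card_independent by metis
qed

lemma fin_dim_image:
  assumes T: "Vector_Spaces.linear scale_fun scale_fun T" and V: "fin_dim V"
  shows "fin_dim (T ` V)"
proof -
  obtain B where B: "finite B" "rat_fun.span B = V"
    using fin_dim_basis[OF V] .
  have "rat_fun.span (T ` B) = T ` V"
    using rat_fun_pair.linear_span_image[OF T] B(2) by auto
  then show ?thesis
    unfolding fin_dim_def using B(1) by (metis finite_imageI order_refl rat_fun.subspace_span)
qed

lemma dim_zero: "rat_fun.dim {0 :: 'x \<Rightarrow> rat} = 0"
  by (rule rat_fun.dim_unique[of "{}"]) (auto simp: rat_fun.independent_empty)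

lemma fin_dim_zero: "fin_dim {0 :: 'x \<Rightarrow> rat}"
  unfolding fin_dim_def by (intro conjI rat_fun.subspace_single_0 exI[of _ "{}"]) auto

lemma dim_direct_sum:
  assumes U: "fin_dim U" and W: "fin_dim W" and inter: "U \<inter> W = {0}"
  shows "rat_fun.dim {u + w | u w. u \<in> U \<and> w \<in> W} = rat_fun.dim U + rat_fun.dim W"
    and "fin_dim {u + w | u w. u \<in> U \<and> w \<in> W}"
proof -
  obtain B where B: "finite B" "rat_fun.independent B" "rat_fun.span B = U" "card B = rat_fun.dim U"
    using fin_dim_basis[OF U] .
  obtain C where C: "finite C" "rat_fun.independent C" "rat_fun.span C = W" "card C = rat_fun.dim W"
    using fin_dim_basis[OF W] .
  have span: "rat_fun.span (B \<union> C) = {u + w | u w. u \<in> U \<and> w \<in> W}"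
    using B(3) C(3) by (simp add: rat_fun.span_Un)
  have "0 \<notin> B" using B(2) rat_fun.dependent_zero by blast
  have "B \<subseteq> U" "C \<subseteq> W"
    using rat_fun.span_superset[of B] rat_fun.span_superset[of C] unfolding B(3) C(3) .
  then have "B \<inter> C \<subseteq> {0}" unfolding inter[symmetric] by (rule Int_mono)
  then have disj: "B \<inter> C = {}" using \<open>0 \<notin> B\<close> by auto
  have "rat_fun.independent (B \<union> C)"
  proof (rule rat_fun.independent_if_scalars_zero)
    show "finite (B \<union> C)" using B C by simp
    fix f :: "('a \<Rightarrow> rat) \<Rightarrow> rat" and x
    assume sum: "(\<Sum>v\<in>B \<union> C. scale_fun (f v) v) = 0" and x: "x \<in> B \<union> C"
    let ?u = "\<Sum>v\<in>B. scale_fun (f v) v" and ?w = "\<Sum>v\<in>C. scale_fun (f v) v"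
    have uw: "?u + ?w = 0"
      using sum disj B(1) C(1) by (simp add: sum.union_disjoint)
    have "?u \<in> U" unfolding B(3)[symmetric]
      by (intro rat_fun.span_sum rat_fun.span_scale rat_fun.span_base)
    moreover have "?w \<in> W" unfolding C(3)[symmetric]
      by (intro rat_fun.span_sum rat_fun.span_scale rat_fun.span_base)
    moreover have "?u = - ?w" using uw by (simp add: eq_neg_iff_add_eq_0)
    moreover have "- ?w \<in> W"
      using \<open>?w \<in> W\<close> W by (auto simp: fin_dim_def intro: rat_fun.subspace_neg)
    ultimately have "?u \<in> U \<inter> W" by simp
    then have "?u = 0" unfolding inter by simp
    with uw have "?w = 0" by simp
    show "f x = 0"
      using x
    proof
      assume "x \<in> B"
      then show ?thesis by (rule rat_fun.independentD[OF B(2,1) order_refl \<open>?u = 0\<close>])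
    next
      assume "x \<in> C"
      then show ?thesis by (rule rat_fun.independentD[OF C(2,1) order_refl \<open>?w = 0\<close>])
    qed
  qed
  then have "rat_fun.dim (rat_fun.span (B \<union> C)) = card (B \<union> C)"
    by (rule rat_fun.dim_span_eq_card_independent)
  also have "\<dots> = card B + card C" using disj B(1) C(1) by (simp add: card_Un_disjoint)
  finally show "rat_fun.dim {u + w | u w. u \<in> U \<and> w \<in> W} = rat_fun.dim U + rat_fun.dim W"
    using span B(4) C(4) by simp
  show "fin_dim {u + w | u w. u \<in> U \<and> w \<in> W}"
    unfolding fin_dim_def span[symmetric] using B(1) C(1)
    by (intro conjI rat_fun.subspace_span exI[of _ "B \<union> C"]) auto
qed

lemma fun_module_simps [simp]:
  "carrier (fun_module V) = V" "\<zero>\<^bsub>fun_module V\<^esub> = (\<lambda>x. 0)"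
  "f \<oplus>\<^bsub>fun_module V\<^esub> g = (\<lambda>x. f x + g x)" "c \<odot>\<^bsub>fun_module V\<^esub> f = (\<lambda>x. c * f x)"
  by (simp_all add: fun_module_def)

lemma has_dim_fun_module:
  assumes "fin_dim V"
  shows "has_dim (fun_module V) (rat_fun.dim V)"
proof -
  define d where "d = rat_fun.dim V"
  obtain B where B: "finite B" "rat_fun.independent B" "rat_fun.span B = V" "card B = d"
    using fin_dim_basis[OF assms] unfolding d_def .
  obtain b where b: "bij_betw b {..<d} B"
    using B(1,4) by (metis card_lessThan finite_lessThan finite_same_card_bij)
  define T :: "(nat \<Rightarrow> rat) \<Rightarrow> 'a \<Rightarrow> rat" where "T = (\<lambda>a x. \<Sum>i<d. a i * b i x)"
  have T_eq: "T a = (\<Sum>v\<in>B. scale_fun (a (inv_into {..<d} b v)) v)" for a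
  proof
    fix x
    have "T a x = (\<Sum>i<d. a (inv_into {..<d} b (b i)) * b i x)"
      unfolding T_def using b by (intro sum.cong) (auto simp: bij_betw_def)
    also have "\<dots> = (\<Sum>v\<in>B. a (inv_into {..<d} b v) * v x)"
      by (rule sum.reindex_bij_betw[OF b])
    finally show "T a x = (\<Sum>v\<in>B. scale_fun (a (inv_into {..<d} b v)) v) x"
      by (simp add: sum_fun_apply)
  qed
  let ?A = "{a :: nat \<Rightarrow> rat. \<forall>i\<ge>d. a i = 0}"
  have "inj_on T ?A"
  proof (rule inj_onI)
    fix a a' assume a: "a \<in> ?A" "a' \<in> ?A" and eq: "T a = T a'"
    show "a = a'"
    proof
      fix i
      show "a i = a' i"
      proof (cases "i < d")
        case True
        have "(\<Sum>v\<in>B. scale_fun ((a - a') (inv_into {..<d} b v)) v) = T a - T a'"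
          unfolding T_eq by (auto simp: fun_eq_iff sum_fun_apply algebra_simps sum_subtractf)
        also have "\<dots> = 0" using eq by simp
        finally have "(a - a') (inv_into {..<d} b (b i)) = 0"
          by (rule rat_fun.independentD[OF B(2,1) order_refl]) (use True b in \<open>auto simp: bij_betw_def\<close>)
        then show ?thesis using True b by (simp add: bij_betw_def)
      qed (use a in simp)
    qed
  qed
  moreover have "T ` ?A = V"
  proof
    show "T ` ?A \<subseteq> V"
      unfolding B(3)[symmetric]
      by (auto simp: T_eq intro!: rat_fun.span_sum rat_fun.span_scale intro: rat_fun.span_base)
    show "V \<subseteq> T ` ?A"
    proof
      fix x assume "x \<in> V"
      then obtain u where u: "x = (\<Sum>v\<in>B. scale_fun (u v) v)"
        unfolding B(3)[symmetric] rat_fun.span_finite[OF B(1)] by auto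
      define a where "a = (\<lambda>i. if i < d then u (b i) else 0)"
      have "a (inv_into {..<d} b v) = u v" if "v \<in> B" for v
      proof -
        have "inv_into {..<d} b v \<in> {..<d}" "b (inv_into {..<d} b v) = v"
          using that b by (metis bij_betw_def inv_into_into, metis bij_betw_def f_inv_into_f)
        then show ?thesis by (simp add: a_def)
      qed
      then have "T a = x" unfolding T_eq u by (intro sum.cong) auto
      then show "x \<in> T ` ?A" by (intro image_eqI[of _ _ a]) (auto simp: a_def)
    qed
  qed
  moreover have "T (\<lambda>x. u x + v x) = (\<lambda>x. T u x + T v x)" for u v
    by (auto simp: T_def algebra_simps sum.distrib)
  moreover have "T (\<lambda>x. c * u x) = (\<lambda>x. c * T u x)" for c u
    by (auto simp: T_def algebra_simps sum_distrib_left)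
  ultimately show ?thesis
    unfolding has_dim_def lin_iso_def d_def[symmetric] bij_betw_def by (intro exI[of _ T]) simp
qed


section \<open>Oriented simplices\<close>

text \<open>The coefficient function of an oriented simplex. The sum over permutations is chosen to
  match the sum over the column stabilizer in \<open>polytabloid\<close>.\<close>

definition simplex :: "'a list \<Rightarrow> 'a list \<Rightarrow> rat" where
  "simplex zs ys = (\<Sum>\<pi> | \<pi> permutes set zs. if map \<pi> zs = ys then of_int (sign \<pi>) else 0)"

lemma simplex_nonzero:
  assumes "simplex zs ys \<noteq> 0"
  obtains \<pi> where "\<pi> permutes set zs" "map \<pi> zs = ys"
proof -
  from assms[unfolded simplex_def] obtain \<pi>
    where "\<pi> \<in> {\<pi>. \<pi> permutes set zs}" "(if map \<pi> zs = ys then of_int (sign \<pi>) else (0::rat)) \<noteq> 0"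
    by (rule sum.not_neutral_contains_not_neutral)
  then show ?thesis using that by (auto split: if_splits)
qed

lemma simplex_support:
  assumes "simplex zs ys \<noteq> 0"
  shows "set ys = set zs" "length ys = length zs"
proof -
  from assms obtain \<pi> where "\<pi> permutes set zs" "map \<pi> zs = ys" by (rule simplex_nonzero)
  then show "set ys = set zs" "length ys = length zs"
    using permutes_image by fastforce+
qed

lemma simplex_self:
  assumes "distinct zs"
  shows "simplex zs zs = 1"
proof -
  have id: "map \<pi> zs = zs \<longleftrightarrow> \<pi> = id" if "\<pi> permutes set zs" for \<pi>
  proof
    assume "map \<pi> zs = zs"
    then have "\<pi> x = x" if "x \<in> set zs" for x
      using that by (metis map_eq_conv map_ident)
    then show "\<pi> = id" using that by (auto simp: fun_eq_iff permutes_def)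
  qed simp
  have "simplex zs zs = (\<Sum>\<pi> | \<pi> permutes set zs. if \<pi> = id then 1 else 0)"
    unfolding simplex_def by (intro sum.cong) (auto simp: id sign_id)
  also have "\<dots> = 1"
    by (subst sum.delta) (auto simp: permutes_id finite_permutations)
  finally show ?thesis .
qed

lemma simplex_alternating:
  fixes zs :: "'a list"
  assumes "distinct zs"
  shows "alternating (simplex zs)"
proof (rule alternatingI)
  fix us vs :: "'a list" and a b
  let ?xs = "us @ a # b # vs" and ?ys = "us @ b # a # vs"
  show "simplex zs ?xs = - simplex zs ?ys"
  proof (cases "distinct ?xs \<and> set ?xs = set zs")
    case True
    define \<tau> where "\<tau> = transpose a b"
    have \<tau>: "\<tau> permutes set zs" unfolding \<tau>_def using True by (intro permutes_swap_id) auto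
    have ab: "a \<noteq> b" using True by auto
    have map_\<tau>: "map \<tau> ?ys = ?xs"
      unfolding \<tau>_def using True by (auto simp: transpose_def intro!: map_idI)
    \<comment> \<open>Composition with the transposition permutes the summands, carries the
      condition for one list to that for the other, and flips every sign.\<close>
    have "simplex zs ?xs = (\<Sum>\<pi> | \<pi> permutes set zs. if map (\<tau> \<circ> \<pi>) zs = ?xs then of_int (sign (\<tau> \<circ> \<pi>)) else 0)"
      unfolding simplex_def by (rule setum_permutations_compose_left[OF \<tau>])
    also have "\<dots> = (\<Sum>\<pi> | \<pi> permutes set zs. - (if map \<pi> zs = ?ys then of_int (sign \<pi>) else 0))"
    proof (intro sum.cong refl)
      fix \<pi> assume "\<pi> \<in> {\<pi>. \<pi> permutes set zs}"
      then have \<pi>: "permutation \<pi>" "permutation \<tau>"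
        using \<tau> by (auto simp: permutation_permutes)
      have "sign (\<tau> \<circ> \<pi>) = - sign \<pi>"
        using sign_compose[OF \<pi>(2,1)] ab by (simp add: \<tau>_def sign_swap_id)
      moreover have "map (\<tau> \<circ> \<pi>) zs = ?xs \<longleftrightarrow> map \<pi> zs = ?ys"
      proof -
        have "map (\<tau> \<circ> \<pi>) zs = ?xs \<longleftrightarrow> map \<tau> (map \<pi> zs) = map \<tau> ?ys"
          unfolding map_\<tau> by simp
        also have "\<dots> \<longleftrightarrow> map \<pi> zs = ?ys"
          using permutes_inj[OF \<tau>] by (intro inj_map_eq_map)
        finally show ?thesis .
      qed
      ultimately show "(if map (\<tau> \<circ> \<pi>) zs = ?xs then of_int (sign (\<tau> \<circ> \<pi>)) else (0::rat)) =
        - (if map \<pi> zs = ?ys then of_int (sign \<pi>) else 0)" by simp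
    qed
    finally show ?thesis by (simp only: simplex_def sum_negf)
  next
    case False
    \<comment> \<open>In the remaining case both coefficients vanish, since only rearrangements of
      \<open>zs\<close> are in the support.\<close>
    have zero: "simplex zs ws = 0" if "mset ws = mset ?xs" for ws
    proof (rule ccontr)
      assume "simplex zs ws \<noteq> 0"
      then obtain \<pi> where \<pi>: "\<pi> permutes set zs" "map \<pi> zs = ws"
        by (rule simplex_nonzero)
      have "inj_on \<pi> (set zs)" using \<pi>(1) by (meson permutes_inj inj_on_subset subset_UNIV)
      then have "distinct ws" using assms \<pi>(2) by (auto simp: distinct_map)
      moreover have "set ws = set zs" using \<pi> permutes_image by fastforce
      moreover have "distinct ws \<longleftrightarrow> distinct ?xs" "set ws = set ?xs"
        using that mset_eq_imp_distinct_iff mset_eq_setD by blast+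
      ultimately show False using False by simp
    qed
    show ?thesis using zero[of ?xs] zero[of ?ys] by simp
  qed
qed

lemma simplex_alt_chains:
  assumes "distinct zs" "set zs \<subseteq> A"
  shows "simplex zs \<in> alt_chains A (length zs)"
  by (rule alt_chainsI[OF simplex_alternating[OF assms(1)]]) (use assms simplex_support in blast)

section \<open>A basis of the chains: one oriented simplex for each vertex set\<close>

definition list_of :: "'a set \<Rightarrow> 'a list" where
  "list_of T = (SOME xs. distinct xs \<and> set xs = T)"

lemma list_of:
  assumes "finite T"
  shows "distinct (list_of T)" "set (list_of T) = T" "length (list_of T) = card T"
proof -
  obtain xs where "set xs = T \<and> distinct xs" using finite_distinct_list[OF assms] by blast
  then have "distinct xs \<and> set xs = T" by simp
  then have "distinct (list_of T) \<and> set (list_of T) = T"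
    unfolding list_of_def by (rule someI)
  then show "distinct (list_of T)" "set (list_of T) = T" "length (list_of T) = card T"
    using distinct_card by fastforce+
qed

text \<open>Evaluations at the reference lists are dual to the simplices, which gives independence
  of the latter and the coefficients in expansions.\<close>

lemma simplex_list_of_eval:
  assumes "finite T" "finite T'"
  shows "simplex (list_of T') (list_of T) = (if T' = T then 1 else 0)"
proof (cases "T' = T")
  case True
  then show ?thesis using simplex_self[OF list_of(1)[OF assms(1)]] by simp
next
  case False
  then have "set (list_of T) \<noteq> set (list_of T')"
    using list_of(2)[OF assms(1)] list_of(2)[OF assms(2)] by simp
  then show ?thesis using simplex_support(1)[of "list_of T'" "list_of T"] False by auto
qed

lemma alt_chain_expand:
  assumes "finite A" and c: "c \<in> alt_chains A L"
  shows "c = (\<Sum>T | T \<subseteq> A \<and> card T = L. scale_fun (c (list_of T)) (simplex (list_of T)))"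
proof
  let ?\<T> = "{T. T \<subseteq> A \<and> card T = L}"
  have fin: "finite ?\<T>" using assms(1) by simp
  fix ys
  have "(\<Sum>T\<in>?\<T>. c (list_of T) * simplex (list_of T) ys) = c ys"
  proof (cases "distinct ys \<and> set ys \<in> ?\<T>")
    case True
    have "c (list_of T) * simplex (list_of T) ys = (if T = set ys then c ys else 0)"
      if "T \<in> ?\<T>" for T
    proof (cases "T = set ys")
      case eq: True
      have l: "distinct (list_of T)" "set (list_of T) = T" by (simp_all add: eq list_of)
      have "c (list_of T) * simplex (list_of T) ys = c ys"
      proof (rule alternating_eqI[OF alternating_scale[OF simplex_alternating[OF l(1)]] alt_chainsD(1)[OF c]])
        show "mset ys = mset (list_of T)"
          using True l eq set_eq_iff_mset_eq_distinct by metis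
        show "c (list_of T) * simplex (list_of T) (list_of T) = c (list_of T)"
          by (simp add: simplex_self[OF l(1)])
      qed
      then show ?thesis by (simp add: eq)
    next
      case False
      have "finite T" using that assms(1) finite_subset by blast
      then have "simplex (list_of T) ys = 0"
        using simplex_support(1)[of "list_of T" ys] list_of(2)[of T] False by force
      then show ?thesis using False by simp
    qed
    then have "(\<Sum>T\<in>?\<T>. c (list_of T) * simplex (list_of T) ys)
      = (\<Sum>T\<in>?\<T>. if T = set ys then c ys else 0)" by (intro sum.cong) auto
    also have "\<dots> = c ys" using True fin by (subst sum.delta) auto
    finally show ?thesis .
  next
    case False
    have "c ys = 0"
    proof (rule ccontr)
      assume "c ys \<noteq> 0"
      then show False using False alt_chainsD(2-4)[OF c, of ys] by (auto simp: distinct_card)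
    qed
    moreover have "simplex (list_of T) ys = 0" if T: "T \<in> ?\<T>" for T
    proof (rule ccontr)
      assume nz: "simplex (list_of T) ys \<noteq> 0"
      have "finite T" using T assms(1) finite_subset by blast
      with nz have "set ys = T" "length ys = card T"
        using simplex_support[OF nz] list_of[of T] by simp_all
      then show False using False T by (simp add: card_distinct)
    qed
    ultimately show ?thesis by simp
  qed
  then show "c ys = (\<Sum>T | T \<subseteq> A \<and> card T = L. scale_fun (c (list_of T)) (simplex (list_of T))) ys"
    by (simp add: sum_fun_apply)
qed

lemma alt_chains_span:
  assumes "finite A"
  shows "alt_chains A L = rat_fun.span ((\<lambda>T. simplex (list_of T)) ` {T. T \<subseteq> A \<and> card T = L})"
    (is "_ = rat_fun.span ?B")
proof
  show "alt_chains A L \<subseteq> rat_fun.span ?B"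
  proof
    fix c assume c: "c \<in> alt_chains A L"
    show "c \<in> rat_fun.span ?B"
      by (subst alt_chain_expand[OF assms c])
        (intro rat_fun.span_sum rat_fun.span_scale, auto intro: rat_fun.span_base)
  qed
  have "?B \<subseteq> alt_chains A L"
  proof (clarsimp)
    fix T assume T: "T \<subseteq> A" "L = card T"
    then have "finite T" using assms finite_subset by blast
    then show "simplex (list_of T) \<in> alt_chains A (card T)"
      using T simplex_alt_chains[of "list_of T" A] by (simp add: list_of)
  qed
  then show "rat_fun.span ?B \<subseteq> alt_chains A L"
    by (rule rat_fun.span_minimal[OF _ subspace_alt_chains])
qed

lemma fin_dim_alt_chains:
  assumes "finite A"
  shows "fin_dim (alt_chains A L)"
  unfolding fin_dim_def
proof (intro conjI exI)
  show "finite ((\<lambda>T. simplex (list_of T)) ` {T. T \<subseteq> A \<and> card T = L})"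
    using assms by simp
  show "alt_chains A L \<subseteq> rat_fun.span ((\<lambda>T. simplex (list_of T)) ` {T. T \<subseteq> A \<and> card T = L})"
    using alt_chains_span[OF assms] by simp
qed (rule subspace_alt_chains)

lemma fin_dim_alt_cycles: "finite A \<Longrightarrow> fin_dim (alt_cycles A L)"
  using fin_dim_subset[OF fin_dim_alt_chains subspace_alt_cycles] by (auto simp: alt_cycles_def)

lemma dim_alt_chains:
  assumes "finite A"
  shows "rat_fun.dim (alt_chains A L) = card A choose L"
proof -
  let ?\<T> = "{T. T \<subseteq> A \<and> card T = L}" and ?s = "\<lambda>T. simplex (list_of T)"
  have fin: "finite ?\<T>" and finT: "\<And>T. T \<in> ?\<T> \<Longrightarrow> finite T"
    using assms finite_subset by auto
  have inj: "inj_on ?s ?\<T>"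
  proof (rule inj_onI)
    fix T T' assume *: "T \<in> ?\<T>" "T' \<in> ?\<T>" "?s T = ?s T'"
    have "?s T' (list_of T) = ?s T (list_of T)" by (simp only: *(3))
    then show "T = T'"
      unfolding simplex_list_of_eval[OF finT[OF *(1)] finT[OF *(2)]]
        simplex_list_of_eval[OF finT[OF *(1)] finT[OF *(1)]] by (simp split: if_splits)
  qed
  have "rat_fun.independent (?s ` ?\<T>)"
  proof (rule rat_fun.independent_if_scalars_zero)
    fix f x assume sum: "(\<Sum>x\<in>?s ` ?\<T>. scale_fun (f x) x) = 0" and "x \<in> ?s ` ?\<T>"
    then obtain T where T: "T \<in> ?\<T>" "x = ?s T" by blast
    have "0 = (\<Sum>x\<in>?s ` ?\<T>. scale_fun (f x) x) (list_of T)" using sum by simp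
    also have "\<dots> = (\<Sum>T'\<in>?\<T>. f (?s T') * ?s T' (list_of T))"
      by (simp add: sum_fun_apply sum.reindex[OF inj])
    also have "\<dots> = (\<Sum>T'\<in>?\<T>. if T' = T then f (?s T) else 0)"
      using finT T by (intro sum.cong) (auto simp: simplex_list_of_eval)
    also have "\<dots> = f x" using T fin by (subst sum.delta) auto
    finally show "f x = 0" by simp
  qed (use fin in simp)
  then have "rat_fun.dim (alt_chains A L) = card (?s ` ?\<T>)"
    unfolding alt_chains_span[OF assms] by (rule rat_fun.dim_span_eq_card_independent)
  also have "\<dots> = card A choose L"
    using card_image[OF inj] n_subsets[OF assms] by simp
  finally show ?thesis .
qed

lemma bdry_linear: "Vector_Spaces.linear scale_fun scale_fun (bdry A)"
  by (rule linear_funI) (auto simp: bdry_add bdry_scale)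

text \<open>The cone over the barycentre is a preimage. For empty \<open>A\<close> the empty face
  would be a cycle that bounds nothing.\<close>

lemma alt_cycles_eq_bdry:
  assumes "finite A" "A \<noteq> {}"
  shows "alt_cycles A L = bdry A ` alt_chains A (Suc L)"
proof
  show "bdry A ` alt_chains A (Suc L) \<subseteq> alt_cycles A L"
    by (auto intro: bdry_in_alt_cycles)
  show "alt_cycles A L \<subseteq> bdry A ` alt_chains A (Suc L)"
  proof
    fix z assume z: "z \<in> alt_cycles A L"
    let ?w = "barycentre A"
    have "bdry A (wedge ?w z) = z"
      using z bdry_wedge_cycle[OF sum_barycentre[OF assms]] by (simp add: alt_cycles_def)
    moreover have "wedge ?w z \<in> alt_chains A (Suc L)"
      using z by (intro wedge_alt_chains) (auto simp: alt_cycles_def barycentre_support)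
    ultimately show "z \<in> bdry A ` alt_chains A (Suc L)" by (metis image_eqI)
  qed
qed

text \<open>A cycle is determined by its restriction to the simplices avoiding a vertex \<open>a\<close>,
  which is arbitrary: cone it off with \<open>a\<close> and take the boundary.\<close>

lemma dim_alt_cycles:
  assumes "finite A" "A \<noteq> {}"
  shows "rat_fun.dim (alt_cycles A L) = (card A - 1) choose L"
proof -
  obtain a where a: "a \<in> A" using assms(2) by blast
  \<comment> \<open>With all the weight at \<open>a\<close>, the wedge is the cone with apex
    \<open>a\<close>. A dimension count asks for no equivariance, so a vertex serves as apex
    here.\<close>
  define w where "w = (\<lambda>x. if x = a then 1 else (0::rat))"
  have w1: "sum w A = 1" unfolding w_def using assms(1) a by simp
  have w_out: "wedge w c xs = 0" if "a \<notin> set xs" for c xs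
    using that by (induction xs arbitrary: c) (auto simp: w_def)
  define T where "T = (\<lambda>c. bdry A (wedge w c))"
  have lin: "Vector_Spaces.linear scale_fun scale_fun T"
  proof (rule linear_funI)
    show "T (f + g) = T f + T g" for f g
      unfolding T_def bdry_add[symmetric] by (rule arg_cong[where f = "bdry A"]) (auto simp: wedge_add plus_fun_def)
    show "T (\<lambda>x. c * f x) = (\<lambda>x. c * T f x)" for c f
      unfolding T_def bdry_scale[symmetric] by (rule arg_cong[where f = "bdry A"]) (auto simp: wedge_scale)
  qed
  \<comment> \<open>By the homotopy formula \<open>T c\<close> differs from \<open>c\<close> by a
    cone, and a cone lives on lists through its apex.\<close>
  have T_out: "T c xs = c xs" if "a \<notin> set xs" for c xs
    unfolding T_def bdry_wedge[OF w1] by (simp add: w_out[OF that])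
  let ?C = "alt_chains (A - {a}) L"
  have inj: "inj_on T ?C"
  proof (rule inj_onI, rule ext)
    fix c c' xs assume c: "c \<in> ?C" "c' \<in> ?C" "T c = T c'"
    show "c xs = c' xs"
    proof (cases "a \<in> set xs")
      case True
      then have "\<not> set xs \<subseteq> A - {a}" by blast
      then have "c xs = 0" "c' xs = 0"
        using alt_chainsD(2)[OF c(1), of xs] alt_chainsD(2)[OF c(2), of xs] by metis+
      then show ?thesis by simp
    next
      case False
      then show ?thesis using T_out[OF False, of c] T_out[OF False, of c'] c(3) by simp
    qed
  qed
  have T_cyc: "T c \<in> alt_cycles A L" if "c \<in> alt_chains A L" for c
    unfolding T_def using that a
    by (intro bdry_in_alt_cycles wedge_alt_chains) (auto simp: w_def split: if_splits)
  have "?C \<subseteq> alt_chains A L" by (auto simp: alt_chains_def)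
  have "T ` ?C = alt_cycles A L"
  proof
    show "T ` ?C \<subseteq> alt_cycles A L" using \<open>?C \<subseteq> _\<close> T_cyc by blast
    show "alt_cycles A L \<subseteq> T ` ?C"
    proof
      fix z assume z: "z \<in> alt_cycles A L"
      then have zc: "z \<in> alt_chains A L" and "bdry A z = 0" by (auto simp: alt_cycles_def)
      define c where "c = (\<lambda>xs. if a \<in> set xs then 0 else z xs)"
      have c: "c \<in> ?C"
      proof (rule alt_chainsI)
        show "alternating c"
        proof (rule alternatingI)
          fix xs u v ys
          show "c (xs @ u # v # ys) = - c (xs @ v # u # ys)"
            using alternatingD[OF alt_chainsD(1)[OF zc], of xs u v ys] by (auto simp: c_def)
        qed
        show "set xs \<subseteq> A - {a} \<and> length xs = L" if "c xs \<noteq> 0" for xs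
          using that alt_chainsD(2,3)[OF zc, of xs] by (auto simp: c_def split: if_splits)
      qed
      \<comment> \<open>The difference is a cycle supported on simplices through \<open>a\<close>.
        Its boundary at a list without \<open>a\<close> has the single term
        \<open>y (a # xs)\<close>, so the cycle is zero.\<close>
      define y where "y = z - T c"
      have "y \<in> alt_cycles A L"
        unfolding y_def using z T_cyc c \<open>?C \<subseteq> _\<close> rat_fun.subspace_diff[OF subspace_alt_cycles] by blast
      then have y: "y \<in> alt_chains A L" "bdry A y = 0" by (auto simp: alt_cycles_def)
      have y_out: "y xs = 0" if "a \<notin> set xs" for xs
        using T_out[OF that, of c] that by (simp add: y_def c_def)
      have y_in: "y (a # xs) = 0" for xs
      proof (cases "a \<in> set xs")
        case True
        then show ?thesis using alt_chainsD(4)[OF y(1), of "a # xs"] by auto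
      next
        case False
        have "0 = bdry A y xs" using y(2) by simp
        also have "\<dots> = (\<Sum>v\<in>A. if v = a then y (a # xs) else 0)"
          unfolding bdry_def using False y_out by (intro sum.cong) auto
        also have "\<dots> = y (a # xs)" using a assms(1) by simp
        finally show ?thesis by simp
      qed
      have "y xs = 0" for xs
      proof (cases "a \<in> set xs")
        case True
        then obtain us vs where "xs = us @ a # vs" by (meson split_list)
        then show ?thesis
          using alternating_shift[OF alt_chainsD(1)[OF y(1)], of a us vs] y_in[of "us @ vs"] by simp
      qed (rule y_out)
      then have "z = T c" unfolding y_def by (auto simp: fun_eq_iff)
      then show "z \<in> T ` ?C" using c by blast
    qed
  qed
  then have "rat_fun.dim (alt_cycles A L) = rat_fun.dim ?C"
    using dim_inj_image[OF lin fin_dim_alt_chains inj] assms(1) by simp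
  also have "\<dots> = (card A - 1) choose L"
    using assms(1) a by (simp add: dim_alt_chains)
  finally show ?thesis .
qed


section \<open>Specht modules of hooks\<close>

text \<open>A tabloid of hook shape is given by the entries \<open>xs\<close> of its rows of length one, and
  evaluating on these lists turns a polytabloid into the boundary of the oriented simplex on the
  entries of the first column.\<close>

definition hook_tabloid :: "nat \<Rightarrow> nat list \<Rightarrow> nat set list" where
  "hook_tabloid r xs = ({1..r} - set xs) # map (\<lambda>x. {x}) xs"

lemma hook_tabloid_inj: "hook_tabloid r xs = hook_tabloid r ys \<longleftrightarrow> xs = ys"
proof -
  have "inj (\<lambda>x :: nat. {x})" by (simp add: inj_def)
  then show ?thesis by (auto simp: hook_tabloid_def inj_map_eq_map)
qed

lemma hook_tabloid_permute:
  assumes "\<pi> permutes {1..r}"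
  shows "map (image \<pi>) (hook_tabloid r xs) = hook_tabloid r (map \<pi> xs)"
proof -
  have "\<pi> ` ({1..r} - set xs) = \<pi> ` {1..r} - \<pi> ` set xs"
    using assms by (intro image_set_diff permutes_inj)
  then show ?thesis using assms by (simp add: hook_tabloid_def permutes_image)
qed

definition hook :: "nat \<Rightarrow> nat \<Rightarrow> nat list" where
  "hook k r = k # replicate (r - k) 1"

definition first_column :: "nat \<Rightarrow> (nat \<times> nat \<Rightarrow> nat) \<Rightarrow> nat list" where
  "first_column s t = map (\<lambda>i. t (i, 0)) [0..<Suc s]"

context
  fixes k r :: nat
  assumes k: "1 \<le> k" "k \<le> r"
begin

lemma cells_hook: "cells (hook k r) = {(i, j). i = 0 \<and> j < k \<or> 1 \<le> i \<and> i \<le> r - k \<and> j = 0}"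
  by (auto simp: cells_def hook_def nth_Cons split: nat.splits)

lemma sum_list_hook: "sum_list (hook k r) = r"
  using k by (simp add: hook_def sum_list_replicate)

lemma first_column_Cons:
  "first_column (r - k) t = t (0, 0) # map (\<lambda>i. t (i, 0)) [1..<Suc (r - k)]"
  unfolding first_column_def by (subst upt_conv_Cons) auto

lemma tableau_bij: "t \<in> tableaux (hook k r) \<Longrightarrow> bij_betw t (cells (hook k r)) {1..r}"
  by (simp add: tableaux_def sum_list_hook)

lemma first_column_props:
  assumes "t \<in> tableaux (hook k r)"
  shows "distinct (first_column (r - k) t)" "set (first_column (r - k) t) \<subseteq> {1..r}"
    "length (first_column (r - k) t) = Suc (r - k)"
proof -
  note bij = tableau_bij[OF assms]
  have cell: "(i, 0) \<in> cells (hook k r)" if "i < Suc (r - k)" for i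
    using that k by (auto simp: cells_hook)
  show "set (first_column (r - k) t) \<subseteq> {1..r}"
  proof
    fix x assume "x \<in> set (first_column (r - k) t)"
    then obtain i where "i < Suc (r - k)" "x = t (i, 0)"
      by (auto simp: first_column_def simp del: upt_Suc)
    then show "x \<in> {1..r}" using bij_betw_apply[OF bij cell] by simp
  qed
  have "inj_on (\<lambda>i. t (i, 0)) {0..<Suc (r - k)}"
  proof (rule inj_onI)
    fix i j assume *: "i \<in> {0..<Suc (r - k)}" "j \<in> {0..<Suc (r - k)}" "t (i, 0) = t (j, 0)"
    then have "(i, 0::nat) = (j, 0)"
      using bij cell by (intro inj_onD[OF bij_betw_imp_inj_on[OF bij]]) auto
    then show "i = j" by simp
  qed
  then show "distinct (first_column (r - k) t)"
    by (simp add: first_column_def distinct_map del: upt_Suc)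
  show "length (first_column (r - k) t) = Suc (r - k)" by (simp add: first_column_def)
qed

lemma tabloid_hook:
  assumes "t \<in> tableaux (hook k r)"
  shows "tabloid (hook k r) t = hook_tabloid r (tl (first_column (r - k) t))"
proof -
  note bij = tableau_bij[OF assms]
  let ?c = "cells (hook k r)"
  have len: "length (hook k r) = Suc (r - k)" by (simp add: hook_def)
  have "tabloid (hook k r) t =
    {t (0, j) | j. (0, j) \<in> ?c} # map (\<lambda>i. {t (i, j) | j. (i, j) \<in> ?c}) [1..<Suc (r - k)]"
    unfolding tabloid_def len by (subst upt_conv_Cons) auto
  moreover have "map (\<lambda>i. {t (i, j) | j. (i, j) \<in> ?c}) [1..<Suc (r - k)]
    = map (\<lambda>i. {t (i, 0)}) [1..<Suc (r - k)]"
    by (rule map_cong) (auto simp: cells_hook)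
  moreover have "{t (0, j) | j. (0, j) \<in> ?c} = {1..r} - (\<lambda>i. t (i, 0)) ` {1..<Suc (r - k)}"
  proof -
    let ?R = "{(0::nat, j) | j. j < k}" and ?S = "(\<lambda>i. (i, 0::nat)) ` {1..<Suc (r - k)}"
    have c: "?c = ?R \<union> ?S" "?R \<inter> ?S = {}" by (auto simp: cells_hook)
    have "{t (0, j) | j. (0, j) \<in> ?c} = t ` ?R" by (auto simp: cells_hook)
    also have "?R = ?c - ?S" using c by blast
    also have "t ` (?c - ?S) = t ` ?c - t ` ?S"
      using bij c(1) by (intro inj_on_image_set_diff[of t ?c]) (auto simp: bij_betw_def)
    also have "t ` ?c = {1..r}" using bij by (simp add: bij_betw_def)
    finally show ?thesis by (simp add: image_image)
  qed
  ultimately show ?thesis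
    by (simp add: hook_tabloid_def first_column_Cons comp_def del: upt_Suc)
qed

text \<open>Every later column has at most one cell, and stabilising it means fixing its entry. So
  exactly the entries of the first column can move.\<close>

lemma column_stabilizer_hook:
  assumes "t \<in> tableaux (hook k r)"
  shows "column_stabilizer (hook k r) t = {\<pi>. \<pi> permutes set (first_column (r - k) t)}"
proof -
  note bij = tableau_bij[OF assms]
  let ?C = "set (first_column (r - k) t)" and ?c = "cells (hook k r)"
  define col where "col = (\<lambda>j. {t (i, j) | i. (i, j) \<in> ?c})"
  have "(i, 0) \<in> ?c \<longleftrightarrow> i < Suc (r - k)" for i
    using k by (auto simp: cells_hook)
  then have col0: "col 0 = ?C"
    by (auto simp: col_def first_column_def simp del: upt_Suc)
  have colj: "col j = (if j < k then {t (0, j)} else {})" if "j \<noteq> 0" for j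
    using that by (auto simp: col_def cells_hook)
  have notin: "t (0, j) \<notin> ?C" if "j \<noteq> 0" "j < k" for j
  proof
    assume "t (0, j) \<in> ?C"
    then obtain i where "(i, 0) \<in> ?c" "t (0, j) = t (i, 0)" unfolding col0[symmetric] col_def by blast
    moreover have "(0, j) \<in> ?c" using that by (simp add: cells_hook)
    ultimately have "(0, j) = (i, 0)" using bij inj_onD unfolding bij_betw_def by metis
    with that show False by simp
  qed
  have stab: "column_stabilizer (hook k r) t = {\<pi>. \<pi> permutes {1..r} \<and> (\<forall>j. \<pi> ` col j = col j)}"
    unfolding column_stabilizer_def sum_list_hook col_def ..
  show ?thesis
  proof (intro equalityI subsetI)
    fix \<pi> assume "\<pi> \<in> column_stabilizer (hook k r) t"
    then have \<pi>: "\<pi> permutes {1..r}" "\<And>j. \<pi> ` col j = col j" by (auto simp: stab)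
    have "\<pi> permutes ?C"
    proof (rule permutes_superset[OF \<pi>(1)])
      fix x assume x: "x \<in> {1..r} - ?C"
      then obtain i j where ij: "(i, j) \<in> ?c" "x = t (i, j)"
        using bij unfolding bij_betw_def by force
      then have "j \<noteq> 0" using x col0 col_def by fastforce
      then show "\<pi> x = x" using ij \<pi>(2)[of j] colj[of j] by (auto simp: cells_hook)
    qed
    then show "\<pi> \<in> {\<pi>. \<pi> permutes ?C}" by simp
  next
    fix \<pi> assume "\<pi> \<in> {\<pi>. \<pi> permutes ?C}"
    then have \<pi>: "\<pi> permutes ?C" by simp
    have "\<pi> ` col j = col j" for j
    proof (cases "j = 0")
      case True
      then show ?thesis using permutes_image[OF \<pi>] col0 by simp
    next
      case False
      then show ?thesis using colj[OF False] notin[OF False] permutes_not_in[OF \<pi>] by auto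
    qed
    then show "\<pi> \<in> column_stabilizer (hook k r) t"
      using permutes_subset[OF \<pi> first_column_props(2)[OF assms]] by (simp add: stab)
  qed
qed

lemma tableau_permute:
  assumes "t \<in> tableaux (hook k r)" "\<pi> permutes {1..r}"
  shows "\<pi> \<circ> t \<in> tableaux (hook k r)"
  using bij_betw_trans[OF tableau_bij[OF assms(1)] permutes_imp_bij[OF assms(2)]]
  by (simp add: tableaux_def sum_list_hook)

lemma tabloid_hook_permute:
  assumes "t \<in> tableaux (hook k r)" "\<pi> \<in> column_stabilizer (hook k r) t"
  shows "tabloid (hook k r) (\<pi> \<circ> t) = hook_tabloid r (map \<pi> (tl (first_column (r - k) t)))"
proof -
  have "\<pi> permutes {1..r}" using assms(2) by (simp add: column_stabilizer_def sum_list_hook)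
  then show ?thesis
    using tabloid_hook[OF tableau_permute[OF assms(1)]] by (simp add: first_column_def map_tl comp_def del: upt_Suc)
qed

text \<open>The corner entry of the first column lies in the long row, so the tabloid sees only the
  rest of the column. Forgetting the first vertex in this way is what the boundary does.\<close>

lemma polytabloid_hook:
  assumes "t \<in> tableaux (hook k r)"
  shows "polytabloid (hook k r) t (hook_tabloid r ys) = bdry {1..r} (simplex (first_column (r - k) t)) ys"
proof -
  define zs where "zs = first_column (r - k) t"
  define x where "x = t (0, 0)"
  have zs: "zs = x # tl zs" by (simp add: zs_def x_def first_column_Cons del: upt_Suc)
  have x_in: "\<pi> x \<in> {1..r}" if "\<pi> permutes set zs" for \<pi>
  proof -
    have "x \<in> set zs" by (subst zs) simp
    then have "\<pi> x \<in> set zs" using permutes_in_image[OF that] by simp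
    then show ?thesis using first_column_props(2)[OF assms] zs_def by blast
  qed
  have "polytabloid (hook k r) t (hook_tabloid r ys)
    = (\<Sum>\<pi> | \<pi> permutes set zs. if map \<pi> (tl zs) = ys then of_int (sign \<pi>) else 0)"
    unfolding polytabloid_def zs_def
    by (intro sum.cong) (auto simp: tabloid_hook_permute[OF assms] column_stabilizer_hook[OF assms] hook_tabloid_inj)
  \<comment> \<open>The inner sum restores the forgotten corner entry: for each permutation only
    \<open>v = \<pi> x\<close> can contribute. Exchanging the sums then produces the
    boundary.\<close>
  also have "\<dots> = (\<Sum>\<pi> | \<pi> permutes set zs. \<Sum>v\<in>{1..r}. if map \<pi> zs = v # ys then of_int (sign \<pi>) else 0)"
  proof (intro sum.cong refl)
    fix \<pi> assume "\<pi> \<in> {\<pi>. \<pi> permutes set zs}"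
    then have "\<pi> x \<in> {1..r}" using x_in by simp
    have "map \<pi> zs = v # ys \<longleftrightarrow> v = \<pi> x \<and> map \<pi> (tl zs) = ys" for v
      by (subst zs) auto
    then have "(\<Sum>v\<in>{1..r}. if map \<pi> zs = v # ys then of_int (sign \<pi>) else (0::rat))
      = (\<Sum>v\<in>{1..r}. if v = \<pi> x then (if map \<pi> (tl zs) = ys then of_int (sign \<pi>) else 0) else 0)"
      by (intro sum.cong) auto
    also have "\<dots> = (if map \<pi> (tl zs) = ys then of_int (sign \<pi>) else 0)"
      using \<open>\<pi> x \<in> _\<close> by (subst sum.delta) auto
    finally show "(if map \<pi> (tl zs) = ys then of_int (sign \<pi>) else (0::rat)) =
      (\<Sum>v\<in>{1..r}. if map \<pi> zs = v # ys then of_int (sign \<pi>) else 0)" by simp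
  qed
  also have "\<dots> = bdry {1..r} (simplex zs) ys"
    unfolding bdry_def simplex_def by (rule sum.swap)
  finally show ?thesis by (simp add: zs_def)
qed

lemma polytabloid_hook_support:
  assumes "t \<in> tableaux (hook k r)" "X \<notin> range (hook_tabloid r)"
  shows "polytabloid (hook k r) t X = 0"
  unfolding polytabloid_def
proof (intro sum.neutral ballI)
  fix \<pi> assume "\<pi> \<in> column_stabilizer (hook k r) t"
  then have "tabloid (hook k r) (\<pi> \<circ> t) \<noteq> X"
    using tabloid_hook_permute[OF assms(1)] assms(2) by auto
  then show "(if tabloid (hook k r) (\<pi> \<circ> t) = X then of_int (sign \<pi>) else 0) = (0::rat)" by simp
qed

lemma exists_tableau_hook:
  assumes "distinct zs" "set zs \<subseteq> {1..r}" "length zs = Suc (r - k)"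
  obtains t where "t \<in> tableaux (hook k r)" "first_column (r - k) t = zs"
proof -
  \<comment> \<open>The \<open>k - 1\<close> entries outside the prescribed column fill the rest of
    the first row in any order.\<close>
  define us where "us = list_of ({1..r} - set zs)"
  have us: "distinct us" "set us = {1..r} - set zs" "length us = card ({1..r} - set zs)"
    unfolding us_def by (rule list_of, simp)+
  have "card (set zs) = Suc (r - k)" using assms distinct_card by metis
  then have len_us: "length us = k - 1"
    using us(3) assms(2) k by (simp add: card_Diff_subset)
  define t where "t = (\<lambda>(i::nat, j::nat). if j = 0 then zs ! i else us ! (j - 1))"
  let ?R = "{0::nat} \<times> {1..<k}" and ?S = "{..<Suc (r - k)} \<times> {0::nat}"
  have c: "cells (hook k r) = ?S \<union> ?R" using k by (auto simp: cells_hook)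
  have S: "bij_betw t ?S (set zs)"
  proof (rule bij_betw_trans[of fst _ "{..<Suc (r - k)}" "(!) zs", unfolded comp_def, THEN bij_betw_cong[THEN iffD1, rotated]])
    show "bij_betw fst ?S {..<Suc (r - k)}" by (rule bij_betw_byWitness[of _ "\<lambda>i. (i, 0)"]) auto
    show "bij_betw ((!) zs) {..<Suc (r - k)} (set zs)"
      using assms by (intro bij_betw_nth) auto
    show "zs ! fst x = t x" if "x \<in> ?S" for x using that by (auto simp: t_def)
  qed
  have R: "bij_betw t ?R (set us)"
  proof (rule bij_betw_trans[of "\<lambda>(i, j). j - 1" _ "{..<k - 1}" "(!) us", unfolded comp_def, THEN bij_betw_cong[THEN iffD1, rotated]])
    show "bij_betw (\<lambda>(i, j). j - 1) ?R {..<k - 1}"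
      by (rule bij_betw_byWitness[of _ "\<lambda>j. (0, Suc j)"]) auto
    show "bij_betw ((!) us) {..<k - 1} (set us)"
      using us(1) len_us by (intro bij_betw_nth) auto
    show "us ! (case x of (i, j) \<Rightarrow> j - 1) = t x" if "x \<in> ?R" for x using that by (auto simp: t_def)
  qed
  have "bij_betw t (?S \<union> ?R) (set zs \<union> set us)"
    by (rule bij_betw_combine[OF S R]) (use us(2) in auto)
  moreover have "set zs \<union> set us = {1..r}" using us(2) assms(2) by auto
  ultimately have "t \<in> tableaux (hook k r)"
    unfolding tableaux_def sum_list_hook c by simp
  moreover have "first_column (r - k) t = zs"
    unfolding first_column_def t_def using assms(3) by (intro nth_equalityI) (auto simp del: upt_Suc)
  ultimately show ?thesis by (rule that)
qed

text \<open>Makes evaluation on lists injective on the Specht module: no coefficient is hidden at a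
  list of sets that is not a hook tabloid.\<close>

lemma specht_hook_support:
  assumes "f \<in> rat_fun.span (polytabloid (hook k r) ` tableaux (hook k r))" "X \<notin> range (hook_tabloid r)"
  shows "f X = 0"
proof -
  have "rat_fun.span (polytabloid (hook k r) ` tableaux (hook k r)) \<subseteq> {f. f X = 0}"
  proof (rule rat_fun.span_minimal)
    show "polytabloid (hook k r) ` tableaux (hook k r) \<subseteq> {f. f X = 0}"
      using polytabloid_hook_support[OF _ assms(2)] by blast
    show "rat_fun.subspace {f :: nat set list \<Rightarrow> rat. f X = 0}"
      by (rule rat_fun.subspaceI) auto
  qed
  then show ?thesis using assms(1) by blast
qed

text \<open>The images of the polytabloids include the boundaries of all simplices in a basis of the
  chains one degree up, and these span the cycles because the full simplex is acyclic.\<close>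

lemma specht_hook_image:
  "(\<lambda>f xs. f (hook_tabloid r xs)) ` rat_fun.span (polytabloid (hook k r) ` tableaux (hook k r))
    = alt_cycles {1..r} (r - k)" (is "?\<Theta> ` rat_fun.span ?P = _")
proof -
  have lin: "Vector_Spaces.linear scale_fun scale_fun ?\<Theta>"
    by (rule linear_funI) auto
  have eval: "?\<Theta> (polytabloid (hook k r) t) = bdry {1..r} (simplex (first_column (r - k) t))"
    if "t \<in> tableaux (hook k r)" for t
    by (rule ext) (rule polytabloid_hook[OF that])
  have "?\<Theta> ` rat_fun.span ?P = rat_fun.span (?\<Theta> ` ?P)"
    using rat_fun_pair.linear_span_image[OF lin] by simp
  also have "\<dots> = alt_cycles {1..r} (r - k)"
  proof
    have "?\<Theta> ` ?P \<subseteq> alt_cycles {1..r} (r - k)"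
    proof clarify
      fix t assume t: "t \<in> tableaux (hook k r)"
      note c = first_column_props[OF t]
      have "bdry {1..r} (simplex (first_column (r - k) t)) \<in> alt_cycles {1..r} (r - k)"
        using simplex_alt_chains[OF c(1,2)] unfolding c(3) by (rule bdry_in_alt_cycles)
      then show "?\<Theta> (polytabloid (hook k r) t) \<in> alt_cycles {1..r} (r - k)"
        unfolding eval[OF t] .
    qed
    then show "rat_fun.span (?\<Theta> ` ?P) \<subseteq> alt_cycles {1..r} (r - k)"
      by (rule rat_fun.span_minimal[OF _ subspace_alt_cycles])
    let ?B = "(\<lambda>T. simplex (list_of T)) ` {T. T \<subseteq> {1..r} \<and> card T = Suc (r - k)}"
    have "bdry {1..r} ` ?B \<subseteq> ?\<Theta> ` ?P"
    proof clarify
      fix T assume T: "T \<subseteq> {1..r}" "card T = Suc (r - k)"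
      then have "finite T" using finite_subset by blast
      then obtain t where t: "t \<in> tableaux (hook k r)" "first_column (r - k) t = list_of T"
        using exists_tableau_hook[of "list_of T"] T list_of[of T] by metis
      show "bdry {1..r} (simplex (list_of T)) \<in> ?\<Theta> ` ?P"
        unfolding t(2)[symmetric] eval[OF t(1), symmetric] using t(1) by (intro imageI)
    qed
    moreover have "alt_cycles {1..r} (r - k) = rat_fun.span (bdry {1..r} ` ?B)"
    proof -
      have "alt_cycles {1..r} (r - k) = bdry {1..r} ` alt_chains {1..r} (Suc (r - k))"
        using k by (intro alt_cycles_eq_bdry) auto
      also have "\<dots> = bdry {1..r} ` rat_fun.span ?B" by (simp only: alt_chains_span[OF finite_atLeastAtMost])
      also have "\<dots> = rat_fun.span (bdry {1..r} ` ?B)"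
        unfolding rat_fun_pair.linear_span_image[OF bdry_linear] ..
      finally show ?thesis .
    qed
    ultimately show "alt_cycles {1..r} (r - k) \<subseteq> rat_fun.span (?\<Theta> ` ?P)"
      using rat_fun.span_mono by simp
  qed
  finally show ?thesis .
qed

end


section \<open>Products of cycles on a disjoint union\<close>

primrec lefts :: "('a + 'b) list \<Rightarrow> 'a list" where
  "lefts [] = []"
| "lefts (z # zs) = (case z of Inl a \<Rightarrow> a # lefts zs | Inr b \<Rightarrow> lefts zs)"

primrec rights :: "('a + 'b) list \<Rightarrow> 'b list" where
  "rights [] = []"
| "rights (z # zs) = (case z of Inl a \<Rightarrow> rights zs | Inr b \<Rightarrow> b # rights zs)"

text \<open>The sign of the shuffle that moves the left vertices to the front.\<close>

primrec shuffle_sign :: "('a + 'b) list \<Rightarrow> rat" where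
  "shuffle_sign [] = 1"
| "shuffle_sign (z # zs) =
    (case z of Inl a \<Rightarrow> 1 | Inr b \<Rightarrow> (-1) ^ length (lefts zs)) * shuffle_sign zs"

lemma lefts_append [simp]: "lefts (us @ vs) = lefts us @ lefts vs"
  by (induction us) (auto split: sum.splits)

lemma rights_append [simp]: "rights (us @ vs) = rights us @ rights vs"
  by (induction us) (auto split: sum.splits)

lemma lefts_rights_map [simp]:
  "lefts (map Inl xs) = xs" "lefts (map Inr ys) = []"
  "rights (map Inl xs) = []" "rights (map Inr ys) = ys"
  by (induction xs, simp_all) (induction ys, simp_all)+

lemma lefts_map_sum [simp]: "lefts (map (map_sum g h) zs) = map g (lefts zs)"
  by (induction zs) (auto split: sum.splits)

lemma rights_map_sum [simp]: "rights (map (map_sum g h) zs) = map h (rights zs)"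
  by (induction zs) (auto split: sum.splits)

lemma shuffle_sign_map_sum [simp]: "shuffle_sign (map (map_sum g h) zs) = shuffle_sign zs"
  by (induction zs) (auto split: sum.splits)

text \<open>The extra sign counts crossings between the two blocks: every right vertex of
  \<open>us\<close> is passed by every left vertex of \<open>vs\<close>.\<close>

lemma shuffle_sign_append:
  "shuffle_sign (us @ vs) =
     shuffle_sign us * (-1) ^ (length (rights us) * length (lefts vs)) * shuffle_sign vs"
  by (induction us) (auto split: sum.splits simp: power_add algebra_simps)

lemma shuffle_sign_map_Inr [simp]: "shuffle_sign (map Inr ys) = 1"
  by (induction ys) auto

lemma shuffle_sign_map_Inl [simp]: "shuffle_sign (map Inl xs) = 1"
  by (induction xs) auto

lemma shuffle_sign_sorted [simp]: "shuffle_sign (map Inl xs @ map Inr ys) = 1"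
  by (simp add: shuffle_sign_append)

lemma set_lefts: "a \<in> set (lefts zs) \<longleftrightarrow> Inl a \<in> set zs"
  by (induction zs) (auto split: sum.splits)

lemma set_rights: "b \<in> set (rights zs) \<longleftrightarrow> Inr b \<in> set zs"
  by (induction zs) (auto split: sum.splits)

lemma distinct_lefts: "distinct zs \<Longrightarrow> distinct (lefts zs)"
  by (induction zs) (auto split: sum.splits simp: set_lefts)

lemma distinct_rights: "distinct zs \<Longrightarrow> distinct (rights zs)"
  by (induction zs) (auto split: sum.splits simp: set_rights)

lemma length_lefts_rights: "length (lefts zs) + length (rights zs) = length zs"
  by (induction zs) (auto split: sum.splits)

lemma mset_lefts_rights: "mset (map Inl (lefts zs) @ map Inr (rights zs)) = mset zs"
  by (induction zs) (auto split: sum.splits)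

text \<open>Taking one function of pairs instead of two factors makes this linear on all of the
  tensor product, including elements that are not pure tensors.\<close>

definition join :: "('a list \<times> 'b list \<Rightarrow> rat) \<Rightarrow> ('a + 'b) list \<Rightarrow> rat" where
  "join F zs = shuffle_sign zs * F (lefts zs, rights zs)"

definition outer :: "('x \<Rightarrow> rat) \<Rightarrow> ('y \<Rightarrow> rat) \<Rightarrow> 'x \<times> 'y \<Rightarrow> rat" where
  "outer u v = (\<lambda>(x, y). u x * v y)"

lemma join_outer_alt_chains:
  assumes u: "u \<in> alt_chains A p" and v: "v \<in> alt_chains B q"
  shows "join (outer u v) \<in> alt_chains (A <+> B) (p + q)"
proof (rule alt_chainsI)
  show "alternating (join (outer u v))"
  proof (rule alternatingI)
    fix xs ys :: "('a + 'b) list" and c d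
    \<comment> \<open>If \<open>c\<close> and \<open>d\<close> lie on the same side, the factor on
      that side changes sign. If they lie on different sides, both factors stay the same and
      \<open>shuffle_sign\<close> changes; the projections are then irrelevant.\<close>
    show "join (outer u v) (xs @ c # d # ys) = - join (outer u v) (xs @ d # c # ys)"
      using alternatingD[OF alt_chainsD(1)[OF u], of "lefts xs" "projl c" "projl d" "lefts ys"]
        alternatingD[OF alt_chainsD(1)[OF v], of "rights xs" "projr c" "projr d" "rights ys"]
      by (cases c; cases d) (simp_all add: join_def outer_def shuffle_sign_append)
  qed
  fix zs :: "('a + 'b) list" assume "join (outer u v) zs \<noteq> 0"
  then have nz: "u (lefts zs) \<noteq> 0" "v (rights zs) \<noteq> 0" by (auto simp: join_def outer_def)
  note U = alt_chainsD(2,3)[OF u nz(1)] and V = alt_chainsD(2,3)[OF v nz(2)]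
  have "z \<in> A <+> B" if "z \<in> set zs" for z
    using U(1) V(1) that set_lefts[of _ zs] set_rights[of _ zs] by (cases z rule: sum.exhaust) auto
  then show "set zs \<subseteq> A <+> B \<and> length zs = p + q"
    using length_lefts_rights[of zs] U(2) V(2) by auto
qed

lemma sum_Plus: "finite A \<Longrightarrow> finite B \<Longrightarrow> (\<Sum>z\<in>A <+> B. f z) = (\<Sum>a\<in>A. f (Inl a)) + (\<Sum>b\<in>B. f (Inr b))"
  by (subst Plus_def, subst sum.union_disjoint) (auto simp: sum.reindex)

lemma bdry_Plus:
  assumes "finite A" "finite B"
  shows "bdry (A <+> B) c zs = (\<Sum>a\<in>A. c (Inl a # zs)) + (\<Sum>b\<in>B. c (Inr b # zs))"
  unfolding bdry_def by (rule sum_Plus[OF assms])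

text \<open>The graded Leibniz rule. A new left vertex in front costs no shuffle, a new right vertex
  has to pass all the left ones.\<close>

lemma bdry_join_outer:
  assumes "finite A" "finite B"
  shows "bdry (A <+> B) (join (outer u v)) zs = shuffle_sign zs *
    (bdry A u (lefts zs) * v (rights zs) + (-1) ^ length (lefts zs) * u (lefts zs) * bdry B v (rights zs))"
  unfolding bdry_Plus[OF assms]
  by (simp add: join_def outer_def bdry_def sum_distrib_left sum_distrib_right algebra_simps)

definition wedge_left :: "('a \<Rightarrow> rat) \<Rightarrow> ('a list \<times> 'b list \<Rightarrow> rat) \<Rightarrow> 'a list \<times> 'b list \<Rightarrow> rat" where
  "wedge_left w F = (\<lambda>(xs, ys). wedge w (\<lambda>xs. F (xs, ys)) xs)"

definition wedge_right :: "('b \<Rightarrow> rat) \<Rightarrow> ('a list \<times> 'b list \<Rightarrow> rat) \<Rightarrow> 'a list \<times> 'b list \<Rightarrow> rat" where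
  "wedge_right w F = (\<lambda>(xs, ys). wedge w (\<lambda>ys. F (xs, ys)) ys)"

text \<open>The product of a cycle \<open>u\<close> on \<open>A\<close> and a cycle \<open>v\<close> on \<open>B\<close> is the boundary of the join of
  their cones over the barycentres. Coning over the barycentres, not over vertices, makes it
  equivariant.\<close>

definition cross :: "'a set \<Rightarrow> 'b set \<Rightarrow> ('a list \<times> 'b list \<Rightarrow> rat) \<Rightarrow> ('a + 'b) list \<Rightarrow> rat" where
  "cross A B F =
     bdry (A <+> B) (join (wedge_left (barycentre A) (wedge_right (barycentre B) F)))"

lemma cross_add: "cross A B (F + G) = cross A B F + cross A B G"
proof -
  have "join (wedge_left w (wedge_right w' (F + G))) =
    join (wedge_left w (wedge_right w' F)) + join (wedge_left w (wedge_right w' G))" for w w'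
    by (auto simp: join_def wedge_left_def wedge_right_def wedge_add fun_eq_iff algebra_simps)
  then show ?thesis by (simp add: cross_def bdry_add)
qed

lemma cross_scale: "cross A B (\<lambda>x. r * F x) = (\<lambda>x. r * cross A B F x)"
proof -
  have "join (wedge_left w (wedge_right w' (\<lambda>x. r * F x))) =
    (\<lambda>zs. r * join (wedge_left w (wedge_right w' F)) zs)" for w w'
    by (auto simp: join_def wedge_left_def wedge_right_def wedge_scale fun_eq_iff)
  then show ?thesis by (simp add: cross_def bdry_scale)
qed

lemma permutes_Plus_bij:
  assumes "g permutes A" "h permutes B"
  shows "bij_betw (map_sum g h) (A <+> B) (A <+> B)"
proof -
  have "inj_on (map_sum g h) (A <+> B)"
    using permutes_inj[OF assms(1)] permutes_inj[OF assms(2)]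
    by (meson inj_on_subset subset_UNIV sum.inj_map)
  moreover have "map_sum g h ` (A <+> B) = A <+> B"
    using permutes_image[OF assms(1)] permutes_image[OF assms(2)]
    by (simp add: Plus_def image_Un image_image flip: image_image[of Inl g] image_image[of Inr h])
  ultimately show ?thesis by (simp add: bij_betw_def)
qed

text \<open>Every ingredient is invariant: the barycentres under permutations of their sets, the
  shuffle sign because it sees only the sides, and the boundary because it sums over an invariant
  vertex set.\<close>

lemma cross_equivariant:
  assumes "g permutes A" "h permutes B"
  shows "cross A B (\<lambda>(xs, ys). F (map g xs, map h ys)) zs = cross A B F (map (map_sum g h) zs)"
proof -
  define G where "G = wedge_left (barycentre A) (wedge_right (barycentre B) F)"
  have "wedge_left (barycentre A) (wedge_right (barycentre B) (\<lambda>(xs, ys). F (map g xs, map h ys))) (xs, ys)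
    = G (map g xs, map h ys)" for xs ys
    unfolding G_def wedge_left_def wedge_right_def prod.case
    by (subst wedge_relabel[where w' = "barycentre B" and h = h], rule barycentre_permutes[OF assms(2)])
      (rule wedge_relabel[where w' = "barycentre A" and h = g], rule barycentre_permutes[OF assms(1)])
  then have "join (wedge_left (barycentre A) (wedge_right (barycentre B) (\<lambda>(xs, ys). F (map g xs, map h ys))))
    = (\<lambda>zs. join G (map (map_sum g h) zs))"
    by (simp add: join_def fun_eq_iff)
  then show ?thesis
    unfolding cross_def G_def[symmetric] by (simp add: bdry_relabel[OF permutes_Plus_bij[OF assms]])
qed

section \<open>Products with a cycle of top degree, the generator of the sign representation\<close>

definition top_cycle :: "'b set \<Rightarrow> 'b list \<Rightarrow> rat" where
  "top_cycle B = bdry B (simplex (list_of B))"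

lemma simplex_list_of_alt_chains: "finite B \<Longrightarrow> simplex (list_of B) \<in> alt_chains B (card B)"
  using simplex_alt_chains[of "list_of B" B] by (simp add: list_of)

lemma top_cycle_alt_cycles:
  assumes "finite B" "B \<noteq> {}"
  shows "top_cycle B \<in> alt_cycles B (card B - 1)"
  unfolding top_cycle_def using simplex_list_of_alt_chains[OF assms(1)] assms
  by (intro bdry_in_alt_cycles) (simp add: card_gt_0_iff)

text \<open>The cone over the full simplex has more vertices than \<open>B\<close> and is zero. The
  homotopy formula then equates the simplex with the cone over its boundary.\<close>

lemma wedge_top_cycle:
  assumes "finite B" "B \<noteq> {}"
  shows "wedge (barycentre B) (top_cycle B) = simplex (list_of B)"
proof
  fix ys
  have "wedge (barycentre B) (simplex (list_of B)) \<in> alt_chains B (Suc (card B))"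
    by (intro wedge_alt_chains simplex_list_of_alt_chains[OF assms(1)] barycentre_support)
  then have "wedge (barycentre B) (simplex (list_of B)) = 0"
    by (rule alt_chains_eq_0[OF _ assms(1)]) simp
  then have "0 = bdry B (wedge (barycentre B) (simplex (list_of B))) ys"
    by (simp add: bdry_zero)
  also have "\<dots> = simplex (list_of B) ys - wedge (barycentre B) (top_cycle B) ys"
    unfolding top_cycle_def by (rule bdry_wedge[OF sum_barycentre[OF assms]])
  finally show "wedge (barycentre B) (top_cycle B) ys = simplex (list_of B) ys" by simp
qed

text \<open>Coning maps such cycles injectively into the line of chains on all of \<open>B\<close>,
  and the boundary brings the scalar back.\<close>

lemma alt_cycles_top:
  assumes "finite B" "B \<noteq> {}" "v \<in> alt_cycles B (card B - 1)"
  obtains r where "v = (\<lambda>ys. r * top_cycle B ys)"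
proof -
  let ?w = "wedge (barycentre B) v" and ?s = "simplex (list_of B)"
  define r where "r = ?w (list_of B)"
  have "?w \<in> alt_chains B (Suc (card B - 1))"
    using assms(3) by (intro wedge_alt_chains) (auto simp: alt_cycles_def barycentre_support)
  then have w: "?w \<in> alt_chains B (card B)" using assms(1,2) by (simp add: card_gt_0_iff)
  have "?w = (\<lambda>ys. r * ?s ys)"
  proof (rule alt_chains_top_eqI[OF w])
    show "(\<lambda>ys. r * ?s ys) \<in> alt_chains B (card B)"
      by (rule rat_fun.subspace_scale[OF subspace_alt_chains simplex_list_of_alt_chains[OF assms(1)]])
    show "set (list_of B) = B" "distinct (list_of B)" using assms(1) by (simp_all add: list_of)
    show "?w (list_of B) = r * ?s (list_of B)"
      using assms(1) by (simp add: r_def simplex_self list_of)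
  qed
  then have "bdry B ?w = (\<lambda>ys. r * top_cycle B ys)" by (simp add: bdry_scale top_cycle_def)
  then have "v = (\<lambda>ys. r * top_cycle B ys)"
    using assms(3) bdry_wedge_cycle[OF sum_barycentre[OF assms(1,2)], of v] by (simp add: alt_cycles_def)
  then show ?thesis by (rule that)
qed

lemma linear_outer_left: "Vector_Spaces.linear scale_fun scale_fun (\<lambda>u. outer u v)"
  by (rule linear_funI) (auto simp: outer_def fun_eq_iff distrib_left distrib_right)

lemma linear_outer_right: "Vector_Spaces.linear scale_fun scale_fun (\<lambda>v. outer u v)"
  by (rule linear_funI) (auto simp: outer_def fun_eq_iff distrib_left distrib_right)

lemma linear_cross: "Vector_Spaces.linear scale_fun scale_fun (cross A B)"
  by (rule linear_funI) (simp_all add: cross_add cross_scale)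

text \<open>Tensoring with a line: scalars move into the first factor, and every element of the span
  is a pure tensor with the top cycle.\<close>

lemma span_outer_top_right:
  assumes "finite B" "B \<noteq> {}" "rat_fun.subspace U"
  shows "rat_fun.span {outer u v | u v. u \<in> U \<and> v \<in> alt_cycles B (card B - 1)}
    = (\<lambda>u. outer u (top_cycle B)) ` U" (is "rat_fun.span ?S = ?T")
proof
  have "?S \<subseteq> ?T"
  proof clarify
    fix u v assume u: "u \<in> U" and "v \<in> alt_cycles B (card B - 1)"
    then obtain r where v: "v = (\<lambda>ys. r * top_cycle B ys)"
      using alt_cycles_top[OF assms(1,2)] by blast
    have "outer u v = outer (\<lambda>x. r * u x) (top_cycle B)" by (auto simp: outer_def v)
    show "outer u v \<in> ?T"
      unfolding \<open>outer u v = _\<close> by (intro imageI rat_fun.subspace_scale[OF assms(3) u])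
  qed
  then show "rat_fun.span ?S \<subseteq> ?T"
    by (rule rat_fun.span_minimal)
      (rule rat_fun_pair.linear_subspace_image[OF linear_outer_left assms(3)])
  show "?T \<subseteq> rat_fun.span ?S"
    using top_cycle_alt_cycles[OF assms(1,2)] by (auto intro!: rat_fun.span_base)
qed

lemma span_outer_top_left:
  assumes "finite A" "A \<noteq> {}" "rat_fun.subspace U"
  shows "rat_fun.span {outer v u | v u. v \<in> alt_cycles A (card A - 1) \<and> u \<in> U}
    = (\<lambda>u. outer (top_cycle A) u) ` U" (is "rat_fun.span ?S = ?T")
proof
  have "?S \<subseteq> ?T"
  proof clarify
    fix u v assume u: "u \<in> U" and "v \<in> alt_cycles A (card A - 1)"
    then obtain r where v: "v = (\<lambda>ys. r * top_cycle A ys)"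
      using alt_cycles_top[OF assms(1,2)] by blast
    have "outer v u = outer (top_cycle A) (\<lambda>x. r * u x)" by (auto simp: outer_def v)
    show "outer v u \<in> ?T"
      unfolding \<open>outer v u = _\<close> by (intro imageI rat_fun.subspace_scale[OF assms(3) u])
  qed
  then show "rat_fun.span ?S \<subseteq> ?T"
    by (rule rat_fun.span_minimal)
      (rule rat_fun_pair.linear_subspace_image[OF linear_outer_right assms(3)])
  show "?T \<subseteq> rat_fun.span ?S"
    using top_cycle_alt_cycles[OF assms(1,2)] by (auto intro!: rat_fun.span_base)
qed

context
  fixes A :: "'a set" and B :: "'b set"
  assumes fin: "finite A" "finite B" and ne: "A \<noteq> {}" "B \<noteq> {}"
begin

lemma wedge_outer:
  "wedge_left w (wedge_right w' (outer u v)) = outer (wedge w u) (wedge w' v)"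
proof (rule ext, clarify)
  fix xs ys
  have "wedge_left w (wedge_right w' (outer u v)) (xs, ys) = wedge w (\<lambda>xs. wedge w' v ys * u xs) xs"
    by (simp add: wedge_left_def wedge_right_def outer_def wedge_scale mult.commute)
  then show "wedge_left w (wedge_right w' (outer u v)) (xs, ys) = outer (wedge w u) (wedge w' v) (xs, ys)"
    by (simp add: wedge_scale outer_def)
qed

lemma cross_outer_alt_cycles:
  assumes "u \<in> alt_cycles A p" "v \<in> alt_cycles B q"
  shows "cross A B (outer u v) \<in> alt_cycles (A <+> B) (Suc (p + q))"
proof -
  have "join (outer (wedge (barycentre A) u) (wedge (barycentre B) v)) \<in> alt_chains (A <+> B) (Suc p + Suc q)"
    using assms by (intro join_outer_alt_chains wedge_alt_chains) (auto simp: alt_cycles_def barycentre_support)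
  then show ?thesis
    unfolding cross_def wedge_outer by (intro bdry_in_alt_cycles) simp
qed

lemma cross_outer:
  assumes "u \<in> alt_cycles A p" "v \<in> alt_cycles B q"
  shows "cross A B (outer u v) zs = shuffle_sign zs *
    (u (lefts zs) * wedge (barycentre B) v (rights zs)
      + (-1) ^ length (lefts zs) * wedge (barycentre A) u (lefts zs) * v (rights zs))"
  using assms
  unfolding cross_def wedge_outer bdry_join_outer[OF fin] alt_cycles_def
  by (simp add: bdry_wedge_cycle sum_barycentre fin ne)

lemma length_full_lefts: "Inl ` A \<subseteq> set zs \<Longrightarrow> card A \<le> length (lefts zs)"
proof -
  assume "Inl ` A \<subseteq> set zs"
  then have "A \<subseteq> set (lefts zs)" by (auto simp: set_lefts)
  then show ?thesis by (meson List.finite_set card_length card_mono le_trans)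
qed

lemma length_full_rights: "Inr ` B \<subseteq> set zs \<Longrightarrow> card B \<le> length (rights zs)"
proof -
  assume "Inr ` B \<subseteq> set zs"
  then have "B \<subseteq> set (rights zs)" by (auto simp: set_rights)
  then show ?thesis by (meson List.finite_set card_length card_mono le_trans)
qed

text \<open>A simplex in the product has \<open>p\<close> or \<open>p + 1\<close> left vertices, too
  few to exhaust \<open>A\<close>.\<close>

lemma cross_outer_avoids_left:
  assumes u: "u \<in> alt_cycles A p" and v: "v \<in> alt_cycles B q" and "Suc p < card A" "Inl ` A \<subseteq> set zs"
  shows "cross A B (outer u v) zs = 0"
proof -
  have len: "length (lefts zs) > Suc p" using length_full_lefts[OF assms(4)] assms(3) by simp
  have uc: "u \<in> alt_chains A p" using u by (simp add: alt_cycles_def)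
  have "u (lefts zs) = 0" using alt_chainsD(3)[OF uc] len by fastforce
  moreover have "wedge (barycentre A) u (lefts zs) = 0"
    using alt_chainsD(3)[OF wedge_alt_chains[OF uc barycentre_support]] len by fastforce
  ultimately show ?thesis by (simp add: cross_outer[OF u v])
qed

lemma cross_outer_avoids_right:
  assumes u: "u \<in> alt_cycles A p" and v: "v \<in> alt_cycles B q" and "Suc q < card B" "Inr ` B \<subseteq> set zs"
  shows "cross A B (outer u v) zs = 0"
proof -
  have len: "length (rights zs) > Suc q" using length_full_rights[OF assms(4)] assms(3) by simp
  have vc: "v \<in> alt_chains B q" using v by (simp add: alt_cycles_def)
  have "v (rights zs) = 0" using alt_chainsD(3)[OF vc] len by fastforce
  moreover have "wedge (barycentre B) v (rights zs) = 0"
    using alt_chainsD(3)[OF wedge_alt_chains[OF vc barycentre_support]] len by fastforce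
  ultimately show ?thesis by (simp add: cross_outer[OF u v])
qed

text \<open>Slicing at \<open>B\<close> inverts the product from the left: the cone over the top
  cycle has value 1 at \<open>list_of B\<close>, while the top cycle itself is one vertex short of
  seeing that list.\<close>

lemma cross_top_right:
  assumes u: "u \<in> alt_cycles A p"
  shows "cross A B (outer u (top_cycle B)) (map Inl xs @ map Inr (list_of B)) = u xs"
proof -
  note t = top_cycle_alt_cycles[OF fin(2) ne(2)]
  have "card B > 0" using fin ne by (simp add: card_gt_0_iff)
  then have "top_cycle B (list_of B) = 0"
    using t alt_chainsD(3)[of "top_cycle B" B "card B - 1" "list_of B"] list_of(3)[OF fin(2)]
    by (fastforce simp: alt_cycles_def)
  then show ?thesis
    by (simp add: cross_outer[OF u t] wedge_top_cycle[OF fin(2) ne(2)] simplex_self list_of(1)[OF fin(2)])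
qed

text \<open>The sign comes from the second term of the Leibniz rule: the apex removed from the right
  cone stands behind all the vertices of \<open>A\<close>.\<close>

lemma cross_top_left:
  assumes v: "v \<in> alt_cycles B q"
  shows "cross A B (outer (top_cycle A) v) (map Inl (list_of A) @ map Inr ys) = (-1) ^ card A * v ys"
proof -
  note t = top_cycle_alt_cycles[OF fin(1) ne(1)]
  have "card A > 0" using fin ne by (simp add: card_gt_0_iff)
  then have "top_cycle A (list_of A) = 0"
    using t alt_chainsD(3)[of "top_cycle A" A "card A - 1" "list_of A"] list_of(3)[OF fin(1)]
    by (fastforce simp: alt_cycles_def)
  then show ?thesis
    by (simp add: cross_outer[OF t v] wedge_top_cycle[OF fin(1) ne(1)] simplex_self list_of[OF fin(1)])
qed

text \<open>Vanishing is unaffected by rearrangement, so lists that end in \<open>list_of B\<close>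
  represent all the lists containing \<open>B\<close>.\<close>

lemma avoids_rightI:
  assumes c: "c \<in> alt_chains (A <+> B) L" and "\<And>xs. c (map Inl xs @ map Inr (list_of B)) = 0"
    and zs: "Inr ` B \<subseteq> set zs"
  shows "c zs = 0"
proof (rule ccontr)
  assume nz: "c zs \<noteq> 0"
  have "set (rights zs) = B"
    using alt_chainsD(2)[OF c nz] zs by (auto simp: set_rights)
  then have "mset (rights zs) = mset (list_of B)"
    using distinct_rights[OF alt_chainsD(4)[OF c nz]] list_of[OF fin(2)] set_eq_iff_mset_eq_distinct by metis
  then have "mset zs = mset (map Inl (lefts zs) @ map Inr (list_of B))"
    unfolding mset_lefts_rights[of zs, symmetric] by simp
  then have "c zs = 0"
    by (rule alternating_vanish[OF alt_chainsD(1)[OF c] _ assms(2)])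
  with nz show False ..
qed

lemma avoids_leftI:
  assumes c: "c \<in> alt_chains (A <+> B) L" and "\<And>ys. c (map Inl (list_of A) @ map Inr ys) = 0"
    and zs: "Inl ` A \<subseteq> set zs"
  shows "c zs = 0"
proof (rule ccontr)
  assume nz: "c zs \<noteq> 0"
  have "set (lefts zs) = A"
    using alt_chainsD(2)[OF c nz] zs by (auto simp: set_lefts)
  then have "mset (lefts zs) = mset (list_of A)"
    using distinct_lefts[OF alt_chainsD(4)[OF c nz]] list_of[OF fin(1)] set_eq_iff_mset_eq_distinct by metis
  then have "mset zs = mset (map Inl (list_of A) @ map Inr (rights zs))"
    unfolding mset_lefts_rights[of zs, symmetric] by simp
  then have "c zs = 0"
    by (rule alternating_vanish[OF alt_chainsD(1)[OF c] _ assms(2)])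
  with nz show False ..
qed

text \<open>A list that already contains \<open>B\<close> admits no further vertex of
  \<open>B\<close>, so on such lists the boundary over the union is the boundary over
  \<open>A\<close>.\<close>

lemma slice_right:
  assumes y: "y \<in> alt_chains (A <+> B) L" and "card B \<le> L"
    and bd: "\<And>zs. Inr ` B \<subseteq> set zs \<Longrightarrow> bdry (A <+> B) y zs = 0"
  shows "(\<lambda>xs. y (map Inl xs @ map Inr (list_of B))) \<in> alt_cycles A (L - card B)" (is "?u \<in> _")
proof -
  have "?u \<in> alt_chains A (L - card B)"
  proof (rule alt_chainsI)
    show "alternating ?u"
    proof (rule alternatingI)
      fix xs a b ys
      show "?u (xs @ a # b # ys) = - ?u (xs @ b # a # ys)"
        using alternatingD[OF alt_chainsD(1)[OF y], of "map Inl xs" "Inl a" "Inl b"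
            "map Inl ys @ map Inr (list_of B)"] by simp
    qed
    fix xs assume nz: "?u xs \<noteq> 0"
    from alt_chainsD(2,3)[OF y nz] show "set xs \<subseteq> A \<and> length xs = L - card B"
      by (auto simp: list_of[OF fin(2)])
  qed
  moreover have "bdry A ?u = 0"
  proof
    fix xs :: "'a list"
    let ?zs = "map Inl xs @ map Inr (list_of B)"
    have "y (Inr b # ?zs) = 0" if "b \<in> B" for b
    proof (rule ccontr)
      assume nz: "y (Inr b # ?zs) \<noteq> 0"
      from alt_chainsD(4)[OF y nz] show False using that by (simp add: list_of[OF fin(2)])
    qed
    then have "bdry A ?u xs = bdry (A <+> B) y ?zs"
      unfolding bdry_Plus[OF fin] by (simp add: bdry_def)
    also have "\<dots> = 0" by (rule bd) (auto simp: list_of[OF fin(2)])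
    finally show "bdry A ?u xs = 0 xs" by simp
  qed
  ultimately show ?thesis by (simp add: alt_cycles_def)
qed

lemma slice_left:
  assumes y: "y \<in> alt_chains (A <+> B) L" and "card A \<le> L"
    and bd: "\<And>zs. Inl ` A \<subseteq> set zs \<Longrightarrow> bdry (A <+> B) y zs = 0"
  shows "(\<lambda>ys. y (map Inl (list_of A) @ map Inr ys)) \<in> alt_cycles B (L - card A)" (is "?u \<in> _")
proof -
  have "?u \<in> alt_chains B (L - card A)"
  proof (rule alt_chainsI)
    show "alternating ?u"
    proof (rule alternatingI)
      fix xs a b ys
      show "?u (xs @ a # b # ys) = - ?u (xs @ b # a # ys)"
        using alternatingD[OF alt_chainsD(1)[OF y], of "map Inl (list_of A) @ map Inr xs" "Inr a" "Inr b"
            "map Inr ys"] by simp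
    qed
    fix xs assume nz: "?u xs \<noteq> 0"
    from alt_chainsD(2,3)[OF y nz] show "set xs \<subseteq> B \<and> length xs = L - card A"
      by (auto simp: list_of[OF fin(1)])
  qed
  moreover have "bdry B ?u = 0"
  proof
    fix ys :: "'b list"
    let ?as = "map Inl (list_of A) :: ('a + 'b) list"
    let ?zs = "?as @ map Inr ys"
    have "y (Inl a # ?zs) = 0" if "a \<in> A" for a
    proof (rule ccontr)
      assume nz: "y (Inl a # ?zs) \<noteq> 0"
      from alt_chainsD(4)[OF y nz] show False using that by (simp add: list_of[OF fin(1)])
    qed
    then have "bdry (A <+> B) y ?zs = (\<Sum>b\<in>B. y (Inr b # ?zs))"
      unfolding bdry_Plus[OF fin] by simp
    \<comment> \<open>Here the new vertex must pass the whole prefix \<open>?as\<close>. The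
      resulting sign is common to all summands and does not affect vanishing.\<close>
    also have "\<dots> = (\<Sum>b\<in>B. (-1) ^ card A * y (?as @ Inr b # map Inr ys))"
      using alternating_shift[OF alt_chainsD(1)[OF y], of _ ?as "map Inr ys"]
      by (intro sum.cong refl) (simp add: list_of[OF fin(1)])
    also have "\<dots> = (-1) ^ card A * bdry B ?u ys"
      by (simp add: bdry_def sum_distrib_left)
    finally have "(-1) ^ card A * bdry B ?u ys = 0"
      using bd[of ?zs] by (auto simp: list_of[OF fin(1)])
    then show "bdry B ?u ys = 0 ys" by simp
  qed
  ultimately show ?thesis by (simp add: alt_cycles_def)
qed

text \<open>The summands of \<open>alt_cycles (A <+> B) L\<close> that see the simplices containing all of
  \<open>B\<close> (respectively all of \<open>A\<close>).\<close>

definition right_part :: "nat \<Rightarrow> ('a list \<times> 'b list \<Rightarrow> rat) set" where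
  "right_part L = (\<lambda>u. outer u (top_cycle B)) ` (if card B \<le> L then alt_cycles A (L - card B) else {0})"

definition left_part :: "nat \<Rightarrow> ('a list \<times> 'b list \<Rightarrow> rat) set" where
  "left_part L = (\<lambda>v. outer (top_cycle A) v) ` (if card A \<le> L then alt_cycles B (L - card A) else {0})"

text \<open>The bound on the size of a face is absorbed into the length of the lists: for lengths up
  to that bound these are the chains of the cut complex.\<close>

definition avoiding :: "nat \<Rightarrow> (('a + 'b) list \<Rightarrow> rat) set" where
  "avoiding L = {c \<in> alt_chains (A <+> B) L.
     \<forall>zs. Inl ` A \<subseteq> set zs \<or> Inr ` B \<subseteq> set zs \<longrightarrow> c zs = 0}"

lemma zero_alt_cycles: "0 \<in> alt_cycles C l"
  by (rule rat_fun.subspace_0[OF subspace_alt_cycles])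

text \<open>Merges the two cases of the definition. Zero is a cycle in the truncated degree as well,
  so the inequality matters only for nonzero \<open>u\<close>.\<close>

lemma right_partE:
  assumes "F \<in> right_part L"
  obtains u where "F = outer u (top_cycle B)" "u \<in> alt_cycles A (L - card B)" "card B \<le> L \<or> u = 0"
  using assms zero_alt_cycles by (auto simp: right_part_def split: if_splits)

lemma left_partE:
  assumes "F \<in> left_part L"
  obtains v where "F = outer (top_cycle A) v" "v \<in> alt_cycles B (L - card A)" "card A \<le> L \<or> v = 0"
  using assms zero_alt_cycles by (auto simp: left_part_def split: if_splits)

lemma cross_zero: "cross A B (outer 0 v) = 0" "cross A B (outer u 0) = 0"
proof -
  have zero: "cross A B (\<lambda>x. 0) = (\<lambda>x. 0)"
    using cross_scale[of A B 0 "\<lambda>x. 0"] by simp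
  have "outer (0 :: 'a list \<Rightarrow> rat) v = (\<lambda>x. 0)" "outer u (0 :: 'b list \<Rightarrow> rat) = (\<lambda>x. 0)"
    by (auto simp: outer_def)
  then show "cross A B (outer 0 v) = 0" "cross A B (outer u 0) = 0"
    using zero by (simp_all add: zero_fun_def)
qed

text \<open>A triangularity statement: the right part is invisible on simplices containing
  \<open>A\<close> and detected on those containing \<open>B\<close>. With its mirror image this
  separates the parts from each other and from the chains of the complex.\<close>

lemma cross_right_part:
  assumes F: "F \<in> right_part L" and L: "L + 2 \<le> card A + card B"
  shows "cross A B F \<in> alt_cycles (A <+> B) L" "Inl ` A \<subseteq> set zs \<Longrightarrow> cross A B F zs = 0"
    "(\<And>zs. Inr ` B \<subseteq> set zs \<Longrightarrow> cross A B F zs = 0) \<Longrightarrow> F = 0"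
proof -
  obtain u where u: "F = outer u (top_cycle B)" "u \<in> alt_cycles A (L - card B)" "card B \<le> L \<or> u = 0"
    using right_partE[OF F] .
  have "card B > 0" using fin ne by (simp add: card_gt_0_iff)
  show "cross A B F \<in> alt_cycles (A <+> B) L"
  proof (cases "u = 0")
    case True
    then show ?thesis using cross_zero zero_alt_cycles by (simp add: u(1))
  next
    case False
    then have "Suc (L - card B + (card B - 1)) = L" using u(3) \<open>card B > 0\<close> by simp
    then show ?thesis
      using cross_outer_alt_cycles[OF u(2) top_cycle_alt_cycles[OF fin(2) ne(2)]] u(1) by simp
  qed
  show "cross A B F zs = 0" if "Inl ` A \<subseteq> set zs"
  proof (cases "u = 0")
    case True
    then show ?thesis using cross_zero by (simp add: u(1))
  next
    case False
    \<comment> \<open>This is where \<open>k >= 2\<close> enters: \<open>u\<close> has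
      \<open>m - k\<close> vertices and its cone \<open>m - k + 1\<close>, which must stay below
      \<open>m\<close>.\<close>
    then have "Suc (L - card B) < card A" using u(3) L by simp
    then show ?thesis
      unfolding u(1) using cross_outer_avoids_left[OF u(2) top_cycle_alt_cycles[OF fin(2) ne(2)]] that by simp
  qed
  show "F = 0" if "\<And>zs. Inr ` B \<subseteq> set zs \<Longrightarrow> cross A B F zs = 0"
  proof -
    have "u xs = 0" for xs
      using that[of "map Inl xs @ map Inr (list_of B)"]
      by (simp add: u(1) cross_top_right[OF u(2)] list_of[OF fin(2)])
    then show ?thesis by (auto simp: u(1) outer_def fun_eq_iff)
  qed
qed

lemma cross_left_part:
  assumes F: "F \<in> left_part L" and L: "L + 2 \<le> card A + card B"
  shows "cross A B F \<in> alt_cycles (A <+> B) L" "Inr ` B \<subseteq> set zs \<Longrightarrow> cross A B F zs = 0"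
    "(\<And>zs. Inl ` A \<subseteq> set zs \<Longrightarrow> cross A B F zs = 0) \<Longrightarrow> F = 0"
proof -
  obtain v where v: "F = outer (top_cycle A) v" "v \<in> alt_cycles B (L - card A)" "card A \<le> L \<or> v = 0"
    using left_partE[OF F] .
  have "card A > 0" using fin ne by (simp add: card_gt_0_iff)
  show "cross A B F \<in> alt_cycles (A <+> B) L"
  proof (cases "v = 0")
    case True
    then show ?thesis using cross_zero zero_alt_cycles by (simp add: v(1))
  next
    case False
    then have "Suc (card A - 1 + (L - card A)) = L" using v(3) \<open>card A > 0\<close> by simp
    then show ?thesis
      using cross_outer_alt_cycles[OF top_cycle_alt_cycles[OF fin(1) ne(1)] v(2)] v(1) by simp
  qed
  show "cross A B F zs = 0" if "Inr ` B \<subseteq> set zs"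
  proof (cases "v = 0")
    case True
    then show ?thesis using cross_zero by (simp add: v(1))
  next
    case False
    then have "Suc (L - card A) < card B" using v(3) L by simp
    then show ?thesis
      unfolding v(1) using cross_outer_avoids_right[OF top_cycle_alt_cycles[OF fin(1) ne(1)] v(2)] that by simp
  qed
  show "F = 0" if "\<And>zs. Inl ` A \<subseteq> set zs \<Longrightarrow> cross A B F zs = 0"
  proof -
    have "v ys = 0" for ys
      using that[of "map Inl (list_of A) @ map Inr ys"]
      by (simp add: v(1) cross_top_left[OF v(2)] list_of[OF fin(1)])
    then show ?thesis by (auto simp: v(1) outer_def fun_eq_iff)
  qed
qed

text \<open>The hypothesis on the boundary makes the two slices of \<open>y\<close> cycles.
  Subtracting the product of each slice with the opposite top cycle clears one kind of forbidden
  simplex, and by triangularity neither correction disturbs the other.\<close>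

lemma decompose_chain:
  assumes y: "y \<in> alt_chains (A <+> B) L" and L: "L + 2 \<le> card A + card B"
    and bd: "\<And>zs. Inl ` A \<subseteq> set zs \<or> Inr ` B \<subseteq> set zs \<Longrightarrow> bdry (A <+> B) y zs = 0"
  obtains c F G where "c \<in> avoiding L" "F \<in> right_part L" "G \<in> left_part L"
    "y = c + cross A B F + cross A B G"
proof -
  define u where "u = (\<lambda>xs. y (map Inl xs @ map Inr (list_of B)))"
  \<comment> \<open>The sign cancels the one in \<open>cross_top_left\<close>.\<close>
  define v where "v = (\<lambda>ys. (-1) ^ card A * y (map Inl (list_of A) @ map Inr ys))"
  have u: "u \<in> (if card B \<le> L then alt_cycles A (L - card B) else {0})"
  proof (cases "card B \<le> L")
    case True
    then show ?thesis using slice_right[OF y True] bd unfolding u_def by simp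
  next
    case False
    have "u xs = 0" for xs
      unfolding u_def
    proof (rule ccontr)
      assume nz: "y (map Inl xs @ map Inr (list_of B)) \<noteq> 0"
      from alt_chainsD(3)[OF y nz] show False using False by (simp add: list_of[OF fin(2)])
    qed
    then show ?thesis using False by auto
  qed
  have v: "v \<in> (if card A \<le> L then alt_cycles B (L - card A) else {0})"
  proof (cases "card A \<le> L")
    case True
    have "v \<in> alt_cycles B (L - card A)"
      unfolding v_def using slice_left[OF y True] bd
      by (intro rat_fun.subspace_scale[OF subspace_alt_cycles]) simp
    then show ?thesis using True by simp
  next
    case False
    have "v ys = 0" for ys
    proof -
      have "y (map Inl (list_of A) @ map Inr ys) = 0"
      proof (rule ccontr)
        assume nz: "y (map Inl (list_of A) @ map Inr ys) \<noteq> 0"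
        from alt_chainsD(3)[OF y nz] show False using False by (simp add: list_of[OF fin(1)])
      qed
      then show ?thesis by (simp add: v_def)
    qed
    then show ?thesis using False by auto
  qed
  have u': "u \<in> alt_cycles A (L - card B)" and v': "v \<in> alt_cycles B (L - card A)"
    using u v zero_alt_cycles by (auto split: if_splits)
  define F where "F = outer u (top_cycle B)"
  define G where "G = outer (top_cycle A) v"
  have F: "F \<in> right_part L" unfolding F_def right_part_def using u by (rule imageI)
  have G: "G \<in> left_part L" unfolding G_def left_part_def using v by (rule imageI)
  define c where "c = y - cross A B F - cross A B G"
  have "cross A B F \<in> alt_chains (A <+> B) L" "cross A B G \<in> alt_chains (A <+> B) L"
    using cross_right_part(1)[OF F L] cross_left_part(1)[OF G L] by (auto simp: alt_cycles_def)
  then have c: "c \<in> alt_chains (A <+> B) L"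
    unfolding c_def using y by (intro rat_fun.subspace_diff[OF subspace_alt_chains])
  have "c (map Inl xs @ map Inr (list_of B)) = 0" for xs
    using cross_top_right[OF u', of xs] cross_left_part(2)[OF G L, of "map Inl xs @ map Inr (list_of B)"]
    by (simp add: c_def F_def u_def list_of[OF fin(2)])
  then have "c zs = 0" if "Inr ` B \<subseteq> set zs" for zs
    using avoids_rightI[OF c] that by blast
  moreover have "c (map Inl (list_of A) @ map Inr ys) = 0" for ys
    using cross_top_left[OF v', of ys] cross_right_part(2)[OF F L, of "map Inl (list_of A) @ map Inr ys"]
    by (simp add: c_def G_def v_def list_of[OF fin(1)] flip: power_mult_distrib)
  then have "c zs = 0" if "Inl ` A \<subseteq> set zs" for zs
    using avoids_leftI[OF c] that by blast
  ultimately have "c \<in> avoiding L" using c by (auto simp: avoiding_def)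
  moreover have "y = c + cross A B F + cross A B G" by (simp add: c_def)
  ultimately show ?thesis using F G that by blast
qed

end


section \<open>The cut complex of a disjoint union of two complete graphs\<close>

definition join_skeleton :: "'a set \<Rightarrow> 'b set \<Rightarrow> nat \<Rightarrow> ('a + 'b) set set" where
  "join_skeleton A B L =
     {\<sigma>. \<sigma> \<subseteq> A <+> B \<and> card \<sigma> \<le> L \<and> \<not> Inl ` A \<subseteq> \<sigma> \<and> \<not> Inr ` B \<subseteq> \<sigma>}"

lemma fst_graph_sum_complete [simp]:
  "fst (graph_sum (complete_graph A) (complete_graph B)) = A <+> B"
  by (simp add: graph_sum_def complete_graph_def Plus_def)

text \<open>Edges preserve the side of a vertex, and distinct vertices on one side are adjacent. The
  empty set is excluded because \<open>connected_graph\<close> counts the empty graph as not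
  connected.\<close>

lemma not_connected_graph_sum:
  assumes S: "S \<subseteq> A <+> B" "S \<noteq> {}"
  shows "\<not> connected_graph (induced_graph (graph_sum (complete_graph A) (complete_graph B)) S)
    \<longleftrightarrow> S \<inter> Inl ` A \<noteq> {} \<and> S \<inter> Inr ` B \<noteq> {}" (is "\<not> connected_graph ?G \<longleftrightarrow> ?R")
proof -
  let ?E = "{(x, y). {x, y} \<in> snd ?G}"
  have fst: "fst ?G = S" using S(1) by (auto simp: induced_graph_def)
  have edge: "{x, y} \<in> snd ?G \<longleftrightarrow> {x, y} \<subseteq> S \<and> x \<noteq> y \<and> isl x = isl y" for x y
  proof
    assume "{x, y} \<in> snd ?G"
    then have sub: "{x, y} \<subseteq> S" and "{x, y} \<in> image Inl ` {e. e \<subseteq> A \<and> card e = 2} \<or>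
        {x, y} \<in> image Inr ` {e. e \<subseteq> B \<and> card e = 2}"
      by (auto simp: induced_graph_def graph_sum_def complete_graph_def)
    then show "{x, y} \<subseteq> S \<and> x \<noteq> y \<and> isl x = isl y"
    proof (elim disjE imageE)
      fix e assume e: "{x, y} = Inl ` e" "e \<in> {e. e \<subseteq> A \<and> card e = 2}"
      then obtain a b where ab: "e = {a, b}" "a \<noteq> b" by (auto simp: card_2_iff)
      show ?thesis using sub e(1) ab by (auto simp: doubleton_eq_iff)
    next
      fix e assume e: "{x, y} = Inr ` e" "e \<in> {e. e \<subseteq> B \<and> card e = 2}"
      then obtain a b where ab: "e = {a, b}" "a \<noteq> b" by (auto simp: card_2_iff)
      show ?thesis using sub e(1) ab by (auto simp: doubleton_eq_iff)
    qed
  next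
    assume R: "{x, y} \<subseteq> S \<and> x \<noteq> y \<and> isl x = isl y"
    then have xy: "x \<in> A <+> B" "y \<in> A <+> B" using S(1) by auto
    have "{x, y} \<in> snd (graph_sum (complete_graph A) (complete_graph B))"
    proof (cases x)
      case (Inl a)
      with R obtain b where b: "y = Inl b" by (cases y) auto
      have "{x, y} = Inl ` {a, b}" "{a, b} \<in> {e. e \<subseteq> A \<and> card e = 2}"
        using R xy Inl b by auto
      then have "{x, y} \<in> image Inl ` {e. e \<subseteq> A \<and> card e = 2}" by (rule image_eqI)
      then show ?thesis unfolding graph_sum_def complete_graph_def snd_conv by (rule UnI1)
    next
      case (Inr a)
      with R obtain b where b: "y = Inr b" by (cases y) auto
      have "{x, y} = Inr ` {a, b}" "{a, b} \<in> {e. e \<subseteq> B \<and> card e = 2}"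
        using R xy Inr b by auto
      then have "{x, y} \<in> image Inr ` {e. e \<subseteq> B \<and> card e = 2}" by (rule image_eqI)
      then show ?thesis unfolding graph_sum_def complete_graph_def snd_conv by (rule UnI2)
    qed
    then show "{x, y} \<in> snd ?G" using R by (simp add: induced_graph_def)
  qed
  show ?thesis
  proof
    assume R: ?R
    then obtain a b where ab: "Inl a \<in> S" "Inr b \<in> S" by blast
    have "isl y = isl x" if "(x, y) \<in> ?E\<^sup>*" for x y
      using that by (induction rule: rtrancl_induct) (auto simp: edge)
    from this[of "Inl a" "Inr b"] have "(Inl a, Inr b) \<notin> ?E\<^sup>*" by auto
    then show "\<not> connected_graph ?G" using ab unfolding connected_graph_def fst by blast
  next
    assume nc: "\<not> connected_graph ?G"
    show ?R
    proof (rule ccontr)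
      assume nR: "\<not> ?R"
      have same: "isl x = isl y" if "x \<in> S" "y \<in> S" for x y
      proof -
        have "x \<in> A <+> B" "y \<in> A <+> B" using that S(1) by auto
        then show ?thesis
          using that nR by (cases x rule: sum.exhaust; cases y rule: sum.exhaust) auto
      qed
      have "(x, y) \<in> ?E\<^sup>*" if "x \<in> S" "y \<in> S" for x y
      proof (cases "x = y")
        case False
        then have "(x, y) \<in> ?E" using that same[OF that] by (simp add: edge)
        then show ?thesis by blast
      qed simp
      then have "connected_graph ?G" using S(2) by (simp add: connected_graph_def fst)
      with nc show False ..
    qed
  qed
qed

section \<open>Faces, facets and dimension of the cut complex\<close>

context
  fixes A :: "'a set" and B :: "'b set" and L :: nat
  assumes fin: "finite A" "finite B" and ne: "A \<noteq> {}" "B \<noteq> {}"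
    and L: "L + 2 \<le> card A + card B"
begin

lemma card_Plus_AB: "card (A <+> B) = card A + card B"
  using fin by (rule card_Plus)

lemma finite_face: "\<sigma> \<in> join_skeleton A B L \<Longrightarrow> finite \<sigma>"
  using fin by (auto simp: join_skeleton_def intro: finite_subset)

lemma finite_join_skeleton: "finite (join_skeleton A B L)"
  by (rule finite_subset[of _ "Pow (A <+> B)"]) (auto simp: join_skeleton_def fin)

text \<open>Built through complements: one missing vertex of each clique is reserved, and this pair
  is enlarged to a complement of size \<open>k\<close> disjoint from the face. There is room for the
  pair because \<open>k >= 2\<close>.\<close>

lemma face_extend:
  assumes "\<sigma> \<in> join_skeleton A B L"
  obtains F where "\<sigma> \<subseteq> F" "F \<in> join_skeleton A B L" "card F = L"
proof -
  have \<sigma>: "\<sigma> \<subseteq> A <+> B" "card \<sigma> \<le> L" using assms by (auto simp: join_skeleton_def)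
  obtain a b where ab: "a \<in> A" "b \<in> B" "Inl a \<notin> \<sigma>" "Inr b \<notin> \<sigma>"
    using assms by (auto simp: join_skeleton_def)
  let ?V = "A <+> B" and ?k = "card A + card B - L"
  have "card (?V - \<sigma>) = card A + card B - card \<sigma>"
    using \<sigma> finite_face[OF assms] by (simp add: card_Diff_subset card_Plus_AB)
  then have "?k \<le> card (?V - \<sigma>)" using \<sigma>(2) by simp
  moreover have "card {Inl a, Inr b} \<le> ?k" using L by simp
  moreover have "{Inl a, Inr b} \<subseteq> ?V - \<sigma>" using ab by auto
  ultimately obtain S where S: "{Inl a, Inr b} \<subseteq> S" "S \<subseteq> ?V - \<sigma>" "card S = ?k"
    using exists_subset_between[of "{Inl a, Inr b}" ?k "?V - \<sigma>"] fin by auto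
  have "finite S" using S(2) fin by (meson finite_Diff finite_Plus finite_subset)
  then have "card (?V - S) = L"
    using S L by (subst card_Diff_subset) (auto simp: card_Plus_AB)
  moreover have "\<not> Inl ` A \<subseteq> ?V - S" "\<not> Inr ` B \<subseteq> ?V - S" using S(1) ab by auto
  moreover have "\<sigma> \<subseteq> ?V - S" using S(2) \<sigma>(1) by blast
  ultimately show ?thesis by (intro that[of "?V - S"]) (auto simp: join_skeleton_def)
qed

lemma cut_complex_graph_sum:
  "cut_complex (card A + card B - L) (graph_sum (complete_graph A) (complete_graph B)) = join_skeleton A B L"
  (is "cut_complex ?k ?G = _")
proof (intro equalityI subsetI)
  let ?V = "A <+> B"
  fix \<sigma> assume "\<sigma> \<in> cut_complex ?k ?G"
  then obtain F where F: "\<sigma> \<subseteq> F" "F \<subseteq> ?V" "card F + ?k = card ?V"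
    "\<not> connected_graph (induced_graph ?G (?V - F))"
    by (auto simp: cut_complex_def)
  have "finite F" using F(2) fin by (meson finite_Plus finite_subset)
  then have "card F = L" "card \<sigma> \<le> card F"
    using F(1,3) L by (auto simp: card_Plus_AB intro: card_mono)
  moreover have "?V - F \<noteq> {}"
  proof
    assume "?V - F = {}"
    then have "F = ?V" using F(2) by blast
    then show False using \<open>card F = L\<close> L card_Plus_AB by simp
  qed
  then have "(?V - F) \<inter> Inl ` A \<noteq> {} \<and> (?V - F) \<inter> Inr ` B \<noteq> {}"
    using not_connected_graph_sum[of "?V - F" A B] F(4) by blast
  ultimately show "\<sigma> \<in> join_skeleton A B L" using F(1,2) by (auto simp: join_skeleton_def)
next
  let ?V = "A <+> B"
  fix \<sigma> assume "\<sigma> \<in> join_skeleton A B L"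
  then obtain F where F: "\<sigma> \<subseteq> F" "F \<in> join_skeleton A B L" "card F = L"
    by (rule face_extend)
  have FV: "F \<subseteq> ?V" "\<not> Inl ` A \<subseteq> F" "\<not> Inr ` B \<subseteq> F" using F(2) by (auto simp: join_skeleton_def)
  then have meets: "(?V - F) \<inter> Inl ` A \<noteq> {} \<and> (?V - F) \<inter> Inr ` B \<noteq> {}" by auto
  then have "?V - F \<noteq> {}" by blast
  then have "\<not> connected_graph (induced_graph ?G (?V - F))"
    using not_connected_graph_sum[of "?V - F" A B] meets by blast
  moreover have "card F + ?k = card ?V" using F(3) L card_Plus_AB by simp
  ultimately show "\<sigma> \<in> cut_complex ?k ?G"
    using F(1) FV(1) unfolding cut_complex_def fst_graph_sum_complete by blast
qed

lemma empty_face: "{} \<in> join_skeleton A B L"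
  using ne by (simp add: join_skeleton_def)

lemma facets_join_skeleton: "facets (join_skeleton A B L) = {F \<in> join_skeleton A B L. card F = L}"
proof (intro equalityI subsetI)
  fix F assume F: "F \<in> facets (join_skeleton A B L)"
  then have "F \<in> join_skeleton A B L" by (simp add: facets_def)
  then obtain F' where "F \<subseteq> F'" "F' \<in> join_skeleton A B L" "card F' = L"
    by (rule face_extend)
  then show "F \<in> {F \<in> join_skeleton A B L. card F = L}"
    using F by (auto simp: facets_def)
next
  fix F assume "F \<in> {F \<in> join_skeleton A B L. card F = L}"
  then have F: "F \<in> join_skeleton A B L" "card F = L" by auto
  have "\<sigma> = F" if "\<sigma> \<in> join_skeleton A B L" "F \<subseteq> \<sigma>" for \<sigma>
  proof -
    have "card \<sigma> \<le> L" using that(1) by (simp add: join_skeleton_def)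
    then show ?thesis using card_seteq[OF finite_face[OF that(1)] that(2)] F(2) by simp
  qed
  then show "F \<in> facets (join_skeleton A B L)" using F(1) by (simp add: facets_def)
qed

lemma complex_dim_join_skeleton: "complex_dim (join_skeleton A B L) = int L - 1"
proof -
  obtain F where "F \<in> join_skeleton A B L" "card F = L"
    using face_extend[OF empty_face] by blast
  then have "L \<in> card ` join_skeleton A B L" by force
  moreover have "\<And>y. y \<in> card ` join_skeleton A B L \<Longrightarrow> y \<le> L" by (auto simp: join_skeleton_def)
  ultimately have "Max (card ` join_skeleton A B L) = L"
    using finite_join_skeleton by (intro Max_eqI) auto
  then show ?thesis by (simp add: complex_dim_def)
qed

end

section \<open>Shellability from an exchange property of the complements\<close>

lemma set_encode_less_max:
  assumes "finite X" "finite Y" "set_encode X < set_encode Y"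
  obtains y where "y \<in> Y - X" "\<And>x. x \<in> X - Y \<Longrightarrow> x < y"
proof -
  have split: "set_encode X = set_encode (X \<inter> Y) + set_encode (X - Y)" if "finite X" for X Y
    using that unfolding set_encode_def
    by (subst sum.union_disjoint[symmetric]) (auto simp: Int_Diff_Un)
  have less: "set_encode (X - Y) < set_encode (Y - X)"
    using assms split[of X Y] split[of Y X] by (simp add: Int_commute)
  have "Y - X \<noteq> {}"
  proof
    assume "Y - X = {}"
    then have "set_encode (Y - X) = 0" by (simp only: set_encode_empty)
    with less show False by simp
  qed
  define y where "y = Max (Y - X)"
  have y: "y \<in> Y - X" unfolding y_def using assms(2) \<open>Y - X \<noteq> {}\<close> by (intro Max_in) auto
  have "x < y" if x: "x \<in> X - Y" for x
  proof (rule ccontr)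
    assume "\<not> x < y"
    then have xy: "Suc y \<le> x" using x y by (metis DiffD1 DiffD2 not_less_eq_eq not_le linorder_cases Suc_leI)
    \<comment> \<open>The highest differing digit decides: all digits of \<open>Y - X\<close>
      together stay below \<open>2 ^ Suc y\<close>, and a digit \<open>x > y\<close> of
      \<open>X - Y\<close> alone would reach that.\<close>
    have "Y - X \<subseteq> {..<Suc y}" using assms(2) by (auto simp: y_def less_Suc_eq_le)
    then have "set_encode (Y - X) \<le> (\<Sum>i<Suc y. 2 ^ i)"
      unfolding set_encode_def by (intro sum_mono2) auto
    also have "\<dots> < 2 ^ Suc y" by (simp only: lessThan_atLeast0 sum_power2) simp
    also have "\<dots> \<le> 2 ^ x" using xy by (intro power_increasing) auto
    also have "\<dots> \<le> set_encode (X - Y)"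
      unfolding set_encode_def using assms(1) x by (intro member_le_sum) auto
    finally show False using less by simp
  qed
  then show ?thesis using y that by blast
qed

text \<open>A weight replaces positions in the ordering. Every intersection with an earlier facet is
  enlarged to a face of codimension one that still lies in an earlier facet.\<close>

lemma shellableI:
  fixes w :: "'a set \<Rightarrow> nat"
  assumes fin: "finite (facets \<Delta>)" and inj: "inj_on w (facets \<Delta>)"
    and card: "\<And>F. F \<in> facets \<Delta> \<Longrightarrow> finite F"
    and exchange: "\<And>F F'. F \<in> facets \<Delta> \<Longrightarrow> F' \<in> facets \<Delta> \<Longrightarrow> w F' < w F \<Longrightarrow>
      \<exists>x F''. x \<in> F \<and> F'' \<in> facets \<Delta> \<and> w F'' < w F \<and> F \<inter> F' \<subseteq> F - {x} \<and> F - {x} \<subseteq> F''"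
  shows "shellable \<Delta>"
proof -
  define ws where "ws = sorted_list_of_set (w ` facets \<Delta>)"
  define Fs where "Fs = map (inv_into (facets \<Delta>) w) ws"
  have ws: "set ws = w ` facets \<Delta>" "sorted_wrt (<) ws" "distinct ws"
    unfolding ws_def using fin by auto
  have inv: "inv_into (facets \<Delta>) w ` w ` facets \<Delta> = facets \<Delta>"
    using inj by (rule inv_into_image_cancel) simp
  have set: "set Fs = facets \<Delta>" unfolding Fs_def using ws(1) inv by simp
  have dist: "distinct Fs"
    unfolding Fs_def using ws by (simp add: distinct_map inj_on_inv_into)
  have w_nth: "w (Fs ! i) = ws ! i" if "i < length Fs" for i
  proof -
    have "ws ! i \<in> w ` facets \<Delta>" using that ws(1) by (auto simp: Fs_def)
    then show ?thesis using that by (simp add: Fs_def f_inv_into_f)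
  qed
  have less: "w (Fs ! i) < w (Fs ! j) \<longleftrightarrow> i < j" if "i < length Fs" "j < length Fs" for i j
  proof -
    have "length Fs = length ws" by (simp add: Fs_def)
    then show ?thesis
      using that w_nth sorted_wrt_nth_less[OF ws(2)] by (metis linorder_neqE_nat order_less_asym order_less_irrefl)
  qed
  have "card \<sigma> + 1 = card (Fs ! j)"
    if j: "j < length Fs" and \<sigma>: "\<sigma> \<in> facets {\<sigma>. \<sigma> \<subseteq> Fs ! j \<and> (\<exists>i<j. \<sigma> \<subseteq> Fs ! i)}" for j \<sigma>
  proof -
    let ?F = "Fs ! j"
    obtain i where i: "\<sigma> \<subseteq> ?F" "i < j" "\<sigma> \<subseteq> Fs ! i" using \<sigma> by (auto simp: facets_def)
    have in_facets: "Fs ! j \<in> facets \<Delta>" "Fs ! i \<in> facets \<Delta>"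
      unfolding set[symmetric] using j i(2) by simp_all
    have "w (Fs ! i) < w ?F" using less[of i j] i(2) j by simp
    from exchange[OF in_facets this] obtain x F'' where x: "x \<in> ?F" "F'' \<in> facets \<Delta>" "w F'' < w ?F"
      "?F \<inter> Fs ! i \<subseteq> ?F - {x}" "?F - {x} \<subseteq> F''"
      by blast
    obtain l where l: "l < length Fs" "F'' = Fs ! l"
      using x(2) unfolding set[symmetric] by (auto simp: in_set_conv_nth)
    then have "l < j" using less[of l j] x(3) j by simp
    then have "?F - {x} \<in> {\<sigma>. \<sigma> \<subseteq> Fs ! j \<and> (\<exists>i<j. \<sigma> \<subseteq> Fs ! i)}"
      using x(5) l(2) by blast
    moreover have "\<sigma> \<subseteq> ?F - {x}" using x(4) i by blast
    \<comment> \<open>Maximality of \<open>\<sigma>\<close> among the faces shared with predecessors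
      turns the inclusion into an equality.\<close>
    ultimately have "?F - {x} = \<sigma>" using \<sigma> unfolding facets_def by blast
    then show ?thesis using card_Suc_Diff1[OF card[OF in_facets(1)] x(1)] by simp
  qed
  then show ?thesis unfolding shellable_def using set dist by blast
qed

context
  fixes A :: "'a set" and B :: "'b set" and L :: nat
  assumes fin: "finite A" "finite B" and ne: "A \<noteq> {}" "B \<noteq> {}"
    and L: "L + 2 \<le> card A + card B"
begin

text \<open>If removing \<open>y\<close> empties one side of \<open>S\<close>, a vertex of
  \<open>S'\<close> on that side is a replacement and is automatically outside \<open>S\<close>.
  Otherwise any element of \<open>S' - S\<close> will do, and equal cardinalities provide
  one.\<close>

lemma exchange_complements:
  assumes S: "S \<subseteq> A <+> B" "S \<inter> Inl ` A \<noteq> {}" "S \<inter> Inr ` B \<noteq> {}"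
    and S': "S' \<subseteq> A <+> B" "S' \<inter> Inl ` A \<noteq> {}" "S' \<inter> Inr ` B \<noteq> {}"
    and "card S' = card S" and y: "y \<in> S - S'"
  obtains x where "x \<in> S' - S" "insert x (S - {y}) \<inter> Inl ` A \<noteq> {}" "insert x (S - {y}) \<inter> Inr ` B \<noteq> {}"
proof -
  consider "(S - {y}) \<inter> Inl ` A = {}" | "(S - {y}) \<inter> Inr ` B = {}"
    | "(S - {y}) \<inter> Inl ` A \<noteq> {}" "(S - {y}) \<inter> Inr ` B \<noteq> {}" by blast
  then show ?thesis
  proof cases
    case 1
    then have "y \<in> Inl ` A" using S(2) by blast
    obtain x where x: "x \<in> S'" "x \<in> Inl ` A" using S'(2) by blast
    have "x \<in> S' - S" using x 1 y by blast
    moreover have "insert x (S - {y}) \<inter> Inr ` B \<noteq> {}" using S(3) \<open>y \<in> Inl ` A\<close> by blast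
    ultimately show ?thesis using x that by blast
  next
    case 2
    then have "y \<in> Inr ` B" using S(3) by blast
    obtain x where x: "x \<in> S'" "x \<in> Inr ` B" using S'(3) by blast
    have "x \<in> S' - S" using x 2 y by blast
    moreover have "insert x (S - {y}) \<inter> Inl ` A \<noteq> {}" using S(2) \<open>y \<in> Inr ` B\<close> by blast
    ultimately show ?thesis using x that by blast
  next
    case 3
    have "finite S" "finite S'" using S(1) S'(1) fin by (meson finite_Plus finite_subset)+
    then have "S' - S \<noteq> {}"
      using card_seteq[of S S'] y assms(7) by fastforce
    then show ?thesis using 3 that by blast
  qed
qed

lemma shellable_join_skeleton: "shellable (join_skeleton A B L)"
proof -
  let ?V = "A <+> B" and ?\<F> = "facets (join_skeleton A B L)"
  obtain e :: "'a + 'b \<Rightarrow> nat" where e: "inj_on e ?V"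
    using finite_imp_inj_to_nat_seg[OF finite_Plus[OF fin]] by blast
  define w where "w = (\<lambda>F. set_encode (e ` (?V - F)))"
  have facet_iff: "F \<in> ?\<F> \<longleftrightarrow> F \<subseteq> ?V \<and> card F = L \<and> \<not> Inl ` A \<subseteq> F \<and> \<not> Inr ` B \<subseteq> F" for F
    unfolding facets_join_skeleton[OF fin ne L] by (auto simp: join_skeleton_def)
  have finV: "finite ?V" using fin by simp
  show ?thesis
  proof (rule shellableI)
    show "finite ?\<F>"
      unfolding facets_join_skeleton[OF fin ne L] using finite_join_skeleton[OF fin ne L] by simp
    show "finite F" if "F \<in> ?\<F>" for F using that finV facet_iff by (meson finite_subset)
    show "inj_on w ?\<F>"
    proof (rule inj_onI)
      fix F F' assume F: "F \<in> ?\<F>" "F' \<in> ?\<F>" "w F = w F'"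
      then have "e ` (?V - F) = e ` (?V - F')"
        unfolding w_def using set_encode_eq finV by simp
      then have "?V - F = ?V - F'" using inj_on_image_eq_iff[OF e] by (metis Diff_subset)
      then show "F = F'" using F facet_iff by blast
    qed
    fix F F' assume F: "F \<in> ?\<F>" and F': "F' \<in> ?\<F>" and less: "w F' < w F"
    define S where "S = ?V - F"
    define S' where "S' = ?V - F'"
    have S: "S \<subseteq> ?V" "S \<inter> Inl ` A \<noteq> {}" "S \<inter> Inr ` B \<noteq> {}"
      and S': "S' \<subseteq> ?V" "S' \<inter> Inl ` A \<noteq> {}" "S' \<inter> Inr ` B \<noteq> {}"
      using F F' unfolding facet_iff S_def S'_def by auto
    have finF: "finite F" "finite F'" using F F' finV facet_iff by (meson finite_subset)+
    have card: "card S' = card S"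
      using F F' finF unfolding facet_iff S_def S'_def by (simp add: card_Diff_subset)
    have finS: "finite S" "finite S'" using S(1) S'(1) finV by (meson finite_subset)+
    \<comment> \<open>The exchange gives no control over which \<open>x\<close> enters the
      complement. Choosing the leaving element above every element of \<open>S' - S\<close> makes
      the weight drop for each possible \<open>x\<close>.\<close>
    obtain z where z: "z \<in> e ` S - e ` S'" "\<And>x. x \<in> e ` S' - e ` S \<Longrightarrow> x < z"
      by (rule set_encode_less_max[of "e ` S'" "e ` S"]) (use less finS in \<open>auto simp: w_def S_def S'_def\<close>)
    obtain y where y: "y \<in> S - S'" "z = e y" using z(1) by blast
    obtain x where x: "x \<in> S' - S" "insert x (S - {y}) \<inter> Inl ` A \<noteq> {}" "insert x (S - {y}) \<inter> Inr ` B \<noteq> {}"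
      using exchange_complements[OF S S' card y(1)] .
    have "e x \<notin> e ` S"
      using x(1) S(1) S'(1) inj_on_image_mem_iff[OF e] by blast
    then have xy: "e x < e y" using z(2)[of "e x"] x(1) y(2) by blast
    define F'' where "F'' = insert y (F - {x})"
    have xF: "x \<in> F" "y \<notin> F" "x \<notin> F'" using x(1) S'(1) y(1) by (auto simp: S_def S'_def)
    have FV: "F \<subseteq> ?V" using F facet_iff by blast
    have yV: "y \<in> ?V" using y(1) S(1) by blast
    have compl: "?V - F'' = insert x (S - {y})"
      unfolding F''_def S_def using xF FV yV by blast
    have "card F'' = L"
      unfolding F''_def using xF finF F facet_iff card_Suc_Diff1[OF finF(1) xF(1)] by simp
    moreover have "F'' \<subseteq> ?V" using FV yV by (auto simp: F''_def)
    moreover have "\<not> Inl ` A \<subseteq> F''" "\<not> Inr ` B \<subseteq> F''" using x(2,3) compl by blast+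
    ultimately have "F'' \<in> ?\<F>" using facet_iff by blast
    moreover have "w F'' < w F"
    proof -
      have injS: "inj_on e (insert x S)" using e S(1) S'(1) x(1) by (meson inj_on_subset DiffD1 insert_subset subsetD)
      have sum: "set_encode (e ` T) = (\<Sum>v\<in>T. 2 ^ e v)" if "T \<subseteq> insert x S" for T
        unfolding set_encode_def using sum.reindex[OF inj_on_subset[OF injS that], of "\<lambda>i. 2 ^ i"] by (simp add: comp_def)
      have "w F'' = (\<Sum>v\<in>insert x (S - {y}). 2 ^ e v)"
        unfolding w_def compl by (rule sum) blast
      also have "\<dots> = 2 ^ e x + (\<Sum>v\<in>S - {y}. 2 ^ e v)"
        using finS x(1) by (subst sum.insert) auto
      also have "\<dots> < 2 ^ e y + (\<Sum>v\<in>S - {y}. 2 ^ e v)" using xy by simp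
      also have "\<dots> = (\<Sum>v\<in>S. 2 ^ e v)"
        using y(1) finS sum.remove[of S y "\<lambda>v. (2 :: nat) ^ e v"] by simp
      also have "\<dots> = w F" unfolding w_def S_def[symmetric] by (rule sum[symmetric]) blast
      finally show ?thesis .
    qed
    moreover have "F \<inter> F' \<subseteq> F - {x}" using xF by blast
    moreover have "F - {x} \<subseteq> F''" by (auto simp: F''_def)
    ultimately show "\<exists>x F''. x \<in> F \<and> F'' \<in> ?\<F> \<and> w F'' < w F \<and> F \<inter> F' \<subseteq> F - {x} \<and> F - {x} \<subseteq> F''"
      using xF(1) by blast
  qed
qed


section \<open>Homology of the cut complex\<close>

text \<open>Translates the degree \<open>p\<close> into the number of vertices
  \<open>l = p + 1\<close>. The second case yields both the vanishing above the top and the absence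
  of boundaries in the top degree.\<close>

lemma chains_join_skeleton:
  "chains (join_skeleton A B L) (int l - 1) = (if l \<le> L then avoiding A B l else {\<lambda>_. 0})"
proof -
  let ?\<Delta> = "join_skeleton A B L"
  have chains: "c \<in> chains ?\<Delta> (int l - 1) \<longleftrightarrow>
      alternating c \<and> (\<forall>xs. c xs \<noteq> 0 \<longrightarrow> set xs \<in> ?\<Delta> \<and> length xs = l)" for c
    unfolding chains_def alternating_iff_swap[symmetric] using alternating_distinct[of c] by auto
  show ?thesis
  proof (cases "l \<le> L")
    case True
    have "c \<in> chains ?\<Delta> (int l - 1) \<longleftrightarrow> c \<in> avoiding A B l" for c
    proof
      assume c: "c \<in> chains ?\<Delta> (int l - 1)"
      show "c \<in> avoiding A B l"
        unfolding avoiding_def[OF fin ne] alt_chains_def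
        using c[unfolded chains] by (auto simp: join_skeleton_def)
    next
      assume c: "c \<in> avoiding A B l"
      then have ac: "c \<in> alt_chains (A <+> B) l"
        and av: "\<And>zs. Inl ` A \<subseteq> set zs \<or> Inr ` B \<subseteq> set zs \<Longrightarrow> c zs = 0"
        by (auto simp: avoiding_def[OF fin ne])
      show "c \<in> chains ?\<Delta> (int l - 1)"
        unfolding chains
      proof (intro conjI allI impI)
        show "alternating c" by (rule alt_chainsD(1)[OF ac])
        fix xs assume nz: "c xs \<noteq> 0"
        note * = alt_chainsD(2-4)[OF ac nz]
        show "length xs = l" using *(2) .
        show "set xs \<in> ?\<Delta>"
          using * av[of xs] nz True by (auto simp: join_skeleton_def distinct_card)
      qed
    qed
    then show ?thesis using True by auto
  next
    case False
    have "c = (\<lambda>_. 0)" if "c \<in> chains ?\<Delta> (int l - 1)" for c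
    proof
      fix xs
      show "c xs = 0"
      proof (rule ccontr)
        assume "c xs \<noteq> 0"
        then have "set xs \<in> ?\<Delta>" "length xs = l" "distinct xs"
          using that[unfolded chains] alternating_distinct[of c xs] by auto
        then show False using False by (simp add: join_skeleton_def distinct_card)
      qed
    qed
    then show ?thesis using False alternating_zero by (auto simp: chains)
  qed
qed

text \<open>Degrees below -1 correspond to no number of vertices and escape the translation
  \<open>p = l - 1\<close>.\<close>

lemma chains_below:
  assumes "p < -1"
  shows "chains \<Delta> p = {\<lambda>_. 0}"
proof -
  have "c xs = 0" if "c \<in> chains \<Delta> p" for c xs
  proof (rule ccontr)
    assume "c xs \<noteq> 0"
    then have "int (length xs) = p + 1" using that by (auto simp: chains_def)
    then show False using assms by simp
  qed
  moreover have "(\<lambda>_. 0) \<in> chains \<Delta> p" by (auto simp: chains_def)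
  ultimately show ?thesis by auto
qed

lemma avoiding_alt_chains: "c \<in> avoiding A B l \<Longrightarrow> c \<in> alt_chains (A <+> B) l"
  by (simp add: avoiding_def[OF fin ne])

text \<open>\<open>boundary\<close> sums only over vertices of the complex, which may be fewer than
  \<open>A <+> B\<close>: a clique with one vertex is not a face. Chains vanish on lists through the
  missing vertices.\<close>

lemma boundary_join_skeleton:
  assumes "c \<in> avoiding A B l" "l \<le> L"
  shows "boundary (join_skeleton A B L) c = bdry (A <+> B) c"
proof
  fix xs
  have "c \<in> chains (join_skeleton A B L) (int l - 1)"
    using assms by (simp add: chains_join_skeleton)
  then have "c (v # xs) = 0" if "v \<notin> \<Union> (join_skeleton A B L)" for v
    using that by (fastforce simp: chains_def)
  then show "boundary (join_skeleton A B L) c xs = bdry (A <+> B) c xs"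
    unfolding boundary_def bdry_def using fin
    by (intro sum.mono_neutral_left) (auto simp: join_skeleton_def)
qed

lemma cycles_join_skeleton:
  assumes "l \<le> L"
  shows "cycles (join_skeleton A B L) (int l - 1) = avoiding A B l \<inter> alt_cycles (A <+> B) l"
  unfolding cycles_def chains_join_skeleton using assms
  by (auto simp: boundary_join_skeleton alt_cycles_def avoiding_alt_chains zero_fun_def)

lemma avoiding_bdry:
  assumes "c \<in> avoiding A B (Suc l)"
  shows "bdry (A <+> B) c \<in> avoiding A B l \<inter> alt_cycles (A <+> B) l"
proof -
  have "bdry (A <+> B) c zs = 0" if "Inl ` A \<subseteq> set zs \<or> Inr ` B \<subseteq> set zs" for zs
    unfolding bdry_def
  proof (rule sum.neutral, rule ballI)
    fix v
    have "Inl ` A \<subseteq> set (v # zs) \<or> Inr ` B \<subseteq> set (v # zs)" using that by auto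
    then show "c (v # zs) = 0" using assms unfolding avoiding_def[OF fin ne] by blast
  qed
  moreover have "bdry (A <+> B) c \<in> alt_cycles (A <+> B) l"
    using avoiding_alt_chains[OF assms] by (rule bdry_in_alt_cycles)
  ultimately show ?thesis by (auto simp: avoiding_def[OF fin ne] alt_cycles_def)
qed

lemma boundaries_eq_cycles:
  assumes "p \<noteq> int L - 1"
  shows "boundaries (join_skeleton A B L) p = cycles (join_skeleton A B L) p"
proof -
  let ?\<Delta> = "join_skeleton A B L" and ?V = "A <+> B"
  have zero: "boundary ?\<Delta> (\<lambda>_. 0) = (\<lambda>_. 0)" by (simp add: boundary_def fun_eq_iff)
  consider "p < -1" | l where "p = int l - 1" "l < L" | l where "p = int l - 1" "L < l"
  proof -
    assume *: "p < -1 \<Longrightarrow> thesis" "\<And>l. p = int l - 1 \<Longrightarrow> l < L \<Longrightarrow> thesis"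
      "\<And>l. p = int l - 1 \<Longrightarrow> L < l \<Longrightarrow> thesis"
    show thesis
    proof (cases "p < -1")
      case False
      then have "p = int (nat (p + 1)) - 1" by simp
      moreover have "nat (p + 1) \<noteq> L" using assms False by auto
      ultimately show thesis using *(2,3) by (metis linorder_neqE_nat)
    qed (rule *(1))
  qed
  then show ?thesis
  proof cases
    case 1
    have "boundary ?\<Delta> c = (\<lambda>_. 0)" if "c \<in> chains ?\<Delta> (p + 1)" for c
    proof
      fix xs
      have "c (v # xs) = 0" for v
      proof (rule ccontr)
        assume "c (v # xs) \<noteq> 0"
        then have "int (length (v # xs)) = p + 1 + 1" using that by (auto simp: chains_def)
        then show False using 1 by simp
      qed
      then show "boundary ?\<Delta> c xs = 0" by (simp add: boundary_def)
    qed
    moreover have "(\<lambda>_. 0) \<in> chains ?\<Delta> (p + 1)" by (auto simp: chains_def)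
    ultimately have "boundaries ?\<Delta> p = {\<lambda>_. 0}" unfolding boundaries_def using zero by force
    then show ?thesis using chains_below[OF 1, of ?\<Delta>] zero by (auto simp: cycles_def)
  next
    case (2 l)
    have p1: "p + 1 = int (Suc l) - 1" using 2 by simp
    have bd: "boundaries ?\<Delta> p = bdry ?V ` avoiding A B (Suc l)"
      unfolding boundaries_def p1 chains_join_skeleton using 2(2)
      by (auto simp: boundary_join_skeleton intro!: image_cong)
    have cyc: "cycles ?\<Delta> p = avoiding A B l \<inter> alt_cycles ?V l"
      unfolding 2(1) using 2(2) by (intro cycles_join_skeleton) simp
    show ?thesis
    proof
      show "boundaries ?\<Delta> p \<subseteq> cycles ?\<Delta> p" unfolding bd cyc using avoiding_bdry by blast
      show "cycles ?\<Delta> p \<subseteq> boundaries ?\<Delta> p"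
        unfolding bd cyc
      proof
        fix z assume z: "z \<in> avoiding A B l \<inter> alt_cycles ?V l"
        have V: "finite ?V" "?V \<noteq> {}" using fin ne by auto
        \<comment> \<open>A filling in the full simplex, which need not lie in the complex. Its
          correction terms are cycles, so the corrected chain still fills \<open>z\<close>.\<close>
        define y where "y = wedge (barycentre ?V) z"
        have bdy: "bdry ?V y = z"
          unfolding y_def using z bdry_wedge_cycle[OF sum_barycentre[OF V]] by (simp add: alt_cycles_def)
        have "y \<in> alt_chains ?V (Suc l)"
          unfolding y_def using z by (intro wedge_alt_chains[OF avoiding_alt_chains barycentre_support]) auto
        \<comment> \<open>The filling has one vertex more than \<open>z\<close>;
          \<open>l < L\<close> keeps it in the range of \<open>decompose_chain\<close>.\<close>
        moreover have "Suc l + 2 \<le> card A + card B" using 2(2) L by simp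
        moreover have "bdry ?V y zs = 0" if "Inl ` A \<subseteq> set zs \<or> Inr ` B \<subseteq> set zs" for zs
          unfolding bdy using z that by (auto simp: avoiding_def[OF fin ne])
        ultimately obtain c F G where c: "c \<in> avoiding A B (Suc l)"
          "F \<in> right_part A B (Suc l)" "G \<in> left_part A B (Suc l)" "y = c + cross A B F + cross A B G"
          using decompose_chain[OF fin ne] by blast
        have "bdry ?V (cross A B F) = 0" "bdry ?V (cross A B G) = 0"
          using cross_right_part(1)[OF fin ne c(2)] cross_left_part(1)[OF fin ne c(3)] 2(2) L
          by (simp_all add: alt_cycles_def)
        then have "bdry ?V c = z" using bdy c(4) by (simp add: bdry_add)
        then show "z \<in> bdry ?V ` avoiding A B (Suc l)" using c(1) by blast
      qed
    qed
  next
    case (3 l)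
    have p1: "p + 1 = int (Suc l) - 1" using 3 by simp
    have "chains ?\<Delta> p = {\<lambda>_. 0}" "chains ?\<Delta> (p + 1) = {\<lambda>_. 0}"
      unfolding p1 unfolding 3(1) chains_join_skeleton using 3(2) by simp_all
    then show ?thesis using zero by (auto simp: boundaries_def cycles_def)
  qed
qed

lemma boundaries_top: "boundaries (join_skeleton A B L) (int L - 1) = {\<lambda>_. 0}"
proof -
  have "int L - 1 + 1 = int (Suc L) - 1" by simp
  then have "chains (join_skeleton A B L) (int L - 1 + 1) = {\<lambda>_. 0}"
    using chains_join_skeleton[of "Suc L"] by simp
  then show ?thesis by (simp add: boundaries_def boundary_def)
qed

end


section \<open>Representations\<close>

lemma fun_rep_simps [simp]:
  "carrier (fun_rep V \<rho>) = V" "\<zero>\<^bsub>fun_rep V \<rho>\<^esub> = (\<lambda>x. 0)"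
  "f \<oplus>\<^bsub>fun_rep V \<rho>\<^esub> g = (\<lambda>x. f x + g x)" "c \<odot>\<^bsub>fun_rep V \<rho>\<^esub> f = (\<lambda>x. c * f x)"
  "action (fun_rep V \<rho>) = \<rho>"
  by (simp_all add: fun_rep_def module.defs fun_module_def)

lemma restrict_rep_simps [simp]:
  "carrier (restrict_rep \<iota> M) = carrier M" "\<zero>\<^bsub>restrict_rep \<iota> M\<^esub> = \<zero>\<^bsub>M\<^esub>"
  "f \<oplus>\<^bsub>restrict_rep \<iota> M\<^esub> g = f \<oplus>\<^bsub>M\<^esub> g" "c \<odot>\<^bsub>restrict_rep \<iota> M\<^esub> f = c \<odot>\<^bsub>M\<^esub> f"
  "action (restrict_rep \<iota> M) h = action M (\<iota> h)"
  by (simp_all add: restrict_rep_def module.defs)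

lemma dsum_rep_simps [simp]:
  "carrier (dsum_rep M N) = carrier M \<times> carrier N"
  "(u, v) \<oplus>\<^bsub>dsum_rep M N\<^esub> (u', v') = (u \<oplus>\<^bsub>M\<^esub> u', v \<oplus>\<^bsub>N\<^esub> v')"
  "c \<odot>\<^bsub>dsum_rep M N\<^esub> (u, v) = (c \<odot>\<^bsub>M\<^esub> u, c \<odot>\<^bsub>N\<^esub> v)"
  "action (dsum_rep M N) g (u, v) = (action M g u, action N g v)"
  by (simp_all add: dsum_rep_def)

lemma carrier_quotient_fun_rep:
  "carrier (quotient_rep (fun_rep V \<rho>) U) = (\<lambda>a. {(\<lambda>x. u x + a x) | u. u \<in> U}) ` V"
  by (auto simp: quotient_rep_def A_RCOSETS_def' a_r_coset_def')

lemma zero_quotient_rep: "\<zero>\<^bsub>quotient_rep M U\<^esub> = U"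
  by (simp add: quotient_rep_def)

lemma quotient_rep_self:
  assumes "rat_fun.subspace V"
  shows "carrier (quotient_rep (fun_rep V \<rho>) V) = {V}"
proof -
  have "{(\<lambda>x. u x + a x) | u. u \<in> V} = V" if a: "a \<in> V" for a
  proof
    show "{(\<lambda>x. u x + a x) | u. u \<in> V} \<subseteq> V"
      using rat_fun.subspace_add[OF assms _ a] by (auto simp: plus_fun_def)
    show "V \<subseteq> {(\<lambda>x. u x + a x) | u. u \<in> V}"
    proof
      fix v assume "v \<in> V"
      then have "v - a \<in> V" using rat_fun.subspace_diff[OF assms _ a] by blast
      moreover have "v = (\<lambda>x. (v - a) x + a x)" by auto
      ultimately show "v \<in> {(\<lambda>x. u x + a x) | u. u \<in> V}" by blast
    qed
  qed
  moreover have "V \<noteq> {}" using rat_fun.subspace_0[OF assms] by blast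
  ultimately show ?thesis unfolding carrier_quotient_fun_rep by auto
qed

text \<open>The shape of the top homology: nothing bounds there, so classes are singletons and the
  operations act on representatives.\<close>

lemma quotient_rep_zero:
  "carrier (quotient_rep (fun_rep V \<rho>) {\<lambda>x. 0}) = (\<lambda>a. {a}) ` V"
  "{a} \<oplus>\<^bsub>quotient_rep (fun_rep V \<rho>) {\<lambda>x. 0}\<^esub> {b} = {\<lambda>x. a x + b x}"
  "c \<odot>\<^bsub>quotient_rep (fun_rep V \<rho>) {\<lambda>x. 0}\<^esub> {a} = {\<lambda>x. c * a x}"
  "action (quotient_rep (fun_rep V \<rho>) {\<lambda>x. 0}) g {a} = {\<rho> g a}"
  unfolding carrier_quotient_fun_rep
  by (auto simp: quotient_rep_def set_add_def' a_r_coset_def')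

lemma has_dim_iso:
  assumes "has_dim M d" "lin_iso h M N"
    and "\<And>u v. u \<in> carrier M \<Longrightarrow> v \<in> carrier M \<Longrightarrow> u \<oplus>\<^bsub>M\<^esub> v \<in> carrier M"
  shows "has_dim N d"
proof -
  obtain f where f: "lin_iso f (fun_module {a :: nat \<Rightarrow> rat. \<forall>i\<ge>d. a i = 0}) M"
    using assms(1) by (auto simp: has_dim_def)
  let ?A = "{a :: nat \<Rightarrow> rat. \<forall>i\<ge>d. a i = 0}"
  have bij: "bij_betw f ?A (carrier M)" using f by (simp add: lin_iso_def)
  then have car: "f a \<in> carrier M" if "a \<in> ?A" for a using that by (rule bij_betw_apply)
  have "lin_iso (h \<circ> f) (fun_module ?A) N"
    unfolding lin_iso_def
  proof (intro conjI ballI allI)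
    show "bij_betw (h \<circ> f) (carrier (fun_module ?A)) (carrier N)"
      using assms(2) by (auto simp: lin_iso_def intro: bij_betw_trans[OF bij])
    show "(h \<circ> f) (u \<oplus>\<^bsub>fun_module ?A\<^esub> v) = (h \<circ> f) u \<oplus>\<^bsub>N\<^esub> (h \<circ> f) v"
      if "u \<in> carrier (fun_module ?A)" "v \<in> carrier (fun_module ?A)" for u v
    proof -
      have "f (u \<oplus>\<^bsub>fun_module ?A\<^esub> v) = f u \<oplus>\<^bsub>M\<^esub> f v"
        using f that unfolding lin_iso_def by blast
      then show ?thesis using assms(2) car that by (simp add: lin_iso_def)
    qed
    show "(h \<circ> f) (c \<odot>\<^bsub>fun_module ?A\<^esub> v) = c \<odot>\<^bsub>N\<^esub> (h \<circ> f) v"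
      if "v \<in> carrier (fun_module ?A)" for c v
    proof -
      have "f (c \<odot>\<^bsub>fun_module ?A\<^esub> v) = c \<odot>\<^bsub>M\<^esub> f v"
        using f that unfolding lin_iso_def by blast
      then show ?thesis using assms(2) car that by (simp add: lin_iso_def)
    qed
  qed
  then show ?thesis unfolding has_dim_def by blast
qed

text \<open>An isomorphism is obtained from a cospan \<open>M \<rightarrow> P \<leftarrow> N\<close> of bijections. Injectivity of the
  right leg is assumed on a larger space \<open>W\<close>, so that invariance of \<open>carrier N\<close> under the
  operations need not be known beforehand.\<close>

lemma rep_iso_cospan:
  fixes \<Psi> :: "'v \<Rightarrow> 'x \<Rightarrow> rat" and \<Theta> :: "'w \<Rightarrow> 'x \<Rightarrow> rat"
  assumes \<Psi>: "bij_betw \<Psi> (carrier M) P" and \<Theta>: "\<Theta> ` carrier N = P" "carrier N \<subseteq> W" "inj_on \<Theta> W"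
    and P: "rat_fun.subspace P" "\<And>g z. g \<in> carrier G \<Longrightarrow> z \<in> P \<Longrightarrow> \<rho> g z \<in> P"
    and add: "\<And>u v. u \<in> carrier M \<Longrightarrow> v \<in> carrier M \<Longrightarrow> \<Psi> (u \<oplus>\<^bsub>M\<^esub> v) = \<Psi> u + \<Psi> v"
      "\<And>u v. u \<in> carrier N \<Longrightarrow> v \<in> carrier N \<Longrightarrow> u \<oplus>\<^bsub>N\<^esub> v \<in> W \<and> \<Theta> (u \<oplus>\<^bsub>N\<^esub> v) = \<Theta> u + \<Theta> v"
    and smult: "\<And>c u. u \<in> carrier M \<Longrightarrow> \<Psi> (c \<odot>\<^bsub>M\<^esub> u) = scale_fun c (\<Psi> u)"
      "\<And>c u. u \<in> carrier N \<Longrightarrow> c \<odot>\<^bsub>N\<^esub> u \<in> W \<and> \<Theta> (c \<odot>\<^bsub>N\<^esub> u) = scale_fun c (\<Theta> u)"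
    and action: "\<And>g u. g \<in> carrier G \<Longrightarrow> u \<in> carrier M \<Longrightarrow> \<Psi> (action M g u) = \<rho> g (\<Psi> u)"
      "\<And>g u. g \<in> carrier G \<Longrightarrow> u \<in> carrier N \<Longrightarrow> action N g u \<in> W \<and> \<Theta> (action N g u) = \<rho> g (\<Theta> u)"
  shows "rep_iso G M N"
proof -
  define f where "f = inv_into (carrier N) \<Theta> \<circ> \<Psi>"
  have \<Theta>_bij: "bij_betw \<Theta> (carrier N) P"
    using \<Theta> by (auto simp: bij_betw_def intro: inj_on_subset)
  have bij: "bij_betw f (carrier M) (carrier N)"
    unfolding f_def by (rule bij_betw_trans[OF \<Psi> bij_betw_inv_into[OF \<Theta>_bij]])
  have \<Psi>P: "\<Psi> v \<in> P" if "v \<in> carrier M" for v using \<Psi> that by (rule bij_betw_apply)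
  have fN: "f v \<in> carrier N" if "v \<in> carrier M" for v using bij that by (rule bij_betw_apply)
  have \<Theta>f: "\<Theta> (f v) = \<Psi> v" if "\<Psi> v \<in> P" for v
    unfolding f_def comp_def by (rule f_inv_into_f) (simp add: \<Theta>(1) that)
  have f_eq: "f v = w" if "\<Psi> v \<in> P" "w \<in> W" "\<Theta> w = \<Psi> v" for v w
  proof (rule inj_onD[OF \<Theta>(3)])
    show "\<Theta> (f v) = \<Theta> w" using \<Theta>f[OF that(1)] that(3) by simp
    have "f v \<in> carrier N"
      unfolding f_def comp_def by (rule inv_into_into) (simp add: \<Theta>(1) that(1))
    then show "f v \<in> W" using \<Theta>(2) by blast
  qed (rule that(2))
  have "f (u \<oplus>\<^bsub>M\<^esub> v) = f u \<oplus>\<^bsub>N\<^esub> f v" if u: "u \<in> carrier M" and v: "v \<in> carrier M" for u v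
  proof (rule f_eq)
    show "\<Psi> (u \<oplus>\<^bsub>M\<^esub> v) \<in> P"
      unfolding add(1)[OF u v] by (rule rat_fun.subspace_add[OF P(1) \<Psi>P[OF u] \<Psi>P[OF v]])
    show "f u \<oplus>\<^bsub>N\<^esub> f v \<in> W" using add(2)[OF fN[OF u] fN[OF v]] ..
    show "\<Theta> (f u \<oplus>\<^bsub>N\<^esub> f v) = \<Psi> (u \<oplus>\<^bsub>M\<^esub> v)"
      using add(2)[OF fN[OF u] fN[OF v]] by (simp only: \<Theta>f \<Psi>P u v add(1))
  qed
  moreover have "f (c \<odot>\<^bsub>M\<^esub> u) = c \<odot>\<^bsub>N\<^esub> f u" if u: "u \<in> carrier M" for c u
  proof (rule f_eq)
    show "\<Psi> (c \<odot>\<^bsub>M\<^esub> u) \<in> P"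
      unfolding smult(1)[OF u] by (rule rat_fun.subspace_scale[OF P(1) \<Psi>P[OF u]])
    show "c \<odot>\<^bsub>N\<^esub> f u \<in> W" using smult(2)[OF fN[OF u]] ..
    show "\<Theta> (c \<odot>\<^bsub>N\<^esub> f u) = \<Psi> (c \<odot>\<^bsub>M\<^esub> u)"
      using smult(2)[OF fN[OF u]] by (simp only: \<Theta>f \<Psi>P u smult(1))
  qed
  moreover have "f (action M g u) = action N g (f u)" if g: "g \<in> carrier G" and u: "u \<in> carrier M" for g u
  proof (rule f_eq)
    show "\<Psi> (action M g u) \<in> P" unfolding action(1)[OF g u] by (rule P(2)[OF g \<Psi>P[OF u]])
    show "action N g (f u) \<in> W" using action(2)[OF g fN[OF u]] ..
    show "\<Theta> (action N g (f u)) = \<Psi> (action M g u)"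
      using action(2)[OF g fN[OF u]] by (simp only: \<Theta>f \<Psi>P u action(1)[OF g u])
  qed
  ultimately show ?thesis
    unfolding rep_iso_def lin_iso_def using bij by (intro exI[of _ f]) simp
qed

text \<open>Injectivity of \<open>h\<close> beyond \<open>A\<close> matters: a list that leaves
  \<open>A\<close> must not be carried into \<open>B\<close>, where \<open>c\<close> can be
  nonzero.\<close>

lemma alt_cycles_relabel:
  assumes h: "inj h" "bij_betw h A B"
  shows "bij_betw (\<lambda>c xs. c (map h xs)) (alt_cycles B L) (alt_cycles A L)"
proof (rule bij_betw_imageI)
  have img: "h ` A = B" using h(2) by (simp add: bij_betw_def)
  have in_A: "set xs \<subseteq> A" if "set (map h xs) \<subseteq> B" for xs
    using that inj_image_subset_iff[OF h(1)] unfolding img[symmetric] by simp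
  define h' where "h' = inv_into A h"
  have h': "bij_betw h' B A" unfolding h'_def by (rule bij_betw_inv_into[OF h(2)])
  have hh': "map h (map h' ys) = ys" if "set ys \<subseteq> B" for ys
    unfolding map_map by (rule map_idI) (use that img in \<open>auto simp: h'_def intro!: f_inv_into_f\<close>)
  have h'h: "map h' (map h xs) = xs" if "set xs \<subseteq> A" for xs
    unfolding map_map
    by (rule map_idI) (use that h(2) in \<open>auto simp: h'_def bij_betw_def intro!: inv_into_f_f\<close>)
  show "inj_on (\<lambda>c xs. c (map h xs)) (alt_cycles B L)"
  proof (rule inj_onI, rule ext)
    fix c c' ys assume c: "c \<in> alt_cycles B L" "c' \<in> alt_cycles B L"
      and eq: "(\<lambda>xs. c (map h xs)) = (\<lambda>xs. c' (map h xs))"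
    show "c ys = c' ys"
    proof (cases "set ys \<subseteq> B")
      case True
      then show ?thesis using fun_cong[OF eq, of "map h' ys"] hh'[OF True] by (simp only:)
    next
      case False
      then have "c ys = 0" "c' ys = 0"
        using alt_chainsD(2)[of c B L ys] alt_chainsD(2)[of c' B L ys] c by (auto simp: alt_cycles_def)
      then show ?thesis by simp
    qed
  qed
  show "(\<lambda>c xs. c (map h xs)) ` alt_cycles B L = alt_cycles A L"
  proof
    show "(\<lambda>c xs. c (map h xs)) ` alt_cycles B L \<subseteq> alt_cycles A L"
    proof clarify
      fix c assume c: "c \<in> alt_cycles B L"
      then have cc: "c \<in> alt_chains B L" by (simp add: alt_cycles_def)
      have "(\<lambda>xs. c (map h xs)) \<in> alt_chains A L"
      proof (rule alt_chainsI)
        show "alternating (\<lambda>xs. c (map h xs))" by (rule alternating_relabel[OF alt_chainsD(1)[OF cc]])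
        fix xs assume nz: "c (map h xs) \<noteq> 0"
        from in_A[OF alt_chainsD(2)[OF cc nz]] alt_chainsD(3)[OF cc nz]
        show "set xs \<subseteq> A \<and> length xs = L" by simp
      qed
      moreover have "bdry A (\<lambda>xs. c (map h xs)) = 0"
        using c by (intro ext) (simp add: bdry_relabel[OF h(2)] alt_cycles_def)
      ultimately show "(\<lambda>xs. c (map h xs)) \<in> alt_cycles A L" by (simp add: alt_cycles_def)
    qed
    show "alt_cycles A L \<subseteq> (\<lambda>c xs. c (map h xs)) ` alt_cycles B L"
    proof
      fix d assume d: "d \<in> alt_cycles A L"
      then have dc: "d \<in> alt_chains A L" and bd: "bdry A d = 0" by (auto simp: alt_cycles_def)
      \<comment> \<open>\<open>h'\<close> inverts \<open>h\<close> only on \<open>B\<close>, so the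
        transported cycle is cut off outside \<open>B\<close>.\<close>
      define c where "c = (\<lambda>ys. if set ys \<subseteq> B then d (map h' ys) else 0)"
      have "c \<in> alt_chains B L"
      proof (rule alt_chainsI)
        show "alternating c"
        proof (rule alternatingI)
          fix xs a b ys
          show "c (xs @ a # b # ys) = - c (xs @ b # a # ys)"
            using alternatingD[OF alt_chainsD(1)[OF dc], of "map h' xs" "h' a" "h' b" "map h' ys"]
            by (auto simp: c_def)
        qed
        fix ys assume nz: "c ys \<noteq> 0"
        then have "set ys \<subseteq> B" "d (map h' ys) \<noteq> 0" by (auto simp: c_def split: if_splits)
        then show "set ys \<subseteq> B \<and> length ys = L" using alt_chainsD(3)[OF dc] by fastforce
      qed
      moreover have "bdry B c = 0"
      proof
        fix ys
        show "bdry B c ys = 0 ys"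
        proof (cases "set ys \<subseteq> B")
          case True
          then have "bdry B c ys = bdry B (\<lambda>xs. d (map h' xs)) ys"
            unfolding bdry_def c_def by (intro sum.cong) auto
          also have "\<dots> = 0" unfolding bdry_relabel[OF h'] bd by simp
          finally show ?thesis by simp
        qed (simp add: bdry_def c_def)
      qed
      moreover have "d = (\<lambda>xs. c (map h xs))"
      proof
        fix xs
        show "d xs = c (map h xs)"
        proof (cases "set xs \<subseteq> A")
          case True
          then have "set (map h xs) \<subseteq> B" using img by auto
          then show ?thesis unfolding c_def h'h[OF True] by simp
        next
          case False
          then have "\<not> set (map h xs) \<subseteq> B" using in_A by blast
          moreover have "d xs = 0" using alt_chainsD(2)[OF dc, of xs] False by auto
          ultimately show ?thesis unfolding c_def by simp
        qed
      qed
      ultimately show "d \<in> (\<lambda>c xs. c (map h xs)) ` alt_cycles B L"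
        by (auto simp: alt_cycles_def)
    qed
  qed
qed

lemma subspace_cycles: "rat_fun.subspace (cycles \<Delta> p)"
proof (rule rat_fun.subspaceI)
  have chains: "c \<in> chains \<Delta> p \<longleftrightarrow>
      alternating c \<and> (\<forall>xs. c xs \<noteq> 0 \<longrightarrow> distinct xs \<and> set xs \<in> \<Delta> \<and> int (length xs) = p + 1)" for c
    unfolding chains_def alternating_iff_swap[symmetric] by auto
  show "0 \<in> cycles \<Delta> p"
    using alternating_zero by (auto simp: cycles_def chains boundary_def zero_fun_def)
  show "c + c' \<in> cycles \<Delta> p" if "c \<in> cycles \<Delta> p" "c' \<in> cycles \<Delta> p" for c c'
  proof -
    have "c + c' \<in> chains \<Delta> p"
      unfolding chains
    proof (intro conjI[OF _ allI] impI)
      show "alternating (c + c')"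
        using that alternating_add[of c c'] by (simp add: cycles_def chains plus_fun_def)
      fix xs assume "(c + c') xs \<noteq> 0"
      then have "c xs \<noteq> 0 \<or> c' xs \<noteq> 0" by auto
      then show "distinct xs \<and> set xs \<in> \<Delta> \<and> int (length xs) = p + 1"
        using that by (auto simp: cycles_def chains)
    qed
    moreover have "boundary \<Delta> (c + c') xs = boundary \<Delta> c xs + boundary \<Delta> c' xs" for xs
      by (simp add: boundary_def sum.distrib)
    ultimately show ?thesis using that by (auto simp: cycles_def fun_eq_iff)
  qed
  show "scale_fun r c \<in> cycles \<Delta> p" if "c \<in> cycles \<Delta> p" for r c
  proof -
    have "scale_fun r c \<in> chains \<Delta> p"
      using that alternating_scale[of c r] by (auto simp: cycles_def chains)
    moreover have "boundary \<Delta> (scale_fun r c) xs = r * boundary \<Delta> c xs" for xs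
      by (simp add: boundary_def sum_distrib_left)
    ultimately show ?thesis using that by (auto simp: cycles_def fun_eq_iff)
  qed
qed


section \<open>Hook and sign representations\<close>

lemma sign_rep_eq_hook_rep: "1 \<le> r \<Longrightarrow> sign_rep r = hook_rep 1 r"
  by (cases r) (simp_all add: sign_rep_def hook_rep_def)

definition hook_cycles :: "nat \<Rightarrow> nat \<Rightarrow> (nat list \<Rightarrow> rat) set" where
  "hook_cycles k r = (if k \<le> r then alt_cycles {1..r} (r - k) else {0})"

definition eval_tabloids :: "nat \<Rightarrow> (nat set list \<Rightarrow> rat) \<Rightarrow> nat list \<Rightarrow> rat" where
  "eval_tabloids r f = (\<lambda>xs. f (hook_tabloid r xs))"

definition eval_tabloid_pairs ::
    "nat \<Rightarrow> nat \<Rightarrow> (nat set list \<times> nat set list \<Rightarrow> rat) \<Rightarrow> nat list \<times> nat list \<Rightarrow> rat" where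
  "eval_tabloid_pairs m n F = (\<lambda>(xs, ys). F (hook_tabloid m xs, hook_tabloid n ys))"

lemma hook_rep_hook:
  "k \<le> r \<Longrightarrow> hook_rep k r = fun_rep (rat_fun.span (polytabloid (hook k r) ` tableaux (hook k r)))
     (\<lambda>\<pi> f X. f (map (image (inv_into UNIV \<pi>)) X))"
  by (simp add: hook_rep_def specht_def hook_def)

lemma eval_hook_rep:
  assumes "1 \<le> k"
  shows "eval_tabloids r ` carrier (hook_rep k r) = hook_cycles k r"
proof (cases "k \<le> r")
  case True
  then show ?thesis
    using specht_hook_image[OF assms True]
    by (simp add: hook_rep_hook hook_cycles_def eval_tabloids_def[abs_def])
qed (simp add: hook_rep_def hook_cycles_def eval_tabloids_def zero_fun_def)

lemma hook_rep_support:
  assumes "1 \<le> k" "f \<in> carrier (hook_rep k r)" "X \<notin> range (hook_tabloid r)"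
  shows "f X = 0"
proof (cases "k \<le> r")
  case True
  then show ?thesis using specht_hook_support[OF assms(1) True _ assms(3)] assms(2) by (simp add: hook_rep_hook)
qed (use assms(2) in \<open>simp add: hook_rep_def\<close>)

lemma subspace_hook_cycles: "rat_fun.subspace (hook_cycles k r)"
  by (simp add: hook_cycles_def subspace_alt_cycles rat_fun.subspace_single_0)

section \<open>Tensor products of hook representations as functions on pairs of lists\<close>

lemma carrier_tensor_rep:
  "carrier (tensor_rep M N) = rat_fun.span {outer u v | u v. u \<in> carrier M \<and> v \<in> carrier N}"
  by (simp add: tensor_rep_def outer_def)

lemma linear_eval_tabloid_pairs: "Vector_Spaces.linear scale_fun scale_fun (eval_tabloid_pairs m n)"
  by (rule linear_funI) (auto simp: eval_tabloid_pairs_def)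

context
  fixes j k m n :: nat
  assumes jk: "1 \<le> j" "1 \<le> k"
begin

lemma tensor_hook_support:
  assumes "F \<in> carrier (tensor_rep (hook_rep j m) (hook_rep k n))"
    and "X \<notin> range (hook_tabloid m) \<or> Y \<notin> range (hook_tabloid n)"
  shows "F (X, Y) = 0"
proof -
  have "carrier (tensor_rep (hook_rep j m) (hook_rep k n)) \<subseteq> {F. F (X, Y) = 0}"
    unfolding carrier_tensor_rep
  proof (rule rat_fun.span_minimal)
    show "{outer u v | u v. u \<in> carrier (hook_rep j m) \<and> v \<in> carrier (hook_rep k n)} \<subseteq> {F. F (X, Y) = 0}"
      using assms(2) hook_rep_support[OF jk(1)] hook_rep_support[OF jk(2)] by (auto simp: outer_def)
    show "rat_fun.subspace {F :: nat set list \<times> nat set list \<Rightarrow> rat. F (X, Y) = 0}"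
      by (rule rat_fun.subspaceI) auto
  qed
  then show ?thesis using assms(1) by blast
qed

lemma eval_tensor_hook_image:
  "eval_tabloid_pairs m n ` carrier (tensor_rep (hook_rep j m) (hook_rep k n)) =
     rat_fun.span {outer u v | u v. u \<in> hook_cycles j m \<and> v \<in> hook_cycles k n}"
proof -
  let ?S = "{outer u v | u v. u \<in> carrier (hook_rep j m) \<and> v \<in> carrier (hook_rep k n)}"
  have eval: "eval_tabloid_pairs m n (outer u v) = outer (eval_tabloids m u) (eval_tabloids n v)" for u v
    by (auto simp: eval_tabloid_pairs_def eval_tabloids_def outer_def)
  have "eval_tabloid_pairs m n ` ?S = {outer u v | u v.
      u \<in> eval_tabloids m ` carrier (hook_rep j m) \<and> v \<in> eval_tabloids n ` carrier (hook_rep k n)}"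
  proof (intro equalityI subsetI)
    fix F assume "F \<in> eval_tabloid_pairs m n ` ?S"
    then show "F \<in> {outer u v | u v. u \<in> eval_tabloids m ` carrier (hook_rep j m) \<and>
      v \<in> eval_tabloids n ` carrier (hook_rep k n)}" using eval by auto
  next
    fix F assume "F \<in> {outer u v | u v. u \<in> eval_tabloids m ` carrier (hook_rep j m) \<and>
      v \<in> eval_tabloids n ` carrier (hook_rep k n)}"
    then obtain u v where "F = eval_tabloid_pairs m n (outer u v)" "outer u v \<in> ?S"
      unfolding eval by blast
    then show "F \<in> eval_tabloid_pairs m n ` ?S" by (rule image_eqI)
  qed
  then show ?thesis
    unfolding carrier_tensor_rep rat_fun_pair.linear_span_image[OF linear_eval_tabloid_pairs, symmetric]
    by (simp only: eval_hook_rep[OF jk(1)] eval_hook_rep[OF jk(2)])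
qed

lemma eval_tensor_hook_inj:
  "inj_on (eval_tabloid_pairs m n) (carrier (tensor_rep (hook_rep j m) (hook_rep k n)))"
proof (rule inj_onI, rule ext, clarify)
  fix F F' X Y
  assume F: "F \<in> carrier (tensor_rep (hook_rep j m) (hook_rep k n))"
    "F' \<in> carrier (tensor_rep (hook_rep j m) (hook_rep k n))"
    and eq: "eval_tabloid_pairs m n F = eval_tabloid_pairs m n F'"
  show "F (X, Y) = F' (X, Y)"
  proof (cases "X \<in> range (hook_tabloid m) \<and> Y \<in> range (hook_tabloid n)")
    case True
    then obtain xs ys where XY: "X = hook_tabloid m xs" "Y = hook_tabloid n ys" by blast
    show ?thesis using fun_cong[OF eq, of "(xs, ys)"] by (simp add: eval_tabloid_pairs_def XY)
  next
    case False
    then show ?thesis using tensor_hook_support[OF F(1), of X Y] tensor_hook_support[OF F(2), of X Y] by auto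
  qed
qed

lemma eval_tensor_hook_action:
  assumes F: "F \<in> carrier (tensor_rep (hook_rep j m) (hook_rep k n))"
    and \<sigma>: "\<sigma> permutes {1..m}" and \<tau>: "\<tau> permutes {1..n}"
  shows "eval_tabloid_pairs m n (action (tensor_rep (hook_rep j m) (hook_rep k n)) (\<sigma>, \<tau>) F) =
    (\<lambda>(xs, ys). eval_tabloid_pairs m n F (map (inv_into UNIV \<sigma>) xs, map (inv_into UNIV \<tau>) ys))"
proof (cases "j \<le> m \<and> k \<le> n")
  case True
  then show ?thesis
    using hook_tabloid_permute[OF permutes_inv[OF \<sigma>]] hook_tabloid_permute[OF permutes_inv[OF \<tau>]]
    by (auto simp: tensor_rep_def hook_rep_hook eval_tabloid_pairs_def fun_eq_iff)
next
  \<comment> \<open>A factor that is the zero module carries the identity action in place of the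
    permutation action. The formula survives because the tensor product is then zero.\<close>
  case False
  then have "{outer u v | u v. u \<in> carrier (hook_rep j m) \<and> v \<in> carrier (hook_rep k n)} \<subseteq> {0}"
    by (auto simp: hook_rep_def outer_def zero_fun_def)
  then have "carrier (tensor_rep (hook_rep j m) (hook_rep k n)) \<subseteq> {0}"
    unfolding carrier_tensor_rep by (rule rat_fun.span_minimal) (rule rat_fun.subspace_single_0)
  then have "F = (\<lambda>_. 0)" using F by (auto simp: zero_fun_def)
  then show ?thesis
    by (auto simp: tensor_rep_def eval_tabloid_pairs_def fun_eq_iff hook_rep_def specht_def)
qed

end


section \<open>The decomposition and its dimensions\<close>

context
  fixes A :: "'a set" and B :: "'b set" and L :: nat
  assumes fin: "finite A" "finite B" and ne: "A \<noteq> {}" "B \<noteq> {}"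
    and L: "L + 2 \<le> card A + card B"
begin

lemma subspace_avoiding_cycles: "rat_fun.subspace (avoiding A B L \<inter> alt_cycles (A <+> B) L)"
proof (rule rat_fun.subspace_inter[OF _ subspace_alt_cycles])
  note av = avoiding_def[OF fin ne]
  show "rat_fun.subspace (avoiding A B L)"
  proof (rule rat_fun.subspaceI)
    show "0 \<in> avoiding A B L"
      using rat_fun.subspace_0[OF subspace_alt_chains] by (simp add: av)
    show "c + c' \<in> avoiding A B L" if "c \<in> avoiding A B L" "c' \<in> avoiding A B L" for c c'
      using that rat_fun.subspace_add[OF subspace_alt_chains, of c "A <+> B" L c'] by (auto simp: av)
    show "scale_fun r c \<in> avoiding A B L" if "c \<in> avoiding A B L" for r c
      using that rat_fun.subspace_scale[OF subspace_alt_chains, of c "A <+> B" L r] by (auto simp: av)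
  qed
qed

lemma subspace_parts: "rat_fun.subspace (right_part A B L)" "rat_fun.subspace (left_part A B L)"
  unfolding right_part_def[OF fin ne] left_part_def[OF fin ne]
  by (rule rat_fun_pair.linear_subspace_image[OF linear_outer_left]
      rat_fun_pair.linear_subspace_image[OF linear_outer_right],
      simp add: subspace_alt_cycles rat_fun.subspace_single_0)+

text \<open>On simplices containing \<open>B\<close> both \<open>c\<close> and the left part vanish,
  hence so does the right part, which is detected there. The mirror argument removes the left part
  and leaves \<open>c = 0\<close>.\<close>

lemma decomposition_trivial_kernel:
  assumes c: "c \<in> avoiding A B L" and F: "F \<in> right_part A B L" and G: "G \<in> left_part A B L"
    and sum: "c + cross A B F + cross A B G = 0"
  shows "c = 0" "F = 0" "G = 0"
proof -
  have c0: "c zs = 0" if "Inl ` A \<subseteq> set zs \<or> Inr ` B \<subseteq> set zs" for zs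
    using c that by (auto simp: avoiding_def[OF fin ne])
  have eval: "c zs + cross A B F zs + cross A B G zs = 0" for zs
    using fun_cong[OF sum, of zs] by simp
  show F0: "F = 0"
  proof (rule cross_right_part(3)[OF fin ne F L])
    fix zs :: "('a + 'b) list" assume "Inr ` B \<subseteq> set zs"
    then show "cross A B F zs = 0"
      using eval[of zs] c0[of zs] cross_left_part(2)[OF fin ne G L, of zs] by simp
  qed
  show G0: "G = 0"
  proof (rule cross_left_part(3)[OF fin ne G L])
    fix zs :: "('a + 'b) list" assume "Inl ` A \<subseteq> set zs"
    then show "cross A B G zs = 0"
      using eval[of zs] c0[of zs] cross_right_part(2)[OF fin ne F L, of zs] by simp
  qed
  have "cross A B 0 = 0" by (rule rat_fun_pair.linear_0[OF linear_cross])
  then show "c = 0" using sum unfolding F0 G0 by simp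
qed

lemma decomposition_bij:
  "bij_betw (\<lambda>(c, F, G). c + cross A B F + cross A B G)
     ((avoiding A B L \<inter> alt_cycles (A <+> B) L) \<times> right_part A B L \<times> left_part A B L)
     (alt_cycles (A <+> B) L)"
proof (rule bij_betw_imageI)
  let ?Z = "avoiding A B L \<inter> alt_cycles (A <+> B) L"
  let ?D = "?Z \<times> right_part A B L \<times> left_part A B L"
  let ?f = "\<lambda>(c, F, G). c + cross A B F + cross A B G"
  show "inj_on ?f ?D"
  proof (rule inj_onI)
    fix x x' assume x: "x \<in> ?D" "x' \<in> ?D" "?f x = ?f x'"
    obtain c F G c' F' G' where xx': "x = (c, F, G)" "x' = (c', F', G')"
      by (metis prod_cases3)
    with x have mem: "c \<in> avoiding A B L" "c \<in> alt_cycles (A <+> B) L"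
      "F \<in> right_part A B L" "G \<in> left_part A B L"
      "c' \<in> avoiding A B L" "c' \<in> alt_cycles (A <+> B) L"
      "F' \<in> right_part A B L" "G' \<in> left_part A B L"
      and eq: "c + cross A B F + cross A B G = c' + cross A B F' + cross A B G'" by simp_all
    have "c - c' \<in> ?Z" using mem by (intro rat_fun.subspace_diff[OF subspace_avoiding_cycles]) auto
    then have d: "c - c' \<in> avoiding A B L" by blast
    have dF: "F - F' \<in> right_part A B L" and dG: "G - G' \<in> left_part A B L"
      by (rule rat_fun.subspace_diff[OF subspace_parts(1) mem(3,7)]
          rat_fun.subspace_diff[OF subspace_parts(2) mem(4,8)])+
    have "(c - c') + cross A B (F - F') + cross A B (G - G') = 0"
      using eq by (simp add: rat_fun_pair.linear_diff[OF linear_cross] algebra_simps)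
    from decomposition_trivial_kernel[OF d dF dG this]
    show "x = x'" unfolding xx' by simp
  qed
  show "?f ` ?D = alt_cycles (A <+> B) L"
  proof
    show "?f ` ?D \<subseteq> alt_cycles (A <+> B) L"
    proof clarify
      fix c F G
      assume mem: "c \<in> alt_cycles (A <+> B) L" "F \<in> right_part A B L" "G \<in> left_part A B L"
      show "c + cross A B F + cross A B G \<in> alt_cycles (A <+> B) L"
        by (intro rat_fun.subspace_add[OF subspace_alt_cycles] mem(1)
            cross_right_part(1)[OF fin ne mem(2) L] cross_left_part(1)[OF fin ne mem(3) L])
    qed
    show "alt_cycles (A <+> B) L \<subseteq> ?f ` ?D"
    proof
      fix y assume y: "y \<in> alt_cycles (A <+> B) L"
      then have "y \<in> alt_chains (A <+> B) L" "\<And>zs. bdry (A <+> B) y zs = 0"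
        by (auto simp: alt_cycles_def)
      then obtain c F G where c: "c \<in> avoiding A B L" and FG: "F \<in> right_part A B L" "G \<in> left_part A B L"
        and yeq: "y = c + cross A B F + cross A B G"
        using decompose_chain[OF fin ne _ L] by blast
      \<comment> \<open>\<open>decompose_chain\<close> only makes \<open>c\<close> a chain of the
        complex; it is a cycle because the other terms are.\<close>
      have "c = y - cross A B F - cross A B G" using yeq by simp
      moreover have "y - cross A B F - cross A B G \<in> alt_cycles (A <+> B) L"
        by (intro rat_fun.subspace_diff[OF subspace_alt_cycles] y
            cross_right_part(1)[OF fin ne FG(1) L] cross_left_part(1)[OF fin ne FG(2) L])
      ultimately have "(c, F, G) \<in> ?D" using c FG by simp
      then show "y \<in> ?f ` ?D" unfolding yeq by (intro image_eqI[of _ _ "(c, F, G)"]) simp_all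
    qed
  qed
qed

lemma dim_cross_parts:
  "rat_fun.dim (cross A B ` right_part A B L) = (if card B \<le> L then (card A - 1) choose (L - card B) else 0)"
  "fin_dim (cross A B ` right_part A B L)"
  "rat_fun.dim (cross A B ` left_part A B L) = (if card A \<le> L then (card B - 1) choose (L - card A) else 0)"
  "fin_dim (cross A B ` left_part A B L)"
proof -
  let ?U = "if card B \<le> L then alt_cycles A (L - card B) else {0}"
  let ?W = "if card A \<le> L then alt_cycles B (L - card A) else {0}"
  let ?R = "cross A B \<circ> (\<lambda>u. outer u (top_cycle B))" and ?T = "cross A B \<circ> outer (top_cycle A)"
  have R: "cross A B ` right_part A B L = ?R ` ?U" and T: "cross A B ` left_part A B L = ?T ` ?W"
    unfolding right_part_def[OF fin ne] left_part_def[OF fin ne] by (simp_all only: image_comp)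
  have linR: "Vector_Spaces.linear scale_fun scale_fun ?R"
    by (rule Vector_Spaces.linear_compose[OF linear_outer_left linear_cross])
  have linT: "Vector_Spaces.linear scale_fun scale_fun ?T"
    by (rule Vector_Spaces.linear_compose[OF linear_outer_right linear_cross])
  have U: "?U \<subseteq> alt_cycles A (L - card B)" and W: "?W \<subseteq> alt_cycles B (L - card A)"
    using rat_fun.subspace_0[OF subspace_alt_cycles] by auto
  have finU: "fin_dim ?U" and finW: "fin_dim ?W"
    using fin by (simp_all add: fin_dim_alt_cycles fin_dim_zero)
  have injR: "inj_on ?R ?U"
  proof (rule inj_onI, rule ext)
    fix u u' xs assume u: "u \<in> ?U" "u' \<in> ?U" "?R u = ?R u'"
    have "u \<in> alt_cycles A (L - card B)" "u' \<in> alt_cycles A (L - card B)" using u U by blast+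
    from cross_top_right[OF fin ne this(1), of xs] cross_top_right[OF fin ne this(2), of xs]
    show "u xs = u' xs" using fun_cong[OF u(3), of "map Inl xs @ map Inr (list_of B)"] by simp
  qed
  have injT: "inj_on ?T ?W"
  proof (rule inj_onI, rule ext)
    fix v v' ys assume v: "v \<in> ?W" "v' \<in> ?W" "?T v = ?T v'"
    have "v \<in> alt_cycles B (L - card A)" "v' \<in> alt_cycles B (L - card A)" using v W by blast+
    from cross_top_left[OF fin ne this(1), of ys] cross_top_left[OF fin ne this(2), of ys]
    show "v ys = v' ys" using fun_cong[OF v(3), of "map Inl (list_of A) @ map Inr ys"] by simp
  qed
  show "rat_fun.dim (cross A B ` right_part A B L) = (if card B \<le> L then (card A - 1) choose (L - card B) else 0)"
    unfolding R dim_inj_image[OF linR finU injR] by (simp add: dim_alt_cycles fin ne dim_zero)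
  show "rat_fun.dim (cross A B ` left_part A B L) = (if card A \<le> L then (card B - 1) choose (L - card A) else 0)"
    unfolding T dim_inj_image[OF linT finW injT] by (simp add: dim_alt_cycles fin ne dim_zero)
  show "fin_dim (cross A B ` right_part A B L)" unfolding R by (rule fin_dim_image[OF linR finU])
  show "fin_dim (cross A B ` left_part A B L)" unfolding T by (rule fin_dim_image[OF linT finW])
qed

lemma fin_dim_avoiding_cycles: "fin_dim (avoiding A B L \<inter> alt_cycles (A <+> B) L)"
  by (rule fin_dim_subset[OF fin_dim_alt_cycles[of "A <+> B" L] subspace_avoiding_cycles])
    (simp_all add: fin)

text \<open>Counted inside the cycles on the disjoint union, where the two parts enter through their
  images under \<open>cross\<close>. The additive form keeps truncated subtraction away from the
  binomial coefficients.\<close>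

lemma dim_avoiding_cycles:
  "rat_fun.dim (avoiding A B L \<inter> alt_cycles (A <+> B) L)
    + (if card B \<le> L then (card A - 1) choose (L - card B) else 0)
    + (if card A \<le> L then (card B - 1) choose (L - card A) else 0)
    = (card A + card B - 1) choose L"
proof -
  let ?Z = "avoiding A B L \<inter> alt_cycles (A <+> B) L"
  let ?R = "cross A B ` right_part A B L" and ?T = "cross A B ` left_part A B L"
  let ?ZR = "{c + r | c r. c \<in> ?Z \<and> r \<in> ?R}"
  have zero: "cross A B 0 = 0" by (rule rat_fun_pair.linear_0[OF linear_cross])
  have mem0: "0 \<in> ?Z" "0 \<in> right_part A B L" "0 \<in> left_part A B L"
    by (rule rat_fun.subspace_0[OF subspace_avoiding_cycles]
        rat_fun.subspace_0[OF subspace_parts(1)] rat_fun.subspace_0[OF subspace_parts(2)])+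
  have "cross A B 0 \<in> ?R" "cross A B 0 \<in> ?T" by (intro imageI mem0)+
  then have mem0': "0 \<in> ?R" "0 \<in> ?T" by (simp_all only: zero)
  have neg: "cross A B (- F) = - cross A B F" for F
    by (rule rat_fun_pair.linear_neg[OF linear_cross])
  have "?Z \<inter> ?R \<subseteq> {0}"
  proof
    fix x assume "x \<in> ?Z \<inter> ?R"
    then obtain F where x: "x = cross A B F" and c: "cross A B F \<in> avoiding A B L"
      and F: "F \<in> right_part A B L" by blast
    have "cross A B F + cross A B (- F) + cross A B 0 = 0" unfolding neg zero by simp
    from decomposition_trivial_kernel(1)[OF c rat_fun.subspace_neg[OF subspace_parts(1) F] mem0(3) this]
    show "x \<in> {0}" unfolding x by simp
  qed
  then have ZR: "?Z \<inter> ?R = {0}" using mem0(1) mem0'(1) by blast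
  have "?ZR \<inter> ?T \<subseteq> {0}"
  proof
    fix x assume "x \<in> ?ZR \<inter> ?T"
    then obtain c F G where x: "x = c + cross A B F" and c: "c \<in> avoiding A B L"
      and F: "F \<in> right_part A B L" and G: "G \<in> left_part A B L"
      and eq: "c + cross A B F = cross A B G" by blast
    have "c + cross A B F + cross A B (- G) = 0" unfolding neg eq by simp
    from decomposition_trivial_kernel(1,2)[OF c F rat_fun.subspace_neg[OF subspace_parts(2) G] this]
    show "x \<in> {0}" unfolding x using zero by simp
  qed
  moreover have "0 \<in> ?ZR" using mem0(1) mem0'(1) by (metis (mono_tags, lifting) add_0 mem_Collect_eq)
  ultimately have ZRT: "?ZR \<inter> ?T = {0}" using mem0'(2) by blast
  have "{y + t | y t. y \<in> ?ZR \<and> t \<in> ?T} = alt_cycles (A <+> B) L"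
  proof -
    have "{y + t | y t. y \<in> ?ZR \<and> t \<in> ?T} = (\<lambda>(c, F, G). c + cross A B F + cross A B G) `
        (?Z \<times> right_part A B L \<times> left_part A B L)"
    proof (intro equalityI subsetI)
      fix x assume "x \<in> {y + t | y t. y \<in> ?ZR \<and> t \<in> ?T}"
      then obtain c F G where "x = c + cross A B F + cross A B G"
        "(c, F, G) \<in> ?Z \<times> right_part A B L \<times> left_part A B L" by blast
      then show "x \<in> (\<lambda>(c, F, G). c + cross A B F + cross A B G) `
        (?Z \<times> right_part A B L \<times> left_part A B L)" by (intro image_eqI[of _ _ "(c, F, G)"]) simp_all
    next
      fix x assume "x \<in> (\<lambda>(c, F, G). c + cross A B F + cross A B G) `
        (?Z \<times> right_part A B L \<times> left_part A B L)"
      then obtain c F G where "x = c + cross A B F + cross A B G"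
        "c \<in> ?Z" "F \<in> right_part A B L" "G \<in> left_part A B L" by auto
      then show "x \<in> {y + t | y t. y \<in> ?ZR \<and> t \<in> ?T}" by blast
    qed
    then show ?thesis using decomposition_bij by (simp add: bij_betw_def)
  qed
  then have "rat_fun.dim (alt_cycles (A <+> B) L) = rat_fun.dim ?Z + rat_fun.dim ?R + rat_fun.dim ?T"
    using dim_direct_sum(1)[OF dim_direct_sum(2)[OF fin_dim_avoiding_cycles dim_cross_parts(2) ZR]
        dim_cross_parts(4) ZRT]
      dim_direct_sum(1)[OF fin_dim_avoiding_cycles dim_cross_parts(2) ZR] by simp
  moreover have "rat_fun.dim (alt_cycles (A <+> B) L) = (card A + card B - 1) choose L"
    using dim_alt_cycles[of "A <+> B" L] fin ne by (simp add: card_Plus)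
  ultimately show ?thesis by (simp add: dim_cross_parts(1,3))
qed

end


section \<open>The Young embedding\<close>

text \<open>Placing 0 on the left keeps the map injective on all of \<open>nat\<close>, as
  \<open>alt_cycles_relabel\<close> requires, and agrees with the case distinction in
  \<open>young_embedding\<close>.\<close>

definition split_vertex :: "nat \<Rightarrow> nat \<Rightarrow> nat + nat" where
  "split_vertex m x = (if x \<le> m then Inl x else Inr (x - m))"

lemma inj_split_vertex: "inj (split_vertex m)"
  by (rule injI) (auto simp: split_vertex_def split: if_splits)

lemma split_vertex_bij: "bij_betw (split_vertex m) {1..m + n} ({1..m} <+> {1..n})"
proof (rule bij_betw_imageI)
  show "inj_on (split_vertex m) {1..m + n}" using inj_split_vertex inj_on_subset by blast
  show "split_vertex m ` {1..m + n} = {1..m} <+> {1..n}"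
  proof
    show "split_vertex m ` {1..m + n} \<subseteq> {1..m} <+> {1..n}" by (auto simp: split_vertex_def)
    show "{1..m} <+> {1..n} \<subseteq> split_vertex m ` {1..m + n}"
    proof
      fix z :: "nat + nat" assume z: "z \<in> {1..m} <+> {1..n}"
      show "z \<in> split_vertex m ` {1..m + n}"
      proof (cases z rule: sum.exhaust)
        case (Inl x)
        then show ?thesis using z by (intro image_eqI[of _ _ x]) (auto simp: split_vertex_def)
      next
        case (Inr y)
        then show ?thesis using z by (intro image_eqI[of _ _ "m + y"]) (auto simp: split_vertex_def)
      qed
    qed
  qed
qed

context
  fixes m n :: nat and \<sigma> \<tau> :: "nat \<Rightarrow> nat"
  assumes \<sigma>: "\<sigma> permutes {1..m}" and \<tau>: "\<tau> permutes {1..n}"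
begin

lemma permutes_bounds: "x \<le> m \<Longrightarrow> \<sigma> x \<le> m" "0 < x \<Longrightarrow> 0 < \<tau> x"
proof -
  show "\<sigma> x \<le> m" if "x \<le> m"
    using that permutes_in_image[OF \<sigma>, of x] permutes_not_in[OF \<sigma>, of x] by (cases "x = 0") auto
  show "0 < \<tau> x" if "0 < x"
    using that permutes_in_image[OF \<tau>, of x] permutes_not_in[OF \<tau>, of x] by (cases "x \<le> n") auto
qed

text \<open>The Young embedding is \<open>map_sum\<close> seen through an injective relabelling. Its
  inverse and bijectivity are read off from this.\<close>

lemma split_young: "split_vertex m (young_embedding m (\<sigma>, \<tau>) x) = map_sum \<sigma> \<tau> (split_vertex m x)"
proof (cases "x \<le> m")
  case True
  then show ?thesis using permutes_bounds(1)[of x] by (simp add: split_vertex_def young_embedding_def)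
next
  case False
  then show ?thesis using permutes_bounds(2)[of "x - m"] by (simp add: split_vertex_def young_embedding_def)
qed

lemma young_fixes:
  assumes "x \<notin> {1..m + n}"
  shows "young_embedding m (\<sigma>, \<tau>) x = x"
proof (cases "x = 0")
  case True
  then show ?thesis using permutes_not_in[OF \<sigma>, of x] by (simp add: young_embedding_def)
next
  case False
  then have x: "m + n < x" using assms by auto
  then have "\<tau> (x - m) = x - m" by (intro permutes_not_in[OF \<tau>]) auto
  then show ?thesis using x by (simp add: young_embedding_def)
qed

lemma inv_map_sum: "inv_into UNIV (map_sum \<sigma> \<tau>) = map_sum (inv_into UNIV \<sigma>) (inv_into UNIV \<tau>)"
proof (rule inv_unique_comp)
  show "map_sum \<sigma> \<tau> \<circ> map_sum (inv_into UNIV \<sigma>) (inv_into UNIV \<tau>) = id"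
    by (rule ext) (simp add: sum.map_comp permutes_inv_o[OF \<sigma>] permutes_inv_o[OF \<tau>] sum.map_id)
  show "map_sum (inv_into UNIV \<sigma>) (inv_into UNIV \<tau>) \<circ> map_sum \<sigma> \<tau> = id"
    by (rule ext) (simp add: sum.map_comp permutes_inv_o[OF \<sigma>] permutes_inv_o[OF \<tau>] sum.map_id)
qed

end

lemma young_inverse:
  assumes "\<sigma> permutes {1..m}" "\<tau> permutes {1..n}" "\<sigma>' permutes {1..m}" "\<tau>' permutes {1..n}"
    and "\<sigma>' \<circ> \<sigma> = id" "\<tau>' \<circ> \<tau> = id"
  shows "young_embedding m (\<sigma>', \<tau>') \<circ> young_embedding m (\<sigma>, \<tau>) = id"
proof
  fix x
  have "split_vertex m (young_embedding m (\<sigma>', \<tau>') (young_embedding m (\<sigma>, \<tau>) x))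
    = map_sum (\<sigma>' \<circ> \<sigma>) (\<tau>' \<circ> \<tau>) (split_vertex m x)"
    unfolding split_young[OF assms(3,4)] split_young[OF assms(1,2)] by (simp add: sum.map_comp)
  also have "\<dots> = split_vertex m x" using assms(5,6) by (simp add: sum.map_id)
  finally have "young_embedding m (\<sigma>', \<tau>') (young_embedding m (\<sigma>, \<tau>) x) = x"
    by (rule injD[OF inj_split_vertex])
  then show "(young_embedding m (\<sigma>', \<tau>') \<circ> young_embedding m (\<sigma>, \<tau>)) x = id x" by simp
qed

lemma young_permutes:
  assumes \<sigma>: "\<sigma> permutes {1..m}" and \<tau>: "\<tau> permutes {1..n}"
  shows "young_embedding m (\<sigma>, \<tau>) permutes {1..m + n}"
    and "inv_into UNIV (young_embedding m (\<sigma>, \<tau>)) = young_embedding m (inv_into UNIV \<sigma>, inv_into UNIV \<tau>)"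
proof -
  let ?y = "young_embedding m (\<sigma>, \<tau>)" and ?y' = "young_embedding m (inv_into UNIV \<sigma>, inv_into UNIV \<tau>)"
  note inv = permutes_inv[OF \<sigma>] permutes_inv[OF \<tau>]
  have 1: "?y' \<circ> ?y = id"
    by (rule young_inverse[OF \<sigma> \<tau> inv permutes_inv_o(2)[OF \<sigma>] permutes_inv_o(2)[OF \<tau>]])
  have 2: "?y \<circ> ?y' = id"
    by (rule young_inverse[OF inv \<sigma> \<tau> permutes_inv_o(1)[OF \<sigma>] permutes_inv_o(1)[OF \<tau>]])
  have "bij ?y" using 1 2 by (rule o_bij)
  then show "?y permutes {1..m + n}"
    unfolding permutes_def using young_fixes[OF \<sigma> \<tau>] by (auto simp: bij_iff)
  show "inv_into UNIV ?y = ?y'" by (rule inv_unique_comp[OF 2 1])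
qed

lemma young_inv_split:
  assumes "\<sigma> permutes {1..m}" "\<tau> permutes {1..n}"
  shows "map (split_vertex m) (map (inv_into UNIV (young_embedding m (\<sigma>, \<tau>))) xs) =
    map (map_sum (inv_into UNIV \<sigma>) (inv_into UNIV \<tau>)) (map (split_vertex m) xs)"
  unfolding young_permutes(2)[OF assms]
  by (simp add: split_young[OF permutes_inv[OF assms(1)] permutes_inv[OF assms(2)]])


section \<open>The two tensor products as summands of the cycle space\<close>

lemma tensor_right_part:
  assumes "1 \<le> m" "1 \<le> n" "1 \<le> k" "k \<le> m + n"
  shows "bij_betw (eval_tabloid_pairs m n) (carrier (tensor_rep (hook_rep k m) (sign_rep n)))
    (right_part {1..m} {1..n} (m + n - k))"
proof (rule bij_betw_imageI)
  have ne: "{1..m} \<noteq> {}" "{1..n} \<noteq> {}" using assms(1,2) by auto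
  have top: "hook_cycles 1 n = alt_cycles {1..n} (card {1..n} - 1)"
    using assms(2) by (simp add: hook_cycles_def)
  show "inj_on (eval_tabloid_pairs m n) (carrier (tensor_rep (hook_rep k m) (sign_rep n)))"
    unfolding sign_rep_eq_hook_rep[OF assms(2)] by (rule eval_tensor_hook_inj[OF assms(3) order_refl])
  show "eval_tabloid_pairs m n ` carrier (tensor_rep (hook_rep k m) (sign_rep n)) =
      right_part {1..m} {1..n} (m + n - k)"
    unfolding sign_rep_eq_hook_rep[OF assms(2)] eval_tensor_hook_image[OF assms(3) order_refl] top
      span_outer_top_right[OF finite_atLeastAtMost ne(2) subspace_hook_cycles]
      right_part_def[OF finite_atLeastAtMost finite_atLeastAtMost ne]
    \<comment> \<open>For \<open>L = m + n - k\<close> one has \<open>L - n = m - k\<close>, and the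
      zero module for \<open>m < k\<close> is the case \<open>L < n\<close> of
      \<open>right_part\<close>.\<close>
    using assms(4) by (auto simp: hook_cycles_def)
qed

lemma tensor_left_part:
  assumes "1 \<le> m" "1 \<le> n" "1 \<le> k" "k \<le> m + n"
  shows "bij_betw (eval_tabloid_pairs m n) (carrier (tensor_rep (sign_rep m) (hook_rep k n)))
    (left_part {1..m} {1..n} (m + n - k))"
proof (rule bij_betw_imageI)
  have ne: "{1..m} \<noteq> {}" "{1..n} \<noteq> {}" using assms(1,2) by auto
  have top: "hook_cycles 1 m = alt_cycles {1..m} (card {1..m} - 1)"
    using assms(1) by (simp add: hook_cycles_def)
  show "inj_on (eval_tabloid_pairs m n) (carrier (tensor_rep (sign_rep m) (hook_rep k n)))"
    unfolding sign_rep_eq_hook_rep[OF assms(1)] by (rule eval_tensor_hook_inj[OF order_refl assms(3)])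
  show "eval_tabloid_pairs m n ` carrier (tensor_rep (sign_rep m) (hook_rep k n)) =
      left_part {1..m} {1..n} (m + n - k)"
    unfolding sign_rep_eq_hook_rep[OF assms(1)] eval_tensor_hook_image[OF order_refl assms(3)] top
      span_outer_top_left[OF finite_atLeastAtMost ne(1) subspace_hook_cycles]
      left_part_def[OF finite_atLeastAtMost finite_atLeastAtMost ne]
    using assms(4) by (auto simp: hook_cycles_def)
qed

lemma eval_tabloid_pairs_add:
  "eval_tabloid_pairs m n (\<lambda>x. F x + G x) = eval_tabloid_pairs m n F + eval_tabloid_pairs m n G"
  by (auto simp: eval_tabloid_pairs_def)

lemma eval_tabloid_pairs_scale:
  "eval_tabloid_pairs m n (\<lambda>x. c * F x) = scale_fun c (eval_tabloid_pairs m n F)"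
  by (auto simp: eval_tabloid_pairs_def)

lemma tensor_rep_simps:
  "f \<oplus>\<^bsub>tensor_rep M N\<^esub> g = (\<lambda>x. f x + g x)" "c \<odot>\<^bsub>tensor_rep M N\<^esub> f = (\<lambda>x. c * f x)"
  by (simp_all add: tensor_rep_def)

theorem theorem6p2:
  fixes m n k :: nat
  assumes "m \<ge> 1" and "n \<ge> 1" and "k \<ge> 2" and "m + n > k"
  defines "\<Delta> \<equiv> cut_complex k (graph_sum (complete_graph {1..m}) (complete_graph {1..n}))"
  defines "G \<equiv> sym_group m \<times>\<times> sym_group n"
  defines "H \<equiv> homology_rep (\<lambda>(\<sigma>, \<tau>). map_sum \<sigma> \<tau>) \<Delta>"
  defines "d \<equiv> int m + int n - int k - 1"
  shows "shellable \<Delta> \<and> complex_dim \<Delta> = d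
    \<and> carrier (H d) \<noteq> {\<zero>\<^bsub>H d\<^esub>}
    \<and> (\<forall>p. p \<noteq> d \<longrightarrow> carrier (H p) = {\<zero>\<^bsub>H p\<^esub>})
    \<and> rep_iso G
        (dsum_rep (H d)
          (dsum_rep (tensor_rep (hook_rep k m) (sign_rep n))
                    (tensor_rep (sign_rep m) (hook_rep k n))))
        (restrict_rep (young_embedding m) (hook_rep k (m + n)))
    \<and> (\<exists>b. has_dim (H d) b \<and>
        int b = int ((m + n - 1) choose (k - 1))
              - int ((m - 1) choose (k - 1)) - int ((n - 1) choose (k - 1)))"
proof -
  let ?A = "{1..m}" and ?B = "{1..n}"
  define L where "L = m + n - k"
  have fin: "finite ?A" "finite ?B" and ne: "?A \<noteq> {}" "?B \<noteq> {}" using assms(1,2) by auto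
  have L: "L + 2 \<le> card ?A + card ?B" and kL: "k = card ?A + card ?B - L" and k1: "1 \<le> k"
    using assms(3,4) by (auto simp: L_def)
  have d: "d = int L - 1" using assms(4) by (simp add: d_def L_def)
  have \<Delta>: "\<Delta> = join_skeleton ?A ?B L"
    unfolding \<Delta>_def by (subst kL) (rule cut_complex_graph_sum[OF fin ne L])

  define Z where "Z = avoiding ?A ?B L \<inter> alt_cycles (?A <+> ?B) L"
  define \<rho> where "\<rho> = (\<lambda>(g :: (nat \<Rightarrow> nat) \<times> (nat \<Rightarrow> nat)) (c :: (nat + nat) list \<Rightarrow> rat) xs.
    c (map (inv_into UNIV ((\<lambda>(\<sigma>, \<tau>). map_sum \<sigma> \<tau>) g)) xs))"
  have "cycles \<Delta> d = Z" unfolding \<Delta> d Z_def by (rule cycles_join_skeleton[OF fin ne L order_refl])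
  moreover have "boundaries \<Delta> d = {\<lambda>_. 0}" unfolding \<Delta> d by (rule boundaries_top[OF fin ne L])
  ultimately have Hd: "H d = quotient_rep (fun_rep Z \<rho>) {\<lambda>_. 0}"
    by (simp add: H_def homology_rep_def \<rho>_def)
  have Z: "rat_fun.subspace Z" unfolding Z_def by (rule subspace_avoiding_cycles[OF fin ne L])

  have hom_zero: "carrier (H p) = {\<zero>\<^bsub>H p\<^esub>}" if "p \<noteq> d" for p
  proof -
    have "boundaries \<Delta> p = cycles \<Delta> p"
      unfolding \<Delta> by (rule boundaries_eq_cycles[OF fin ne L]) (use that d in simp)
    then show ?thesis
      by (simp add: H_def homology_rep_def zero_quotient_rep quotient_rep_self[OF subspace_cycles])
  qed

  have dim_H: "has_dim (H d) (rat_fun.dim Z)"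
  proof (rule has_dim_iso[where M = "fun_module Z" and h = "\<lambda>c. {c}"])
    show "has_dim (fun_module Z) (rat_fun.dim Z)"
      unfolding Z_def by (rule has_dim_fun_module[OF fin_dim_avoiding_cycles[OF fin ne L]])
    show "lin_iso (\<lambda>c. {c}) (fun_module Z) (H d)"
      unfolding lin_iso_def Hd by (simp add: quotient_rep_zero bij_betw_def)
    show "u \<oplus>\<^bsub>fun_module Z\<^esub> v \<in> carrier (fun_module Z)"
      if "u \<in> carrier (fun_module Z)" "v \<in> carrier (fun_module Z)" for u v
      using that rat_fun.subspace_add[OF Z, of u v] by (simp add: plus_fun_def)
  qed
  have sym: "(r - 1) choose (r - k) = (r - 1) choose (k - 1)" if "k \<le> r" for r
    using that k1 binomial_symmetric[of "k - 1" "r - 1"] by simp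
  \<comment> \<open>The case distinction becomes the convention for binomial coefficients:
    \<open>L < s\<close> means \<open>r < k\<close>, when \<open>r - 1\<close> is less than
    \<open>k - 1\<close>.\<close>
  have part: "(if s \<le> L then (r - 1) choose (L - s) else 0) = (r - 1) choose (k - 1)"
    if "r + s = m + n" "1 \<le> r" for r s
  proof (cases "k \<le> r")
    case True
    then have "s \<le> L" "L - s = r - k" using that assms(4) by (auto simp: L_def)
    then show ?thesis using sym[OF True] by simp
  next
    case False
    then have "\<not> s \<le> L" "r - 1 < k - 1" using that assms(4) by (auto simp: L_def)
    then show ?thesis by simp
  qed
  have dim_Z: "rat_fun.dim Z + ((m - 1) choose (k - 1)) + ((n - 1) choose (k - 1)) = (m + n - 1) choose (k - 1)"
  proof -
    have "card ?A = m" "card ?B = n" by simp_all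
    then have "rat_fun.dim Z + (if n \<le> L then (m - 1) choose (L - n) else 0)
        + (if m \<le> L then (n - 1) choose (L - m) else 0) = (m + n - 1) choose L"
      using dim_avoiding_cycles[OF fin ne L] unfolding Z_def by (simp only:)
    moreover have "(m + n - 1) choose L = (m + n - 1) choose (k - 1)"
      unfolding L_def by (rule sym) (use assms(4) in simp)
    ultimately show ?thesis
      using part[OF refl assms(1)] part[OF add.commute assms(2)] by (simp only:)
  qed
  \<comment> \<open>The top homology is nonzero: subsets of size \<open>k - 1\<close> on either side
    of \<open>m\<close> miss those containing \<open>m\<close>. \<open>k >= 2\<close> makes the two
    families disjoint and leaves room for \<open>m\<close>.\<close>
  have "((m - 1) choose (k - 1)) + ((n - 1) choose (k - 1)) < (m + n - 1) choose (k - 1)"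
  proof -
    let ?S = "\<lambda>X :: nat set. {T. T \<subseteq> X \<and> card T = k - 1}"
    let ?X = "{1..<m}" and ?Y = "{m<..<m + n}" and ?V = "{1..<m + n}"
    have "?S ?X \<inter> ?S ?Y = {}"
    proof -
      have "?X \<inter> ?Y = {}" by auto
      then have "T = {}" if "T \<in> ?S ?X \<inter> ?S ?Y" for T using that by blast
      moreover have "{} \<notin> ?S ?X" using assms(3) by simp
      ultimately show ?thesis by blast
    qed
    then have "card (?S ?X) + card (?S ?Y) = card (?S ?X \<union> ?S ?Y)"
      by (intro card_Un_disjoint[symmetric]) auto
    also have "\<dots> < card (?S ?V)"
    proof (rule psubset_card_mono)
      have "card {m} \<le> k - 1" "k - 1 \<le> card ?V" "{m} \<subseteq> ?V" "finite ?V" using assms(1-4) by auto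
      from exists_subset_between[OF this] obtain T where T: "{m} \<subseteq> T" "T \<subseteq> ?V" "card T = k - 1"
        by blast
      then have "T \<in> ?S ?V" "T \<notin> ?S ?X \<union> ?S ?Y" by auto
      moreover have "?X \<subseteq> ?V" "?Y \<subseteq> ?V" by auto
      then have "?S ?X \<union> ?S ?Y \<subseteq> ?S ?V" by blast
      ultimately show "?S ?X \<union> ?S ?Y \<subset> ?S ?V" by blast
    qed auto
    finally show ?thesis by (simp add: n_subsets)
  qed
  then have "rat_fun.dim Z > 0" using dim_Z by simp
  have hom_nonzero: "carrier (H d) \<noteq> {\<zero>\<^bsub>H d\<^esub>}"
  proof
    assume "carrier (H d) = {\<zero>\<^bsub>H d\<^esub>}"
    then have "(\<lambda>a. {a}) ` Z = {{\<lambda>_. 0}}" unfolding Hd by (simp add: quotient_rep_zero zero_quotient_rep)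
    then have "Z = {0}" by (auto simp: zero_fun_def)
    then show False using \<open>rat_fun.dim Z > 0\<close> by (simp add: dim_zero)
  qed

  let ?M1 = "tensor_rep (hook_rep k m) (sign_rep n)" and ?M2 = "tensor_rep (sign_rep m) (hook_rep k n)"
  let ?M = "dsum_rep (H d) (dsum_rep ?M1 ?M2)" and ?N = "restrict_rep (young_embedding m) (hook_rep k (m + n))"
  let ?ev = "eval_tabloid_pairs m n"
  \<comment> \<open>The legs of the cospan meet here: the Specht module arrives by evaluation on
    lists, the direct sum through the decomposition of cycles.\<close>
  define P where "P = alt_cycles {1..m + n} L"
  define \<Phi> where "\<Phi> = (\<lambda>(c, F, F'). c + cross ?A ?B F + cross ?A ?B F')"
  \<comment> \<open>Unwraps the homology class to its only representative, passes from tabloids to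
    lists, reassembles the cycle and moves its vertices to \<open>{1..m + n}\<close>.\<close>
  define \<Psi> where "\<Psi> = (\<lambda>(X, F, F') xs. \<Phi> (the_elem X, ?ev F, ?ev F') (map (split_vertex m) xs))"
  have km: "k \<le> m + n" using assms(4) by simp

  have rep: "rep_iso G ?M ?N"
  proof (rule rep_iso_cospan[where \<Psi> = \<Psi> and P = P and \<Theta> = "eval_tabloids (m + n)"
        and W = "{f. \<forall>X. X \<notin> range (hook_tabloid (m + n)) \<longrightarrow> f X = 0}"
        and \<rho> = "\<lambda>g z xs. z (map (inv_into UNIV (young_embedding m g)) xs)"])
    show "bij_betw \<Psi> (carrier ?M) P"
    proof -
      have "bij_betw the_elem ((\<lambda>a. {a}) ` Z) Z"
        by (rule bij_betw_byWitness[of _ "\<lambda>a. {a}"]) auto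
      then have 1: "bij_betw (map_prod the_elem (map_prod ?ev ?ev)) (carrier ?M)
        (Z \<times> right_part ?A ?B L \<times> left_part ?A ?B L)"
        unfolding dsum_rep_simps Hd quotient_rep_zero
        using tensor_right_part[OF assms(1,2) k1 km] tensor_left_part[OF assms(1,2) k1 km]
        unfolding L_def by (intro bij_betw_map_prod)
      have 2: "bij_betw \<Phi> (Z \<times> right_part ?A ?B L \<times> left_part ?A ?B L) (alt_cycles (?A <+> ?B) L)"
        unfolding \<Phi>_def Z_def by (rule decomposition_bij[OF fin ne L])
      have 3: "bij_betw (\<lambda>c xs. c (map (split_vertex m) xs)) (alt_cycles (?A <+> ?B) L) P"
        unfolding P_def by (rule alt_cycles_relabel[OF inj_split_vertex split_vertex_bij])
      have "\<Psi> = (\<lambda>c xs. c (map (split_vertex m) xs)) \<circ> (\<Phi> \<circ> map_prod the_elem (map_prod ?ev ?ev))"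
        by (auto simp: \<Psi>_def fun_eq_iff)
      then show ?thesis using bij_betw_trans[OF bij_betw_trans[OF 1 2] 3] by simp
    qed
    show "eval_tabloids (m + n) ` carrier ?N = P"
      using eval_hook_rep[OF k1, of "m + n"] km by (simp add: hook_cycles_def P_def L_def)
    show "carrier ?N \<subseteq> {f. \<forall>X. X \<notin> range (hook_tabloid (m + n)) \<longrightarrow> f X = 0}"
      using hook_rep_support[OF k1] by auto
    show "inj_on (eval_tabloids (m + n)) {f. \<forall>X. X \<notin> range (hook_tabloid (m + n)) \<longrightarrow> f X = 0}"
    proof (rule inj_onI, rule ext)
      fix f f' X
      assume f: "f \<in> {f. \<forall>X. X \<notin> range (hook_tabloid (m + n)) \<longrightarrow> f X = 0}"
        "f' \<in> {f. \<forall>X. X \<notin> range (hook_tabloid (m + n)) \<longrightarrow> f X = 0}"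
        "eval_tabloids (m + n) f = eval_tabloids (m + n) f'"
      show "f X = f' X"
      proof (cases "X \<in> range (hook_tabloid (m + n))")
        case True
        then obtain xs where "X = hook_tabloid (m + n) xs" by blast
        then show ?thesis using fun_cong[OF f(3), of xs] by (simp add: eval_tabloids_def)
      next
        case False
        then show ?thesis using f(1,2) by simp
      qed
    qed
    show "rat_fun.subspace P" unfolding P_def by (rule subspace_alt_cycles)
    have G: "\<exists>\<sigma> \<tau>. g = (\<sigma>, \<tau>) \<and> \<sigma> permutes ?A \<and> \<tau> permutes ?B" if "g \<in> carrier G" for g
      using that unfolding G_def DirProd_def by (auto simp: sym_group_carrier)
    have young: "young_embedding m g permutes {1..m + n}" if "g \<in> carrier G" for g
      using G[OF that] young_permutes(1) by blast
    show "(\<lambda>xs. z (map (inv_into UNIV (young_embedding m g)) xs)) \<in> P"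
      if "g \<in> carrier G" "z \<in> P" for g z
      using alt_cycles_relabel[OF permutes_inj permutes_imp_bij, OF permutes_inv permutes_inv,
          OF young young, OF that(1) that(1)] that(2)
      unfolding P_def by (rule bij_betw_apply)
    have M_cases: "\<exists>c F F'. u = ({c}, F, F') \<and> c \<in> Z \<and> F \<in> carrier ?M1 \<and> F' \<in> carrier ?M2"
      if "u \<in> carrier ?M" for u
      using that by (auto simp: Hd quotient_rep_zero)
    show "\<Psi> (u \<oplus>\<^bsub>?M\<^esub> v) = \<Psi> u + \<Psi> v" if u: "u \<in> carrier ?M" and v: "v \<in> carrier ?M" for u v
    proof -
      obtain a F F' b E E' where uv: "u = ({a}, F, F')" "v = ({b}, E, E')"
        using M_cases[OF u] M_cases[OF v] by blast
      show ?thesis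
        unfolding uv Hd
        by (auto simp: \<Psi>_def \<Phi>_def quotient_rep_zero tensor_rep_simps eval_tabloid_pairs_add cross_add)
    qed
    show "\<Psi> (c \<odot>\<^bsub>?M\<^esub> u) = scale_fun c (\<Psi> u)" if u: "u \<in> carrier ?M" for c u
    proof -
      obtain a F F' where u: "u = ({a}, F, F')" using M_cases[OF u] by blast
      show ?thesis
        unfolding u Hd
        by (auto simp: \<Psi>_def \<Phi>_def quotient_rep_zero tensor_rep_simps eval_tabloid_pairs_scale
            cross_scale algebra_simps)
    qed
    show "\<Psi> (action ?M g u) = (\<lambda>xs. \<Psi> u (map (inv_into UNIV (young_embedding m g)) xs))"
      if g: "g \<in> carrier G" and u: "u \<in> carrier ?M" for g u
    proof -
      obtain \<sigma> \<tau> where g: "g = (\<sigma>, \<tau>)" and \<sigma>: "\<sigma> permutes ?A" and \<tau>: "\<tau> permutes ?B"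
        using G[OF g] by blast
      obtain a F F' where u: "u = ({a}, F, F')" and F: "F \<in> carrier ?M1" and F': "F' \<in> carrier ?M2"
        using M_cases[OF u] by blast
      let ?h = "map_sum (inv_into UNIV \<sigma>) (inv_into UNIV \<tau>)"
      have 1: "?ev (action ?M1 (\<sigma>, \<tau>) F) = (\<lambda>(xs, ys). ?ev F (map (inv_into UNIV \<sigma>) xs, map (inv_into UNIV \<tau>) ys))"
        using eval_tensor_hook_action[OF k1 order_refl _ \<sigma> \<tau>] F unfolding sign_rep_eq_hook_rep[OF assms(2)] by blast
      have 2: "?ev (action ?M2 (\<sigma>, \<tau>) F') = (\<lambda>(xs, ys). ?ev F' (map (inv_into UNIV \<sigma>) xs, map (inv_into UNIV \<tau>) ys))"
        using eval_tensor_hook_action[OF order_refl k1 _ \<sigma> \<tau>] F' unfolding sign_rep_eq_hook_rep[OF assms(1)] by blast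
      have "\<rho> (\<sigma>, \<tau>) a = (\<lambda>zs. a (map ?h zs))"
        by (simp add: \<rho>_def inv_map_sum[OF \<sigma> \<tau>])
      \<comment> \<open>All three summands are precomposed with the same map \<open>?h\<close>;
        \<open>young_inv_split\<close> then carries it across the relabelling of vertices.\<close>
      then have "\<Psi> (action ?M g u) xs = \<Phi> (a, ?ev F, ?ev F') (map ?h (map (split_vertex m) xs))" for xs
        unfolding g u Hd dsum_rep_simps quotient_rep_zero \<Psi>_def prod.case the_elem_eq 1 2 \<Phi>_def
        by (simp only: plus_fun_apply cross_equivariant[OF permutes_inv[OF \<sigma>] permutes_inv[OF \<tau>]])
      moreover have "\<Psi> u (map (inv_into UNIV (young_embedding m g)) xs) =
          \<Phi> (a, ?ev F, ?ev F') (map ?h (map (split_vertex m) xs))" for xs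
        unfolding u g \<Psi>_def prod.case the_elem_eq young_inv_split[OF \<sigma> \<tau>] ..
      ultimately show ?thesis by (intro ext) simp
    qed
    show "f \<oplus>\<^bsub>?N\<^esub> f' \<in> {f. \<forall>X. X \<notin> range (hook_tabloid (m + n)) \<longrightarrow> f X = 0} \<and>
        eval_tabloids (m + n) (f \<oplus>\<^bsub>?N\<^esub> f') = eval_tabloids (m + n) f + eval_tabloids (m + n) f'"
      if "f \<in> carrier ?N" "f' \<in> carrier ?N" for f f'
      using that hook_rep_support[OF k1, of f "m + n"] hook_rep_support[OF k1, of f' "m + n"]
      by (auto simp: hook_rep_hook[OF km] eval_tabloids_def)
    show "c \<odot>\<^bsub>?N\<^esub> f \<in> {f. \<forall>X. X \<notin> range (hook_tabloid (m + n)) \<longrightarrow> f X = 0} \<and>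
        eval_tabloids (m + n) (c \<odot>\<^bsub>?N\<^esub> f) = scale_fun c (eval_tabloids (m + n) f)"
      if "f \<in> carrier ?N" for c f
      using that hook_rep_support[OF k1, of f "m + n"] by (auto simp: hook_rep_hook[OF km] eval_tabloids_def)
    show "action ?N g f \<in> {f. \<forall>X. X \<notin> range (hook_tabloid (m + n)) \<longrightarrow> f X = 0} \<and>
        eval_tabloids (m + n) (action ?N g f) =
          (\<lambda>xs. eval_tabloids (m + n) f (map (inv_into UNIV (young_embedding m g)) xs))"
      if g: "g \<in> carrier G" and f: "f \<in> carrier ?N" for g f
    proof
      let ?y = "young_embedding m g"
      note y = young[OF g]
      have act: "action ?N g f = (\<lambda>X. f (map (image (inv_into UNIV ?y)) X))"
        by (simp add: hook_rep_hook[OF km])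
      \<comment> \<open>The support condition is invariant: if the permuted list were a hook
        tabloid, permuting it back would make \<open>X\<close> one.\<close>
      have "f (map (image (inv_into UNIV ?y)) X) = 0" if X: "X \<notin> range (hook_tabloid (m + n))" for X
      proof (rule hook_rep_support[OF k1, of f "m + n"])
        show "f \<in> carrier (hook_rep k (m + n))" using f by simp
        show "map (image (inv_into UNIV ?y)) X \<notin> range (hook_tabloid (m + n))"
        proof
          assume "map (image (inv_into UNIV ?y)) X \<in> range (hook_tabloid (m + n))"
          then obtain xs where xs: "map (image (inv_into UNIV ?y)) X = hook_tabloid (m + n) xs" by blast
          have "X = map (image ?y) (map (image (inv_into UNIV ?y)) X)"
            by (simp add: comp_def image_image permutes_inverses(1)[OF y])
          also have "\<dots> = hook_tabloid (m + n) (map ?y xs)" unfolding xs by (rule hook_tabloid_permute[OF y])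
          finally show False using X by blast
        qed
      qed
      then show "action ?N g f \<in> {f. \<forall>X. X \<notin> range (hook_tabloid (m + n)) \<longrightarrow> f X = 0}"
        unfolding act by simp
      show "eval_tabloids (m + n) (action ?N g f) =
          (\<lambda>xs. eval_tabloids (m + n) f (map (inv_into UNIV ?y) xs))"
        unfolding act eval_tabloids_def hook_tabloid_permute[OF permutes_inv[OF y]] ..
    qed
  qed

  have "int (rat_fun.dim Z) = int ((m + n - 1) choose (k - 1))
      - int ((m - 1) choose (k - 1)) - int ((n - 1) choose (k - 1))"
    using dim_Z by linarith
  then show ?thesis
    using shellable_join_skeleton[OF fin ne L] complex_dim_join_skeleton[OF fin ne L]
      hom_nonzero hom_zero rep dim_H unfolding \<Delta>[symmetric] d[symmetric] by blast
qed

end
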